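(* Let $p_1\equiv p_2\equiv1\pmod4$ be primes, $k=\mathbb{Q}(\sqrt{2p_1p_2},i)$, $\mathbb{K}_1=k(\sqrt{p_1})$. Let $\varepsilon_2$ be the fundamental unit of $\mathbb{Q}(\sqrt{2p_2})$ and $\varepsilon_3=x+y\sqrt{2p_1p_2}$ that of $\mathbb{Q}(\sqrt{2p_1p_2})$. Assume $N(\varepsilon_2)=N(\varepsilon_3)=1$. If $x+1$ or $x-1$ is a perfect square in $\mathbb{N}$, then $|\ker J_{\mathbb{K}_1}|=4$; otherwise $|\ker J_{\mathbb{K}_1}|=2$.
   Context: $i=\sqrt{-1}$; $x,y\in\mathbb{Z}$; $N$ is the norm to $\mathbb{Q}$. $J_{\mathbb{K}_1}:\mathbf{C}_k\to\mathbf{C}_{\mathbb{K}_1}$ is the homomorphism of ideal class groups induced by extension of ideals, and $\ker J_{\mathbb{K}_1}$ is the group of classes of $k$ capitulating in $\mathbb{K}_1$. *)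

theory Defs
  imports "HOL-Computational_Algebra.Computational_Algebra"
begin

text \<open>Number fields are realised as subfields of the complex numbers.\<close>

definition is_subfield :: "complex set \<Rightarrow> bool" where
  "is_subfield F \<longleftrightarrow> 0 \<in> F \<and> 1 \<in> F \<and>
     (\<forall>a\<in>F. \<forall>b\<in>F. a + b \<in> F \<and> a - b \<in> F \<and> a * b \<in> F) \<and>
     (\<forall>a\<in>F. a \<noteq> 0 \<longrightarrow> inverse a \<in> F)"

definition field_gen :: "complex set \<Rightarrow> complex set" where
  "field_gen S = \<Inter>{F. is_subfield F \<and> S \<subseteq> F}"

definition ring_of_integers :: "complex set \<Rightarrow> complex set" where
  "ring_of_integers K = {z \<in> K. algebraic_int z}"

definition is_ideal_of :: "complex set \<Rightarrow> complex set \<Rightarrow> bool" where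
  "is_ideal_of R I \<longleftrightarrow> I \<subseteq> R \<and> 0 \<in> I \<and> (\<forall>a\<in>I. \<forall>b\<in>I. a + b \<in> I) \<and>
     (\<forall>a\<in>I. \<forall>r\<in>R. r * a \<in> I)"

definition nonzero_ideal_of :: "complex set \<Rightarrow> complex set \<Rightarrow> bool" where
  "nonzero_ideal_of R I \<longleftrightarrow> is_ideal_of R I \<and> I \<noteq> {0}"

definition principal_ideal_of :: "complex set \<Rightarrow> complex set \<Rightarrow> bool" where
  "principal_ideal_of R I \<longleftrightarrow> (\<exists>a\<in>R. I = (\<lambda>r. a * r) ` R)"

definition ideal_extension :: "complex set \<Rightarrow> complex set \<Rightarrow> complex set" where
  "ideal_extension R' I = \<Inter>{J. is_ideal_of R' J \<and> I \<subseteq> J}"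

definition same_ideal_class :: "complex set \<Rightarrow> (complex set \<times> complex set) set" where
  "same_ideal_class R = {(I, J). nonzero_ideal_of R I \<and> nonzero_ideal_of R J \<and>
      (\<exists>a\<in>R. \<exists>b\<in>R. a \<noteq> 0 \<and> b \<noteq> 0 \<and> (\<lambda>z. a * z) ` I = (\<lambda>z. b * z) ` J)}"

definition capitulation_kernel :: "complex set \<Rightarrow> complex set \<Rightarrow> complex set set set" where
  "capitulation_kernel k L =
     {I. nonzero_ideal_of (ring_of_integers k) I \<and>
         principal_ideal_of (ring_of_integers L) (ideal_extension (ring_of_integers L) I)}
     // same_ideal_class (ring_of_integers k)"

definition unit_of :: "complex set \<Rightarrow> complex \<Rightarrow> bool" where
  "unit_of K u \<longleftrightarrow> u \<in> ring_of_integers K \<and> u \<noteq> 0 \<and> inverse u \<in> ring_of_integers K"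

text \<open>Fundamental unit of the real quadratic field Q(sqrt d), d > 1 squarefree:
  the smallest unit greater than 1 (all its elements are real).\<close>
definition fundamental_unit :: "nat \<Rightarrow> complex \<Rightarrow> bool" where
  "fundamental_unit d \<epsilon> \<longleftrightarrow>
     (let K = field_gen {complex_of_real (sqrt (real d))} in
       unit_of K \<epsilon> \<and> Im \<epsilon> = 0 \<and> Re \<epsilon> > 1 \<and>
       (\<forall>u. unit_of K u \<and> Im u = 0 \<and> Re u > 1 \<longrightarrow> Re \<epsilon> \<le> Re u))"

end

theory Submission
  imports Defs "HOL-Computational_Algebra.Nth_Powers" "Jordan_Normal_Form.Char_Poly"
    "HOL-Analysis.Kronecker_Approximation_Theorem"
begin

text \<open>
  Write \<open>d = 2p\<^sub>1p\<^sub>2\<close>, \<open>k = \<rat>(\<surd>d, \<i>)\<close>, \<open>L = k(\<surd>p\<^sub>1)\<close> and let \<open>\<sigma>\<close> generate \<open>Gal(L/k)\<close>. If an ideal of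
  \<open>k\<close> becomes principal in \<open>L\<close> with generator \<open>\<alpha>\<close>, then \<open>\<sigma>(\<alpha>)/\<alpha>\<close> is a unit of relative norm 1, and this unit
  modulo the units \<open>\<sigma>(v)/v\<close> determines the ideal class. Three explicit square roots govern the units:
  \<open>2\<epsilon>\<^sub>2\<close> is a square in \<open>\<rat>(\<surd>(2p\<^sub>2))\<close>, every norm 1 unit of \<open>\<rat>(\<surd>p\<^sub>1)\<close> is a square up to sign, and one of
  \<open>2\<epsilon>\<^sub>3\<close>, \<open>2p\<^sub>1\<epsilon>\<^sub>3\<close>, \<open>p\<^sub>1\<epsilon>\<^sub>3\<close> is a square in \<open>\<rat>(\<surd>d)\<close>; the first occurs exactly if \<open>x + 1\<close> or \<open>x - 1\<close> is a square.
  As the unit index of \<open>L\<close> is controlled by the fourth roots of unity, the units of relative norm 1 are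
  generated, modulo the \<open>\<sigma>(v)/v\<close>, by \<open>-1\<close> and \<open>-\<i>/\<epsilon>\<^sub>1\<close>, where \<open>\<epsilon>\<^sub>1\<close> is a unit of norm -1 of \<open>\<rat>(\<surd>p\<^sub>1)\<close>.
  They come from the generators \<open>\<surd>p\<^sub>1\<close> and \<open>(\<epsilon>\<^sub>1 - \<i>)/(1 + \<i>)\<close> of ideals extended from \<open>k\<close>. The second is never
  trivial, because every \<open>\<sigma>(v)/v\<close> is real, while \<open>-1 = \<sigma>(v)/v\<close> is solvable exactly if \<open>2\<epsilon>\<^sub>3\<close> is not a square.
\<close>

section \<open>Algebraic integers\<close>

text \<open>Ideals are never factored. Two generators with the same quotient
  \<sigma>(\<alpha>)/\<alpha> differ by a factor in k, and contraction from L back to k then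
  compares the ideals themselves. The obstacle is to control the units of L without knowing its unit
  group. Complex conjugation commutes with the Galois group over Q(\<i>), so v / cnj v has absolute
  value 1 at every conjugate; it is a fourth root of unity because sqrt 2 is not in L. For a unit u
  of relative norm 1 the factor \<zeta> in u = \<zeta> * cnj u satisfies \<zeta>^2 = 1, so u is real
  or purely imaginary. Multiplication by \<i> * \<epsilon>1, itself of relative norm 1, exchanges
  the two cases; this is the origin of the second generator -\<i>/\<epsilon>1. The square of a real
  unit of relative norm 1 is the product of its norms to Q(sqrt p1) and Q(sqrt (2 p2)), so such a
  unit is found by taking square roots of units of real quadratic fields. All these square roots
  come from one source: if a^2 - n b^2 = 1, then a + 1 and a - 1 split n into two factors and so
  exhibit a root of a + b sqrt n.\<close>

lemma algebraic_int_eigenvalue: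
  fixes A :: "int mat" and k :: complex
  assumes A: "A \<in> carrier_mat n n" and ev: "eigenvalue (map_mat of_int A) k"
  shows "algebraic_int k"
proof -
  have A': "map_mat of_int A \<in> carrier_mat n n" using A by simp
  have "poly (char_poly (map_mat of_int A)) k = 0"
    using eigenvalue_root_char_poly[OF A'] ev by blast
  then have "poly (map_poly of_int (char_poly A)) k = 0"
    by (simp add: of_int_hom.char_poly_hom[OF A])
  moreover have "lead_coeff (char_poly A) = 1"
    using degree_monic_char_poly[OF A] by simp
  ultimately show ?thesis unfolding algebraic_int_altdef_ipoly by blast
qed

text \<open>The tuple of generators is an eigenvector, with eigenvalue z, of an integer matrix
  describing multiplication by z, so z is a root of a monic integer polynomial. A nonzero generator
  is required for the tuple to be an eigenvector.\<close>

lemma algebraic_int_of_finite_module: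
  fixes b :: "'i \<Rightarrow> complex"
  assumes fin: "finite I" and nz: "\<exists>i\<in>I. b i \<noteq> 0"
    and mult: "\<And>i. i \<in> I \<Longrightarrow> \<exists>c::'i \<Rightarrow> int. z * b i = (\<Sum>j\<in>I. of_int (c j) * b j)"
  shows "algebraic_int z"
proof -
  obtain c :: "'i \<Rightarrow> 'i \<Rightarrow> int" where c: "\<And>i. i \<in> I \<Longrightarrow> z * b i = (\<Sum>j\<in>I. of_int (c i j) * b j)"
    using mult by metis
  define n where "n = card I"
  obtain e where e: "bij_betw e {0..<n} I"
    using fin ex_bij_betw_nat_finite n_def by blast
  define A :: "int mat" where "A = Matrix.mat n n (\<lambda>(i,j). c (e i) (e j))"
  define v where "v = Matrix.vec n (\<lambda>i. b (e i))"
  have A: "A \<in> carrier_mat n n" by (simp add: A_def)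
  have "map_mat of_int A *\<^sub>v v = z \<cdot>\<^sub>v v"
  proof (rule eq_vecI)
    fix i assume "i < dim_vec (z \<cdot>\<^sub>v v)"
    then have i: "i < n" by (simp add: v_def)
    then have eI: "e i \<in> I" using e by (auto simp: bij_betw_def)
    have "vec_index (map_mat of_int A *\<^sub>v v) i = (\<Sum>j = 0..<n. of_int (c (e i) (e j)) * b (e j))"
      using i by (simp add: A_def v_def scalar_prod_def)
    also have "\<dots> = (\<Sum>j\<in>I. of_int (c (e i) j) * b j)"
      by (rule sum.reindex_bij_betw[OF e])
    also have "\<dots> = z * b (e i)" using c[OF eI] by simp
    finally show "vec_index (map_mat of_int A *\<^sub>v v) i = vec_index (z \<cdot>\<^sub>v v) i"
      using i by (simp add: v_def)
  qed (simp add: A_def v_def)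
  moreover have "v \<noteq> 0\<^sub>v n"
  proof
    assume "v = 0\<^sub>v n"
    then have "b (e i) = 0" if "i < n" for i
      using that by (metis index_vec index_zero_vec(1) v_def)
    then show False using nz e by (force simp: bij_betw_def)
  qed
  ultimately have "eigenvalue (map_mat of_int A) z"
    unfolding eigenvalue_def eigenvector_def by (intro exI[of _ v]) (simp add: v_def A_def)
  then show ?thesis using algebraic_int_eigenvalue[OF A] by blast
qed

lemma algebraic_int_monic_relation:
  fixes x :: complex
  assumes "algebraic_int x"
  obtains m and c :: "nat \<Rightarrow> int" where "m > 0" "x ^ m = (\<Sum>i<m. of_int (c i) * x ^ i)"
proof -
  obtain p where p: "poly (map_poly of_int p) x = 0" "lead_coeff p = 1"
    using assms unfolding algebraic_int_altdef_ipoly by blast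
  define m where "m = degree p"
  have "(\<Sum>i\<le>m. of_int (coeff p i) * x ^ i) = 0"
    using p(1) by (simp add: poly_altdef m_def coeff_map_poly degree_map_poly)
  then have *: "(\<Sum>i<m. of_int (coeff p i) * x ^ i) + x ^ m = 0"
    using p(2) by (simp add: m_def lessThan_Suc_atMost[symmetric])
  have "m > 0" using * by (cases m) auto
  moreover have "x ^ m = (\<Sum>i<m. of_int (- coeff p i) * x ^ i)"
    using * unfolding add_eq_0_iff by (simp add: sum_negf)
  ultimately show ?thesis using that[of m "\<lambda>i. - coeff p i"] by simp
qed

text \<open>The monic relations of degrees m and n make the Z-span of the products x^i y^j with i <
  m and j < n stable under multiplication by x and by y, hence by their sum and product.\<close>

lemma algebraic_int_plus_times:
  fixes x y :: complex
  assumes "algebraic_int x" "algebraic_int y"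
  shows "algebraic_int (x + y) \<and> algebraic_int (x * y)"
proof -
  obtain m c where m: "m > 0" "x ^ m = (\<Sum>i<m. of_int (c i :: int) * x ^ i)"
    using algebraic_int_monic_relation[OF assms(1)] by blast
  obtain n d where n: "n > 0" "y ^ n = (\<Sum>i<n. of_int (d i :: int) * y ^ i)"
    using algebraic_int_monic_relation[OF assms(2)] by blast
  define I where "I = {..<m} \<times> {..<n}"
  define b where "b = (\<lambda>(i,j). x ^ i * y ^ j)"
  have finI: "finite I" by (simp add: I_def)
  define M where "M = {z. \<exists>c::nat \<times> nat \<Rightarrow> int. z = (\<Sum>j\<in>I. of_int (c j) * b j)}"
  have M_I: "(\<Sum>j\<in>I. of_int (c j) * b j) \<in> M" for c :: "nat \<times> nat \<Rightarrow> int"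
    unfolding M_def by blast
  have M_add: "u + v \<in> M" if "u \<in> M" "v \<in> M" for u v
  proof -
    obtain f g :: "nat \<times> nat \<Rightarrow> int" where "u = (\<Sum>j\<in>I. of_int (f j) * b j)" "v = (\<Sum>j\<in>I. of_int (g j) * b j)"
      using \<open>u \<in> M\<close> \<open>v \<in> M\<close> by (auto simp: M_def)
    then have "u + v = (\<Sum>j\<in>I. of_int (f j + g j) * b j)"
      by (simp add: sum.distrib algebra_simps)
    then show ?thesis by (simp only: M_I)
  qed
  have M_mult: "of_int t * u \<in> M" if "u \<in> M" for t u
  proof -
    obtain f :: "nat \<times> nat \<Rightarrow> int" where "u = (\<Sum>j\<in>I. of_int (f j) * b j)"
      using \<open>u \<in> M\<close> by (auto simp: M_def)
    then have "of_int t * u = (\<Sum>j\<in>I. of_int (t * f j) * b j)"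
      by (simp add: sum_distrib_left mult.assoc)
    then show ?thesis by (simp only: M_I)
  qed
  have M_0: "0 \<in> M" using M_I[of "\<lambda>_. 0"] by simp
  have M_sum: "(\<Sum>i\<in>S. f i) \<in> M" if "\<And>i. i \<in> S \<Longrightarrow> f i \<in> M" for S and f :: "nat \<Rightarrow> complex"
    using that by (induction S rule: infinite_finite_induct) (auto simp: M_0 M_add)
  have M_sum2: "(\<Sum>i\<in>S. f i) \<in> M" if "\<And>i. i \<in> S \<Longrightarrow> f i \<in> M" for S and f :: "nat \<times> nat \<Rightarrow> complex"
    using that by (induction S rule: infinite_finite_induct) (auto simp: M_0 M_add)
  have M_b: "b i \<in> M" if "i \<in> I" for i
  proof -
    have "b i = (\<Sum>j\<in>I. of_int (if j = i then 1 else 0) * b j)"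

    proof -
      have "(\<Sum>j\<in>I. of_int (if j = i then 1 else 0) * b j) = (\<Sum>j\<in>I. if j = i then b j else 0)"
        by (rule sum.cong) auto
      then show ?thesis using finI that by (simp add: sum.delta)
    qed
    then show ?thesis by (simp only: M_I)
  qed
  have xb: "x * b i \<in> M" if "i \<in> I" for i
  proof -
    obtain p q where i: "i = (p, q)" "p < m" "q < n" using \<open>i \<in> I\<close> by (auto simp: I_def)
    show ?thesis
    proof (cases "Suc p < m")
      case True
      then have "b (Suc p, q) \<in> M" using i by (intro M_b) (simp add: I_def)
      then show ?thesis by (simp add: i b_def mult.assoc)
    next
      case False
      then have "Suc p = m" using i by simp
      then have "x * b i = x ^ m * y ^ q" by (auto simp: i b_def)
      also have "\<dots> = (\<Sum>r<m. of_int (c r) * b (r, q))"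
        by (simp add: m(2) b_def sum_distrib_right mult.assoc)
      also have "\<dots> \<in> M" using i by (intro M_sum M_mult M_b) (auto simp: I_def)
      finally show ?thesis .
    qed
  qed
  have yb: "y * b i \<in> M" if "i \<in> I" for i
  proof -
    obtain p q where i: "i = (p, q)" "p < m" "q < n" using \<open>i \<in> I\<close> by (auto simp: I_def)
    show ?thesis
    proof (cases "Suc q < n")
      case True
      then have "b (p, Suc q) \<in> M" using i by (intro M_b) (simp add: I_def)
      then show ?thesis by (simp add: i b_def ac_simps)
    next
      case False
      then have "Suc q = n" using i by simp
      then have "y * b i = x ^ p * y ^ n" by (auto simp: i b_def)
      also have "\<dots> = (\<Sum>r<n. of_int (d r) * b (p, r))"
        by (simp add: n(2) b_def sum_distrib_left ac_simps)
      also have "\<dots> \<in> M" using i by (intro M_sum M_mult M_b) (auto simp: I_def)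
      finally show ?thesis .
    qed
  qed
  have xM: "x * u \<in> M" if "u \<in> M" for u
  proof -
    obtain f :: "nat \<times> nat \<Rightarrow> int" where "u = (\<Sum>j\<in>I. of_int (f j) * b j)"
      using \<open>u \<in> M\<close> by (auto simp: M_def)
    then have "x * u = (\<Sum>j\<in>I. of_int (f j) * (x * b j))"
      by (simp add: sum_distrib_left ac_simps)
    then show ?thesis using M_sum2[of I "\<lambda>j. of_int (f j) * (x * b j)"] xb M_mult by simp
  qed
  have nz: "\<exists>i\<in>I. b i \<noteq> 0" using m n by (intro bexI[of _ "(0,0)"]) (auto simp: I_def b_def)
  have *: "algebraic_int z" if "\<And>i. i \<in> I \<Longrightarrow> z * b i \<in> M" for z
    using algebraic_int_of_finite_module[OF finI nz, of z] that unfolding M_def by blast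
  show ?thesis
    using *[of "x + y"] *[of "x * y"] by (simp add: M_add xb yb xM distrib_right mult.assoc)
qed

lemma algebraic_int_plus [intro]: "algebraic_int x \<Longrightarrow> algebraic_int y \<Longrightarrow> algebraic_int (x + y :: complex)"
  and algebraic_int_times [intro]: "algebraic_int x \<Longrightarrow> algebraic_int y \<Longrightarrow> algebraic_int (x * y :: complex)"
  using algebraic_int_plus_times by blast+

lemma algebraic_int_diff [intro]: "algebraic_int x \<Longrightarrow> algebraic_int y \<Longrightarrow> algebraic_int (x - y :: complex)"
  using algebraic_int_plus[of x "- y"] by auto

section \<open>Pell equations\<close>

text \<open>Dirichlet's argument: an irrational sqrt n has infinitely many approximations h/k with
  error below 1/k^2, and their norms h^2 - n k^2 are bounded. Two of them share the norm and the
  residues modulo it, and their quotient is an integral element of norm 1.\<close>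

lemma Pell_solution_exists:
  fixes n :: nat
  assumes irr: "sqrt (real n) \<notin> \<rat>"
  shows "\<exists>x y :: int. y > 0 \<and> x\<^sup>2 - int n * y\<^sup>2 = 1"
proof -
  define \<theta> where "\<theta> = sqrt (real n)"
  have th: "\<theta> \<ge> 0" "\<theta>\<^sup>2 = real n" by (simp_all add: \<theta>_def)
  define v where "v = (\<lambda>(h::int, k::int). h\<^sup>2 - int n * k\<^sup>2)"
  have nz: "v (h, k) \<noteq> 0" if "k > 0" for h k
  proof
    assume "v (h, k) = 0"
    then have "h\<^sup>2 = int n * k\<^sup>2" by (simp add: v_def)
    then have "(real_of_int h)\<^sup>2 = real n * (real_of_int k)\<^sup>2"
      by (metis of_int_mult of_int_of_nat_eq of_int_power)
    then have "(of_int h / of_int k)\<^sup>2 = real n"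
      using that by (simp add: power_divide)
    then have "\<theta> = \<bar>of_int h / of_int k\<bar>" by (metis \<theta>_def real_sqrt_abs)
    then show False using irr by (simp add: \<theta>_def)
  qed
  have bound: "\<bar>v (h, k)\<bar> \<le> \<lceil>2 * \<theta> + 1\<rceil>" if "(h, k) \<in> approx_set \<theta>" for h k
  proof -
    have k: "k > 0" "\<bar>\<theta> - of_int h / of_int k\<bar> < 1 / (of_int k)\<^sup>2"
      using that by (auto simp: approx_set_def)
    have "\<bar>of_int k * \<theta> - of_int h\<bar> = of_int k * \<bar>\<theta> - of_int h / of_int k\<bar>"
    proof -
      have "of_int k * \<theta> - of_int h = of_int k * (\<theta> - of_int h / of_int k)"
        using k(1) by (simp add: right_diff_distrib)
      then show ?thesis using k(1) by (simp only: abs_mult)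
    qed
    also have "\<dots> < of_int k * (1 / (of_int k)\<^sup>2)" using k by (intro mult_strict_left_mono) auto
    finally have d: "\<bar>of_int k * \<theta> - of_int h\<bar> < 1 / of_int k"
      using k(1) by (simp add: power2_eq_square)
    then have d1: "\<bar>of_int k * \<theta> - of_int h\<bar> < 1"
      using k(1) by (smt (verit) divide_le_eq_1_pos of_int_1_le_iff)
    have kp: "real_of_int k \<ge> 1" using k(1) by simp
    have s: "\<bar>of_int h + of_int k * \<theta>\<bar> \<le> (2 * \<theta> + 1) * of_int k"
    proof -
      have "0 \<le> of_int k * \<theta>" using kp th(1) by simp
      then have "\<bar>of_int h + of_int k * \<theta>\<bar> \<le> 2 * (of_int k * \<theta>) + 1" using d1 by linarith
      then show ?thesis using kp by (simp add: algebra_simps)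
    qed
    have "real_of_int \<bar>v (h, k)\<bar> = \<bar>of_int k * \<theta> - of_int h\<bar> * \<bar>of_int h + of_int k * \<theta>\<bar>"
    proof -
      have "real_of_int (v (h, k)) = (of_int h)\<^sup>2 - \<theta>\<^sup>2 * (of_int k)\<^sup>2" by (simp add: v_def th(2))
      also have "\<dots> = - ((of_int k * \<theta> - of_int h) * (of_int h + of_int k * \<theta>))"
        by (simp add: power2_eq_square algebra_simps)
      finally show ?thesis by (simp add: abs_mult)
    qed
    also have "\<dots> \<le> (1 / of_int k) * ((2 * \<theta> + 1) * of_int k)"
      using d s k(1) by (intro mult_mono) auto
    also have "\<dots> = 2 * \<theta> + 1" using k(1) by simp
    finally show ?thesis by linarith
  qed
  \<comment> \<open>Pigeonhole key: the norm together with both residues modulo it, a value in a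
    finite box.\<close>
  define f where "f = (\<lambda>(h, k). (v (h, k), h mod \<bar>v (h, k)\<bar>, k mod \<bar>v (h, k)\<bar>))"
  define B where "B = \<lceil>2 * \<theta> + 1\<rceil>"
  have "f ` approx_set \<theta> \<subseteq> {-B..B} \<times> {0..B} \<times> {0..B}"
  proof (rule image_subsetI)
    fix x assume "x \<in> approx_set \<theta>"
    then obtain h k where x: "x = (h, k)" and a: "(h, k) \<in> approx_set \<theta>" by (cases x) auto
    then have "k > 0" by (auto simp: approx_set_def)
    with nz have "\<bar>v (h, k)\<bar> > 0" by simp
    then show "f x \<in> {-B..B} \<times> {0..B} \<times> {0..B}"
      using bound[OF a] unfolding x f_def B_def[symmetric]
      by (auto intro: order.trans[OF less_imp_le[OF pos_mod_bound]])
  qed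
  then have fin: "finite (f ` approx_set \<theta>)" by (rule finite_subset) simp
  have "infinite (approx_set \<theta>)" using irr rational_iff_finite_approx_set \<theta>_def by blast
  then have "\<not> inj_on f (approx_set \<theta>)" using fin finite_imageD by blast
  then obtain h k h' k' where hk: "(h, k) \<in> approx_set \<theta>" "(h', k') \<in> approx_set \<theta>"
    "(h, k) \<noteq> (h', k')" "f (h, k) = f (h', k')"
    unfolding inj_on_def by (metis surj_pair)
  define w where "w = v (h, k)"
  have kp: "k > 0" "k' > 0" using hk by (auto simp: approx_set_def)
  have w: "w \<noteq> 0" "w = h\<^sup>2 - int n * k\<^sup>2" "w = h'\<^sup>2 - int n * k'\<^sup>2"
    and cong: "h mod \<bar>w\<bar> = h' mod \<bar>w\<bar>" "k mod \<bar>w\<bar> = k' mod \<bar>w\<bar>"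
    using hk(4) nz[OF kp(1)] by (auto simp: w_def f_def v_def)
  obtain s t where st: "h' = h + w * s" "k' = k + w * t"
    using cong by (metis add.commute diff_add_cancel dvd_def abs_dvd_iff mod_eq_dvd_iff)
  \<comment> \<open>x + y sqrt n is the quotient (h + k sqrt n) / (h' + k' sqrt n); the congruences
    modulo w make its coefficients integers.\<close>
  define y where "y = s * k - h * t"
  define x where "x = 1 + h * s - int n * k * t"
  have hx: "w * x = h * h' - int n * k * k'" and hy: "w * y = k * h' - h * k'"
    unfolding x_def y_def st using w(2) by (simp_all add: algebra_simps power2_eq_square)
  have "w\<^sup>2 * (x\<^sup>2 - int n * y\<^sup>2) = (w * x)\<^sup>2 - int n * (w * y)\<^sup>2"
    by (simp add: algebra_simps power_mult_distrib)
  also have "\<dots> = (h\<^sup>2 - int n * k\<^sup>2) * (h'\<^sup>2 - int n * k'\<^sup>2)"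
    unfolding hx hy by (simp add: algebra_simps power2_eq_square)
  also have "\<dots> = w\<^sup>2" using w by (simp add: power2_eq_square)
  finally have xy: "x\<^sup>2 - int n * y\<^sup>2 = 1" using w(1) by simp
  \<comment> \<open>Otherwise the two pairs are proportional, and equal norms with positive second
    entries make them equal.\<close>
  have "y \<noteq> 0"
  proof
    assume "y = 0"
    then have e: "k * h' = h * k'" using hy by simp
    have "k'\<^sup>2 * w = (h * k')\<^sup>2 - int n * k\<^sup>2 * k'\<^sup>2" by (simp add: w(2) algebra_simps power_mult_distrib)
    also have "\<dots> = k\<^sup>2 * w" unfolding e[symmetric] by (simp add: w(3) algebra_simps power_mult_distrib)
    finally have "k'\<^sup>2 = k\<^sup>2" using w(1) by simp
    then have "k' = k" using kp by (simp add: power2_eq_iff)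
    then show False using e kp hk(3) by (simp add: mult.commute)
  qed
  then show ?thesis using xy by (intro exI[of _ x] exI[of _ "\<bar>y\<bar>"]) simp
qed

text \<open>After n is split into a divisor of X and a divisor of Y, the cofactors are coprime with
  a square product, so each is a square.\<close>

lemma coprime_mult_eq_times_square:
  fixes X Y n w :: nat
  assumes "coprime X Y" "X * Y = n * w\<^sup>2" "n > 0" "w > 0"
  obtains n1 n2 u v where "n = n1 * n2" "X = n1 * u\<^sup>2" "Y = n2 * v\<^sup>2" "w = u * v"
proof -
  have "n dvd X * Y" using assms(2) by simp
  then obtain n1 n2 where n: "n = n1 * n2" and "n1 dvd X" "n2 dvd Y"
    using division_decomp by blast
  then obtain X' Y' where X': "X = n1 * X'" and Y': "Y = n2 * Y'" by (auto elim!: dvdE)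
  have eq: "X' * Y' = w\<^sup>2" using assms(2,3) unfolding X' Y' n by simp
  have cop: "coprime X' Y'" using assms(1) unfolding X' Y' by simp
  have pos: "X' > 0" "Y' > 0" using eq assms(4) by (metis gr0I mult_zero_left mult_zero_right power_not_zero less_numeral_extra(3))+
  have "is_nth_power 2 (X' * Y')" unfolding eq by simp
  then obtain u v where uv: "X' = u\<^sup>2" "Y' = v\<^sup>2"
    using is_nth_power_mult_coprime_natD[OF cop _ pos] by (metis is_nth_powerE)
  have "w = u * v" using eq uv by (metis power_eq_iff_eq_base power_mult_distrib zero_le pos2)
  then show ?thesis using that n X' Y' uv by blast
qed

text \<open>With a = 2 c + 1 the equation reads (c + 1) c = n (b/2)^2, a product of coprime numbers.
  The point is the identity a + b sqrt n = (u sqrt n1 + v sqrt n2)^2, an explicit square root of a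
  norm 1 unit.\<close>

lemma norm_one_factorization:
  fixes a b n :: nat
  assumes "a\<^sup>2 = 1 + n * b\<^sup>2" "odd a" "even b" "n > 0" "b > 0"
  obtains n1 n2 u v where "n = n1 * n2" "a + 1 = 2 * n1 * u\<^sup>2" "a = 2 * n2 * v\<^sup>2 + 1" "b = 2 * u * v"
proof -
  obtain c where c: "a = 2 * c + 1" using assms(2) oddE by blast
  obtain w where w: "b = 2 * w" using assms(3) evenE by blast
  have "(c + 1) * c = n * w\<^sup>2" using assms(1) unfolding c w by (simp add: power2_eq_square algebra_simps)
  moreover have "coprime (c + 1) c" by simp
  moreover have "w > 0" using assms(5) w by simp
  ultimately obtain n1 n2 u v where "n = n1 * n2" "c + 1 = n1 * u\<^sup>2" "c = n2 * v\<^sup>2" "w = u * v"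
    using coprime_mult_eq_times_square[of "c + 1" c n w] assms(4) by metis
  then show ?thesis by (intro that[of n1 n2 u v]) (use c w in simp_all)
qed

lemma square_mod_4:
  fixes z :: int
  shows "z\<^sup>2 mod 4 = (if even z then 0 else 1)"
proof (cases "even z")
  case True
  then obtain k where "z = 2 * k" by blast
  then show ?thesis by (simp add: power2_eq_square)
next
  case False
  then obtain k where "z = 2 * k + 1" using oddE by blast
  then have "z\<^sup>2 = 4 * (k\<^sup>2 + k) + 1" by (simp add: power2_eq_square algebra_simps)
  then show ?thesis using False by (simp add: mod_add_eq[symmetric])
qed

lemma norm_one_parity:
  fixes a b :: int and p :: nat
  assumes "p mod 4 = 1" "a\<^sup>2 - int p * b\<^sup>2 = 1"
  shows "odd a" "even b"
proof -
  obtain q where q: "int p = 4 * q + 1"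
    using assms(1) by (metis int_ops(2) mult_div_mod_eq of_nat_mult of_nat_add of_nat_numeral)
  have *: "a\<^sup>2 mod 4 = (1 + b\<^sup>2) mod 4"
  proof -
    have "a\<^sup>2 = (1 + b\<^sup>2) + 4 * (q * b\<^sup>2)" using assms(2) unfolding q by (simp add: algebra_simps)
    then show ?thesis by (metis mod_mult_self2)
  qed
  then have "a\<^sup>2 mod 4 = (1 + b\<^sup>2 mod 4) mod 4" by (simp add: mod_simps)
  then show "odd a" "even b" by (auto simp: square_mod_4 split: if_splits)
qed

text \<open>Descent from the solution of norm 1 with least b > 0. As p is prime, the splitting p =
  n1 n2 is trivial: n1 = 1 yields a solution of norm 1 with the smaller v < b, while n2 = 1 is an
  equation v^2 - p u^2 = -1. Evenness of v follows modulo 4.\<close>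

lemma negative_Pell_solution_exists:
  fixes p :: nat
  assumes "prime p" "p mod 4 = 1" "sqrt (real p) \<notin> \<rat>"
  shows "\<exists>a b :: int. a\<^sup>2 - int p * b\<^sup>2 = -1 \<and> even a"
proof -
  define S where "S = (\<lambda>b::nat. b > 0 \<and> (\<exists>a::nat. a\<^sup>2 = 1 + p * b\<^sup>2))"
  obtain x y :: int where xy: "y > 0" "x\<^sup>2 - int p * y\<^sup>2 = 1"
    using Pell_solution_exists[OF assms(3)] by blast
  have "int ((nat \<bar>x\<bar>)\<^sup>2) = int (1 + p * (nat \<bar>y\<bar>)\<^sup>2)" using xy(2) by simp
  then have "(nat \<bar>x\<bar>)\<^sup>2 = 1 + p * (nat \<bar>y\<bar>)\<^sup>2" by (simp only: of_nat_eq_iff)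
  then have "S (nat \<bar>y\<bar>)" unfolding S_def using xy(1) by auto
  then have Sb: "S (LEAST b. S b)" by (rule LeastI)
  define b where "b = (LEAST b. S b)"
  obtain a where a: "a\<^sup>2 = 1 + p * b\<^sup>2" and b0: "b > 0" using Sb by (auto simp: S_def b_def)
  have ai: "(int a)\<^sup>2 - int p * (int b)\<^sup>2 = 1" using arg_cong[OF a, of int] by simp
  have par: "odd a" "even b" using norm_one_parity[OF assms(2) ai] by simp_all
  have p0: "p > 0" using assms(1) prime_gt_0_nat by blast
  obtain n1 n2 u v where f: "p = n1 * n2" "a + 1 = 2 * n1 * u\<^sup>2" "a = 2 * n2 * v\<^sup>2 + 1" "b = 2 * u * v"
    using norm_one_factorization[OF a par p0 b0] by metis
  have r: "n1 * u\<^sup>2 = n2 * v\<^sup>2 + 1" using f(2,3) by simp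
  have "n1 = 1 \<or> n2 = 1" using f(1) assms(1) by (metis prime_product)
  then show ?thesis
  proof
    assume "n1 = 1"
    then have "u\<^sup>2 = 1 + p * v\<^sup>2" using r f(1) by simp
    then have "S v" using f(4) b0 unfolding S_def by (auto intro!: exI[of _ u])
    then have "b \<le> v" unfolding b_def by (rule Least_le)
    then show ?thesis using f(4) b0 by (cases u) auto
  next
    assume "n2 = 1"
    then have r': "p * u\<^sup>2 = v\<^sup>2 + 1" using r f(1) by simp
    have e: "(int v)\<^sup>2 - int p * (int u)\<^sup>2 = -1" using arg_cong[OF r', of int] by simp
    obtain q where q: "int p = 4 * q + 1"
      using assms(2) by (metis int_ops(2) mult_div_mod_eq of_nat_mult of_nat_add of_nat_numeral)
    have "(int u)\<^sup>2 = ((int v)\<^sup>2 + 1) + 4 * (- q * (int u)\<^sup>2)" using e unfolding q by (simp add: algebra_simps)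
    then have "(int u)\<^sup>2 mod 4 = ((int v)\<^sup>2 + 1) mod 4" by (metis mod_mult_self2)
    also have "\<dots> = ((int v)\<^sup>2 mod 4 + 1) mod 4" by (simp add: mod_simps)
    finally have "even v" by (simp add: square_mod_4 split: if_splits)
    then show ?thesis using e by (metis even_of_nat)
  qed
qed

section \<open>Subfields of the complex numbers and quadratic extensions\<close>

lemma is_subfieldD:
  assumes "is_subfield F"
  shows "0 \<in> F" "1 \<in> F" "\<And>a b. a \<in> F \<Longrightarrow> b \<in> F \<Longrightarrow> a + b \<in> F"
    "\<And>a b. a \<in> F \<Longrightarrow> b \<in> F \<Longrightarrow> a - b \<in> F" "\<And>a b. a \<in> F \<Longrightarrow> b \<in> F \<Longrightarrow> a * b \<in> F"
    "\<And>a. a \<in> F \<Longrightarrow> inverse a \<in> F" "\<And>a. a \<in> F \<Longrightarrow> - a \<in> F"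
    "\<And>a b. a \<in> F \<Longrightarrow> b \<in> F \<Longrightarrow> a / b \<in> F"
proof -
  show *: "0 \<in> F" "1 \<in> F" "\<And>a b. a \<in> F \<Longrightarrow> b \<in> F \<Longrightarrow> a + b \<in> F"
    "\<And>a b. a \<in> F \<Longrightarrow> b \<in> F \<Longrightarrow> a - b \<in> F" "\<And>a b. a \<in> F \<Longrightarrow> b \<in> F \<Longrightarrow> a * b \<in> F"
    using assms unfolding is_subfield_def by auto
  show inv: "inverse a \<in> F" if "a \<in> F" for a
    using assms that unfolding is_subfield_def by (cases "a = 0") auto
  show "- a \<in> F" if "a \<in> F" for a using *(4)[OF *(1) that] by simp
  show "a / b \<in> F" if "a \<in> F" "b \<in> F" for a b
    unfolding divide_inverse using that inv *(5) by blast
qed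

lemma is_subfield_of_nat: "is_subfield F \<Longrightarrow> of_nat n \<in> F"
  by (induction n) (auto intro: is_subfieldD)

lemma is_subfield_of_int: "is_subfield F \<Longrightarrow> of_int n \<in> F"
  by (cases n rule: int_cases2) (auto intro: is_subfieldD is_subfield_of_nat)

lemma is_subfield_numeral: "is_subfield F \<Longrightarrow> numeral n \<in> F"
  using is_subfield_of_nat[of F "numeral n"] by simp

lemma is_subfield_power: "is_subfield F \<Longrightarrow> z \<in> F \<Longrightarrow> z ^ n \<in> F"
  by (induction n) (auto intro: is_subfieldD)

lemma is_subfield_Rats_subset: "is_subfield F \<Longrightarrow> \<rat> \<subseteq> F"
  by (auto elim!: Rats_cases' intro!: is_subfieldD(8) is_subfield_of_int)

lemma is_subfield_Rats: "is_subfield \<rat>"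
  unfolding is_subfield_def by auto

lemma field_gen_subset_iff: "is_subfield F \<Longrightarrow> field_gen S \<subseteq> F \<longleftrightarrow> S \<subseteq> F"
  unfolding field_gen_def by blast

text \<open>Only the F-span of 1 and \<alpha>; it is the field F(\<alpha>) as soon as the square of
  \<alpha> lies in F.\<close>

definition adjoin :: "complex set \<Rightarrow> complex \<Rightarrow> complex set" where
  "adjoin F \<alpha> = {a + b * \<alpha> | a b. a \<in> F \<and> b \<in> F}"

lemma adjoinI: "a \<in> F \<Longrightarrow> b \<in> F \<Longrightarrow> a + b * \<alpha> \<in> adjoin F \<alpha>"
  unfolding adjoin_def by blast

lemma adjoinE:
  assumes "z \<in> adjoin F \<alpha>"
  obtains a b where "a \<in> F" "b \<in> F" "z = a + b * \<alpha>"
  using assms unfolding adjoin_def by blast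

lemma adjoin_mono: "F \<subseteq> G \<Longrightarrow> adjoin F \<alpha> \<subseteq> adjoin G \<alpha>"
  unfolding adjoin_def by blast

text \<open>Only meaningful for \<^term>\<open>\<alpha> \<notin> F\<close> and \<^term>\<open>z \<in> adjoin F \<alpha>\<close>.\<close>
definition conj_over :: "complex set \<Rightarrow> complex \<Rightarrow> complex \<Rightarrow> complex" where
  "conj_over F \<alpha> z = (THE w. \<exists>a\<in>F. \<exists>b\<in>F. z = a + b * \<alpha> \<and> w = a - b * \<alpha>)"

locale subfield =
  fixes F :: "complex set"
  assumes subfield: "is_subfield F"
begin
lemmas closed = is_subfieldD[OF subfield] is_subfield_of_nat[OF subfield]
  is_subfield_of_int[OF subfield] is_subfield_numeral[OF subfield]
end

locale sqrt_adjoin = subfield +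
  fixes \<alpha> :: complex
  assumes square: "\<alpha>\<^sup>2 \<in> F"
begin

lemma base_subset: "F \<subseteq> adjoin F \<alpha>"
  using adjoinI[of _ F 0 \<alpha>] closed by fastforce

lemma gen_in: "\<alpha> \<in> adjoin F \<alpha>"
  using adjoinI[of 0 F 1 \<alpha>] closed by simp

lemma is_subfield_adjoin: "is_subfield (adjoin F \<alpha>)"
proof -
  have sq: "\<alpha> * \<alpha> \<in> F" using square by (simp add: power2_eq_square)
  have mult: "u * v \<in> adjoin F \<alpha>" if A: "u \<in> adjoin F \<alpha>" "v \<in> adjoin F \<alpha>" for u v
  proof -
    obtain a b c d where uv: "a \<in> F" "b \<in> F" "u = a + b * \<alpha>" "c \<in> F" "d \<in> F" "v = c + d * \<alpha>"
      using A by (auto elim!: adjoinE)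
    have "u * v = (a * c + b * d * (\<alpha> * \<alpha>)) + (a * d + b * c) * \<alpha>" unfolding uv by (simp add: algebra_simps)
    then show ?thesis using uv sq by (simp only:) (rule adjoinI; simp add: closed)
  qed
  have inv: "inverse u \<in> adjoin F \<alpha>" if A: "u \<in> adjoin F \<alpha>" "u \<noteq> 0" for u
  proof (cases "\<alpha> \<in> F")
    case True
    then have "u \<in> F" using that(1) by (auto elim!: adjoinE intro: closed)
    then show ?thesis using base_subset closed(6) by blast
  next
    case False
    obtain a b where u: "a \<in> F" "b \<in> F" "u = a + b * \<alpha>" using A by (elim adjoinE)
    have n0: "a - b * \<alpha> \<noteq> 0"
    proof
      assume e: "a - b * \<alpha> = 0"
      show False
      proof (cases "b = 0")
        case True then show False using e u A(2) by simp
      next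
        case b: False
        then have "\<alpha> = a / b" using e by (simp add: field_simps)
        then show False using False u closed(8) by blast
      qed
    qed
    define N where "N = a * a - b * b * (\<alpha> * \<alpha>)"
    have N: "N = u * (a - b * \<alpha>)" unfolding N_def u by (simp add: algebra_simps)
    have "inverse u = (a - b * \<alpha>) / N" using A(2) n0 unfolding N by (simp add: divide_inverse)
    then have "inverse u = a / N + (- b / N) * \<alpha>" by (simp add: diff_divide_distrib)
    moreover have "N \<in> F" unfolding N_def using u sq by (simp add: closed)
    ultimately show ?thesis using u by (simp only:) (rule adjoinI; simp add: closed)
  qed
  have add: "u + v \<in> adjoin F \<alpha> \<and> u - v \<in> adjoin F \<alpha>" if A: "u \<in> adjoin F \<alpha>" "v \<in> adjoin F \<alpha>" for u v
  proof -
    obtain a b c d where uv: "a \<in> F" "b \<in> F" "u = a + b * \<alpha>" "c \<in> F" "d \<in> F" "v = c + d * \<alpha>"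
      using A by (auto elim!: adjoinE)
    have "u + v = (a + c) + (b + d) * \<alpha>" "u - v = (a - c) + (b - d) * \<alpha>"
      unfolding uv by (simp_all add: algebra_simps)
    then show ?thesis using uv by (simp only:) (rule conjI; rule adjoinI; simp add: closed)
  qed
  show ?thesis unfolding is_subfield_def using mult inv add base_subset closed(1,2) by blast
qed

lemma adjoin_subset_iff: "is_subfield G \<Longrightarrow> adjoin F \<alpha> \<subseteq> G \<longleftrightarrow> F \<subseteq> G \<and> \<alpha> \<in> G"
proof (rule iffI)
  assume G: "is_subfield G"
  show "adjoin F \<alpha> \<subseteq> G \<Longrightarrow> F \<subseteq> G \<and> \<alpha> \<in> G" using base_subset gen_in by blast
  show "F \<subseteq> G \<and> \<alpha> \<in> G \<Longrightarrow> adjoin F \<alpha> \<subseteq> G"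
    by (auto elim!: adjoinE intro!: is_subfieldD(3)[OF G] is_subfieldD(5)[OF G])
qed

text \<open>Squaring a + b \<alpha> leaves the cross term 2 a b \<alpha>, which lies in F only if a
  = 0 or b = 0. This lets questions of membership of square roots descend through a tower of
  quadratic extensions.\<close>

lemma square_in_adjoin:
  assumes "\<beta>\<^sup>2 \<in> F" "\<beta> \<in> adjoin F \<alpha>" "\<alpha> \<notin> F"
  shows "\<beta> \<in> F \<or> \<alpha> * \<beta> \<in> F"
proof -
  obtain a b where ab: "a \<in> F" "b \<in> F" "\<beta> = a + b * \<alpha>" using assms(2) by (elim adjoinE)
  have eq: "2 * a * b * \<alpha> = \<beta>\<^sup>2 - a * a - b * b * \<alpha>\<^sup>2"
    unfolding ab(3) by (simp add: algebra_simps power2_eq_square)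
  have "a = 0 \<or> b = 0"
  proof (rule ccontr)
    assume "\<not> ?thesis"
    then have "\<alpha> = (\<beta>\<^sup>2 - a * a - b * b * \<alpha>\<^sup>2) / (2 * a * b)" using eq by (simp add: field_simps)
    also have "\<dots> \<in> F" using ab assms(1) square by (simp add: closed)
    finally show False using assms(3) by simp
  qed
  then show ?thesis
  proof
    assume "a = 0"
    then have "\<alpha> * \<beta> = b * \<alpha>\<^sup>2" using ab by (simp add: power2_eq_square)
    then show ?thesis using ab(2) square closed(5) by simp
  qed (use ab in simp)
qed

end

locale quadratic_ext = sqrt_adjoin +
  assumes not_in_base: "\<alpha> \<notin> F"
begin

lemma coeffs_unique:
  assumes "a \<in> F" "b \<in> F" "c \<in> F" "d \<in> F" "a + b * \<alpha> = c + d * \<alpha>"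
  shows "a = c \<and> b = d"
proof -
  have "(b - d) * \<alpha> = c - a" using assms(5) by (simp add: algebra_simps)
  then have "b \<noteq> d \<Longrightarrow> \<alpha> = (c - a) / (b - d)" by (simp add: field_simps)
  moreover have "(c - a) / (b - d) \<in> F" using assms by (intro closed)
  ultimately have "b = d" using not_in_base by metis
  then show ?thesis using assms(5) by simp
qed

abbreviation "cj \<equiv> conj_over F \<alpha>"

lemma cj_eq: "a \<in> F \<Longrightarrow> b \<in> F \<Longrightarrow> cj (a + b * \<alpha>) = a - b * \<alpha>"
  unfolding conj_over_def by (rule the_equality) (use coeffs_unique in blast)+

lemma cj_base: "a \<in> F \<Longrightarrow> cj a = a"
  using cj_eq[of a 0] closed(1) by simp

lemma cj_in: "z \<in> adjoin F \<alpha> \<Longrightarrow> cj z \<in> adjoin F \<alpha>"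
proof (elim adjoinE)
  fix a b assume "a \<in> F" "b \<in> F" "z = a + b * \<alpha>"
  then show ?thesis using adjoinI[of a F "- b" \<alpha>] closed(7) by (simp add: cj_eq)
qed

lemma cj_cj: "z \<in> adjoin F \<alpha> \<Longrightarrow> cj (cj z) = z"
proof (elim adjoinE)
  fix a b assume "a \<in> F" "b \<in> F" "z = a + b * \<alpha>"
  then show ?thesis using cj_eq[of a "- b"] closed(7) by (simp add: cj_eq)
qed

lemma cj_add:
  assumes "u \<in> adjoin F \<alpha>" "v \<in> adjoin F \<alpha>"
  shows "cj (u + v) = cj u + cj v"
proof -
  obtain a b c d where uv: "a \<in> F" "b \<in> F" "u = a + b * \<alpha>" "c \<in> F" "d \<in> F" "v = c + d * \<alpha>"
    using assms by (auto elim!: adjoinE)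
  have "cj (u + v) = cj ((a + c) + (b + d) * \<alpha>)" by (simp add: uv algebra_simps)
  also have "\<dots> = (a + c) - (b + d) * \<alpha>" using uv by (intro cj_eq closed)
  also have "\<dots> = cj u + cj v" by (simp only: cj_eq uv) (simp add: algebra_simps)
  finally show ?thesis .
qed

lemma cj_mult:
  assumes "u \<in> adjoin F \<alpha>" "v \<in> adjoin F \<alpha>"
  shows "cj (u * v) = cj u * cj v"
proof -
  obtain a b c d where uv: "a \<in> F" "b \<in> F" "u = a + b * \<alpha>" "c \<in> F" "d \<in> F" "v = c + d * \<alpha>"
    using assms by (auto elim!: adjoinE)
  have "cj (u * v) = cj ((a * c + b * d * \<alpha>\<^sup>2) + (a * d + b * c) * \<alpha>)"
    by (simp add: uv algebra_simps power2_eq_square)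
  also have "\<dots> = (a * c + b * d * \<alpha>\<^sup>2) - (a * d + b * c) * \<alpha>"
    using uv square by (intro cj_eq) (simp_all add: closed)
  also have "\<dots> = cj u * cj v" by (simp only: cj_eq uv) (simp add: algebra_simps power2_eq_square)
  finally show ?thesis .
qed

lemma cj_minus: "u \<in> adjoin F \<alpha> \<Longrightarrow> cj (- u) = - cj u"
proof -
  assume u: "u \<in> adjoin F \<alpha>"
  have "-1 \<in> F" using closed(7)[OF closed(2)] .
  then show ?thesis using u cj_mult[of "-1" u] cj_base[of "-1"] base_subset by auto
qed

lemma cj_diff: "u \<in> adjoin F \<alpha> \<Longrightarrow> v \<in> adjoin F \<alpha> \<Longrightarrow> cj (u - v) = cj u - cj v"
  using cj_add[of u "- v"] cj_minus[of v] is_subfieldD(7)[OF is_subfield_adjoin, of v] by simp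

lemma cj_inverse:
  assumes "u \<in> adjoin F \<alpha>" shows "cj (inverse u) = inverse (cj u)"
proof (cases "u = 0")
  case True then show ?thesis using cj_base[OF closed(1)] by simp
next
  case False
  then have "cj u * cj (inverse u) = 1"
    using cj_mult[OF assms is_subfieldD(6)[OF is_subfield_adjoin assms]] cj_base[OF closed(2)] False by simp
  then show ?thesis by (metis inverse_unique)
qed

lemma cj_divide: "u \<in> adjoin F \<alpha> \<Longrightarrow> v \<in> adjoin F \<alpha> \<Longrightarrow> cj (u / v) = cj u / cj v"
  unfolding divide_inverse
  using cj_mult[of u "inverse v"] cj_inverse[of v] is_subfieldD(6)[OF is_subfield_adjoin, of v] by simp

lemma cj_power: "u \<in> adjoin F \<alpha> \<Longrightarrow> cj (u ^ n) = cj u ^ n"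
  by (induction n) (simp_all add: cj_mult cj_base[OF closed(2)] is_subfield_power[OF is_subfield_adjoin])

lemma cj_eq_0_iff: "u \<in> adjoin F \<alpha> \<Longrightarrow> cj u = 0 \<longleftrightarrow> u = 0"
  using cj_cj[of u] cj_base[OF closed(1)] by metis

lemma cj_fixed_iff: "z \<in> adjoin F \<alpha> \<Longrightarrow> cj z = z \<longleftrightarrow> z \<in> F"
proof (elim adjoinE)
  fix a b assume ab: "a \<in> F" "b \<in> F" "z = a + b * \<alpha>"
  have "\<alpha> \<noteq> 0" using not_in_base closed(1) by auto
  moreover have "cj z = a - b * \<alpha>" using ab cj_eq by simp
  ultimately have "cj z = z \<Longrightarrow> b = 0" using ab by simp
  then show ?thesis using ab cj_base by auto
qed

lemma norm_in_base: "z \<in> adjoin F \<alpha> \<Longrightarrow> z * cj z \<in> F"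
proof (elim adjoinE)
  fix a b assume ab: "a \<in> F" "b \<in> F" "z = a + b * \<alpha>"
  then have "z * cj z = a * a - b * b * \<alpha>\<^sup>2" by (simp only: cj_eq) (simp add: algebra_simps power2_eq_square)
  then show ?thesis using ab square by (simp add: closed)
qed

lemma trace_in_base: "z \<in> adjoin F \<alpha> \<Longrightarrow> z + cj z \<in> F"
proof (elim adjoinE)
  fix a b assume ab: "a \<in> F" "b \<in> F" "z = a + b * \<alpha>"
  then have "cj z = a - b * \<alpha>" by (simp only: cj_eq)
  with ab have "z + cj z = a + a" by simp
  then show ?thesis using ab(1) closed(3) by metis
qed

text \<open>Conjugation fixes the integers, hence commutes with evaluation of integer polynomials.
  Membership of the value in the extension is carried through the induction because additivity and
  multiplicativity hold only there.\<close>

lemma cj_algebraic_int: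
  assumes z: "z \<in> adjoin F \<alpha>" and "algebraic_int z"
  shows "algebraic_int (cj z)"
proof -
  obtain p where p: "poly (map_poly of_int p) z = 0" "lead_coeff p = 1"
    using assms(2) unfolding algebraic_int_altdef_ipoly by blast
  have sf: "is_subfield (adjoin F \<alpha>)" by (rule is_subfield_adjoin)
  have "poly (map_poly of_int q) z \<in> adjoin F \<alpha> \<and>
        poly (map_poly of_int q) (cj z) = cj (poly (map_poly of_int q) z)" for q :: "int poly"
  proof (induction q)
    case 0
    then show ?case using cj_base[OF closed(1)] is_subfieldD(1)[OF sf] by simp
  next
    case (pCons c q)
    have c: "of_int c \<in> F" by (rule closed)
    then have c': "of_int c \<in> adjoin F \<alpha>" using base_subset by blast
    have e: "map_poly of_int (pCons c q) = pCons (of_int c :: complex) (map_poly of_int q)"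
      using pCons by (simp add: map_poly_pCons)
    show ?case using pCons.IH z c c' unfolding e
      by (simp add: cj_add cj_mult cj_base is_subfieldD(3,5)[OF sf])
  qed
  then have "poly (map_poly of_int p) (cj z) = 0" using p(1) cj_base[OF closed(1)] by simp
  then show ?thesis using p(2) unfolding algebraic_int_altdef_ipoly by blast
qed

end

section \<open>Real quadratic fields\<close>

abbreviation csq :: "nat \<Rightarrow> complex" where
  "csq n \<equiv> complex_of_real (sqrt (real n))"

lemma csq_square: "(csq n)\<^sup>2 = of_nat n"
  by (simp flip: of_real_power)

lemma csq_mult_self: "csq n * csq n = of_nat n"
  by (simp flip: of_real_mult)

lemma csq_mult: "csq (m * n) = csq m * csq n"
  by (simp add: real_sqrt_mult)

lemma algebraic_int_csq [intro]: "algebraic_int (csq n)"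
  by (intro algebraic_int_of_real algebraic_int_sqrt int_imp_algebraic_int) auto

lemma csq_Rats_imp_square:
  assumes "csq n \<in> \<rat>"
  obtains m where "n = m\<^sup>2"
proof -
  have "csq n \<in> \<int>" using assms algebraic_int_csq rational_algebraic_int_is_int by blast
  then obtain k where k: "csq n = of_int k" by (elim Ints_cases)
  then have "of_nat n = (of_int (k\<^sup>2) :: complex)" by (metis csq_square of_int_power)
  then have "int n = k\<^sup>2" by (metis of_int_eq_iff of_int_of_nat_eq)
  then have "int n = int ((nat \<bar>k\<bar>)\<^sup>2)" by simp
  then show ?thesis using that by (metis of_nat_eq_iff)
qed

lemma squarefree_csq_irrational:
  assumes "squarefree n" "n \<noteq> 1"
  shows "csq n \<notin> \<rat>"
proof
  assume "csq n \<in> \<rat>"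
  then obtain m where "n = m\<^sup>2" by (rule csq_Rats_imp_square)
  then show False using assms unfolding squarefree_def by auto
qed

lemma squarefree_times_square:
  fixes m n u :: nat
  assumes "squarefree m" "m \<noteq> 1" "u > 0"
  shows "m * u\<^sup>2 \<noteq> n\<^sup>2"
proof
  assume e: "m * u\<^sup>2 = n\<^sup>2"
  then have "u\<^sup>2 dvd n\<^sup>2" by (metis dvd_triv_right)
  then have "u dvd n" by simp
  then obtain k where "n = u * k" by (elim dvdE)
  then have "m = k\<^sup>2" using e assms(3) by (simp add: power_mult_distrib)
  then show False using assms(1,2) unfolding squarefree_def by auto
qed

text \<open>If b is the reduced denominator of q, then b^2 divides m, so b = 1.\<close>

lemma squarefree_times_rational_square:
  fixes q :: complex and m :: nat
  assumes "squarefree m" "q \<in> \<rat>" "of_nat m * q\<^sup>2 \<in> \<int>"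
  shows "q \<in> \<int>"
proof -
  obtain a b :: int where ab: "b > 0" "coprime a b" "q = of_int a / of_int b"
    using assms(2) by (elim Rats_cases')
  obtain k where "of_nat m * q\<^sup>2 = of_int k" using assms(3) by (elim Ints_cases)
  then have "of_int (int m * a\<^sup>2) = (of_int (k * b\<^sup>2) :: complex)"
    using ab by (simp add: field_simps)
  then have "int m * a\<^sup>2 = k * b\<^sup>2" by (simp only: of_int_eq_iff)
  then have "b\<^sup>2 dvd int m * a\<^sup>2" by simp
  then have "b\<^sup>2 dvd int m" using ab(2)
    by (metis coprime_commute coprime_dvd_mult_left_iff coprime_power_left_iff coprime_power_right_iff)
  then have "int ((nat b)\<^sup>2) dvd int m" using ab(1) by simp
  then have "(nat b)\<^sup>2 dvd m" by (simp only: of_nat_dvd_iff)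
  then have "nat b dvd 1" using assms(1) unfolding squarefree_def by blast
  then have "b = 1" using ab(1) by simp
  then show ?thesis using ab by simp
qed

lemma quadratic_ext_csq: "csq m \<notin> \<rat> \<Longrightarrow> quadratic_ext \<rat> (csq m)"
  by unfold_locales (simp_all only: is_subfield_Rats csq_square Rats_of_nat not_False_eq_True)

lemma sqrt_adjoin_csq: "is_subfield F \<Longrightarrow> sqrt_adjoin F (csq m)"
  by unfold_locales (simp_all only: csq_square is_subfield_of_nat)

text \<open>The conjugate is integral too, so trace and norm are rational algebraic integers. Then m
  (2b)^2 = (2a)^2 - 4 (a^2 - m b^2) is an integer, and squarefreeness of m clears the denominator of
  2b.\<close>

lemma quadratic_integer_coeffs:
  assumes irr: "csq m \<notin> \<rat>" and ab: "a \<in> \<rat>" "b \<in> \<rat>" and z: "algebraic_int (a + b * csq m)"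
  shows "2 * a \<in> \<int>" "a\<^sup>2 - of_nat m * b\<^sup>2 \<in> \<int>" "squarefree m \<Longrightarrow> 2 * b \<in> \<int>"
proof -
  interpret quadratic_ext \<rat> "csq m" by (rule quadratic_ext_csq[OF irr])
  have c: "cj (a + b * csq m) = a - b * csq m" using ab by (rule cj_eq)
  have i: "algebraic_int (a - b * csq m)" using cj_algebraic_int[OF adjoinI z] ab c by simp
  have "2 * a = (a + b * csq m) + (a - b * csq m)" by simp
  then have "algebraic_int (2 * a)" using z i algebraic_int_plus by metis
  moreover have "2 * a \<in> \<rat>" using ab(1) by (rule Rats_mult[OF Rats_number_of])
  ultimately show 1: "2 * a \<in> \<int>" by (rule rational_algebraic_int_is_int)
  have "a\<^sup>2 - of_nat m * b\<^sup>2 = (a + b * csq m) * (a - b * csq m)"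
    unfolding csq_mult_self[symmetric] by (simp add: algebra_simps power2_eq_square)
  then have "algebraic_int (a\<^sup>2 - of_nat m * b\<^sup>2)" using z i algebraic_int_times by metis
  then show 2: "a\<^sup>2 - of_nat m * b\<^sup>2 \<in> \<int>" using ab by (intro rational_algebraic_int_is_int) auto
  assume sf: "squarefree m"
  have "of_nat m * (2 * b)\<^sup>2 = (2 * a)\<^sup>2 - 4 * (a\<^sup>2 - of_nat m * b\<^sup>2)"
    by (simp add: algebra_simps power2_eq_square)
  also have "\<dots> \<in> \<int>"
    by (rule Ints_diff[OF Ints_power[OF 1] Ints_mult[OF _ 2]]) simp
  finally have i: "of_nat m * (2 * b)\<^sup>2 \<in> \<int>" .
  have "2 * b \<in> \<rat>" using ab(2) by (rule Rats_mult[OF Rats_number_of])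
  then show "2 * b \<in> \<int>" by (rule squarefree_times_rational_square[OF sf _ i])
qed

text \<open>With a = s/2 and b = t/2 one has s^2 - m t^2 = 4 N. As m is 2 modulo 4, s is even, and
  dividing the equation by 2 shows that t is even as well.\<close>

lemma quadratic_integer_mod_4_eq_2:
  assumes "squarefree m" "m mod 4 = 2" "a \<in> \<rat>" "b \<in> \<rat>" "algebraic_int (a + b * csq m)"
  shows "a \<in> \<int>" "b \<in> \<int>"
proof -
  have irr: "csq m \<notin> \<rat>" using assms(1,2) by (intro squarefree_csq_irrational) auto
  note c = quadratic_integer_coeffs[OF irr assms(3-5)]
  obtain s t N where st: "2 * a = of_int s" "2 * b = of_int t" "a\<^sup>2 - of_nat m * b\<^sup>2 = of_int N"
    using c assms(1) by (meson Ints_cases)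
  have "of_int (s\<^sup>2 - int m * t\<^sup>2) = (2 * a)\<^sup>2 - of_nat m * (2 * b)\<^sup>2" by (simp add: st)
  also have "\<dots> = of_int (4 * N)" by (simp add: st(3)[symmetric] algebra_simps power2_eq_square)
  finally have e: "s\<^sup>2 - int m * t\<^sup>2 = 4 * N" by (simp only: of_int_eq_iff)
  obtain j where j: "int m = 4 * j + 2"
    using assms(2) by (metis mult_div_mod_eq of_nat_mult of_nat_add of_nat_numeral)
  have "even (s\<^sup>2)"
  proof -
    have "s\<^sup>2 = 2 * (2 * N + (2 * j + 1) * t\<^sup>2)" using e unfolding j by (simp add: algebra_simps)
    then show ?thesis by simp
  qed
  then obtain s' where s: "s = 2 * s'" by auto
  have "t\<^sup>2 = 2 * (s'\<^sup>2 - j * t\<^sup>2 - N)" using e unfolding j s by (simp add: algebra_simps power2_eq_square)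
  then have "even (t\<^sup>2)" by (metis dvd_triv_left)
  then obtain t' where t: "t = 2 * t'" by auto
  have "a = of_int s'" "b = of_int t'" using st s t by simp_all
  then show "a \<in> \<int>" "b \<in> \<int>" by simp_all
qed

lemma field_gen_csq: "field_gen {csq d} = adjoin \<rat> (csq d)"
proof
  interpret sqrt_adjoin \<rat> "csq d" by (rule sqrt_adjoin_csq[OF is_subfield_Rats])
  show "field_gen {csq d} \<subseteq> adjoin \<rat> (csq d)"
    using field_gen_subset_iff[OF is_subfield_adjoin] gen_in by auto
  show "adjoin \<rat> (csq d) \<subseteq> field_gen {csq d}"
    unfolding field_gen_def using adjoin_subset_iff is_subfield_Rats_subset by (intro Inter_greatest) auto
qed

lemma adjoin_Rats_csq_real: "z \<in> adjoin \<rat> (csq d) \<Longrightarrow> Im z = 0"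
proof (elim adjoinE)
  fix a b assume ab: "a \<in> \<rat>" "b \<in> \<rat>" "z = a + b * csq d"
  have "Im q = 0" if "q \<in> \<rat>" for q :: complex
    using that by (elim Rats_cases') (metis Im_complex_of_real of_real_divide of_real_of_int_eq)
  then show ?thesis using ab by simp
qed

section \<open>Units of subfields and of real quadratic fields\<close>

lemma ring_of_integers_closed:
  assumes "is_subfield K" "u \<in> ring_of_integers K" "v \<in> ring_of_integers K"
  shows "u + v \<in> ring_of_integers K" "u - v \<in> ring_of_integers K"
    "u * v \<in> ring_of_integers K" "- u \<in> ring_of_integers K"
  using assms is_subfieldD[OF assms(1)] unfolding ring_of_integers_def
  by (auto intro: algebraic_int_minus)

lemma unit_ofD: "unit_of K u \<Longrightarrow> u \<in> K" "unit_of K u \<Longrightarrow> algebraic_int u" "unit_of K u \<Longrightarrow> u \<noteq> 0"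
    "unit_of K u \<Longrightarrow> algebraic_int (inverse u)"
  by (auto simp: unit_of_def ring_of_integers_def)

lemma unit_of_iff:
  "is_subfield K \<Longrightarrow> unit_of K u \<longleftrightarrow> u \<in> K \<and> u \<noteq> 0 \<and> algebraic_int u \<and> algebraic_int (inverse u)"
  using is_subfieldD(6) by (auto simp: unit_of_def ring_of_integers_def)

lemma unit_of_mult: "is_subfield K \<Longrightarrow> unit_of K u \<Longrightarrow> unit_of K v \<Longrightarrow> unit_of K (u * v)"
  by (auto simp: unit_of_iff is_subfieldD algebraic_int_times)

lemma unit_of_inverse: "is_subfield K \<Longrightarrow> unit_of K u \<Longrightarrow> unit_of K (inverse u)"
  by (auto simp: unit_of_iff is_subfieldD)

lemma unit_of_minus: "is_subfield K \<Longrightarrow> unit_of K u \<Longrightarrow> unit_of K (- u)"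
  by (auto simp: unit_of_iff is_subfieldD algebraic_int_minus)

lemma unit_of_1: "is_subfield K \<Longrightarrow> unit_of K 1"
  by (auto simp: unit_of_iff is_subfieldD)

lemma unit_of_power: "is_subfield K \<Longrightarrow> unit_of K u \<Longrightarrow> unit_of K (u ^ n)"
  by (induction n) (auto intro: unit_of_1 unit_of_mult)

lemma unit_of_power_int: "is_subfield K \<Longrightarrow> unit_of K u \<Longrightarrow> unit_of K (u powi n)"
  by (auto simp: power_int_def intro: unit_of_power unit_of_inverse)

lemma algebraic_int_square_root: "algebraic_int (z\<^sup>2) \<Longrightarrow> algebraic_int (z :: complex)"
  by (rule algebraic_int_root[of "z\<^sup>2" "monom 1 2"]) (auto simp: poly_monom degree_monom_eq)

lemma unit_of_square_root:
  assumes "is_subfield K" "\<eta> \<in> K" "unit_of K (\<eta>\<^sup>2)"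
  shows "unit_of K \<eta>"
proof -
  have "algebraic_int (\<eta>\<^sup>2)" "algebraic_int ((inverse \<eta>)\<^sup>2)" "\<eta> \<noteq> 0"
    using unit_ofD[OF assms(3)] by (auto simp: power_inverse)
  then show ?thesis using assms algebraic_int_square_root by (simp add: unit_of_iff)
qed

lemma fundamental_unitD:
  assumes "fundamental_unit d \<epsilon>"
  shows "unit_of (adjoin \<rat> (csq d)) \<epsilon>" "Im \<epsilon> = 0" "Re \<epsilon> > 1"
    "\<And>u. unit_of (adjoin \<rat> (csq d)) u \<Longrightarrow> Re u > 1 \<Longrightarrow> Re \<epsilon> \<le> Re u"
  using assms adjoin_Rats_csq_real unit_ofD(1)
  unfolding fundamental_unit_def Let_def field_gen_csq by blast+

lemma Re_power_int_of_real: "Im z = 0 \<Longrightarrow> Re (z powi n) = Re z powi n \<and> Im (z powi n) = 0"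
proof -
  assume "Im z = 0"
  then have "z = of_real (Re z)" by (simp add: complex_eq_iff)
  then show ?thesis by (metis Im_complex_of_real Re_complex_of_real of_real_power_int)
qed

text \<open>For positive u let n be the integer part of its logarithm to base \<epsilon>. Then u
  divided by the n-th power of \<epsilon> is a unit in the interval from 1 to below \<epsilon>, and
  minimality leaves only 1.\<close>

lemma units_real_quadratic:
  assumes f: "fundamental_unit d \<epsilon>" and u: "unit_of (adjoin \<rat> (csq d)) u"
  obtains n :: int where "u = \<epsilon> powi n \<or> u = - (\<epsilon> powi n)"
proof -
  define K where "K = adjoin \<rat> (csq d)"
  have K: "is_subfield K"
    unfolding K_def by (rule sqrt_adjoin.is_subfield_adjoin[OF sqrt_adjoin_csq[OF is_subfield_Rats]])
  note fu = fundamental_unitD[OF f, folded K_def]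
  have *: "\<exists>n. w = \<epsilon> powi n" if w: "unit_of K w" "Re w > 0" for w
  proof -
    define n where "n = \<lfloor>log (Re \<epsilon>) (Re w)\<rfloor>"
    have "real_of_int n \<le> log (Re \<epsilon>) (Re w)" "log (Re \<epsilon>) (Re w) < real_of_int n + 1"
      unfolding n_def by linarith+
    then have "Re \<epsilon> powr n \<le> Re w" "Re w < Re \<epsilon> powr (n + 1)"
      using fu(3) w(2) by (simp_all add: le_log_iff log_less_iff)
    then have b: "Re \<epsilon> powi n \<le> Re w" "Re w < Re \<epsilon> powi n * Re \<epsilon>"
      using fu(3) powr_real_of_int'[of "Re \<epsilon>" n] powr_add[of "Re \<epsilon>" n 1] by simp_all
    have pos: "Re \<epsilon> powi n > 0" using fu(3) by simp
    have imw: "Im w = 0" using w(1) adjoin_Rats_csq_real unit_ofD(1) unfolding K_def by blast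
    define v where "v = w * inverse (\<epsilon> powi n)"
    have uv: "unit_of K v" unfolding v_def
      using K w fu(1) by (intro unit_of_mult unit_of_inverse unit_of_power_int)
    have rv: "Re v = Re w / (Re \<epsilon> powi n)" "Im v = 0"
      using Re_power_int_of_real[OF fu(2), of n] imw pos
      by (simp_all add: v_def Re_divide Im_divide divide_inverse[symmetric] power2_eq_square)
    have "1 \<le> Re v" "Re v < Re \<epsilon>"
      using b pos by (simp_all add: rv pos_divide_less_eq mult.commute)
    then have "Re v = 1" using fu(4)[OF uv] by fastforce
    then have "v = 1" using rv(2) by (simp only: complex_eq_iff) simp
    moreover have "\<epsilon> powi n \<noteq> 0" using fu(3) by auto
    ultimately have "w = \<epsilon> powi n" by (simp add: v_def field_simps)
    then show ?thesis ..
  qed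
  have "Im u = 0" "u \<noteq> 0" using u adjoin_Rats_csq_real unit_ofD(1,3) by blast+
  then have "Re u > 0 \<or> Re (- u) > 0" by (auto simp: complex_eq_iff)
  then show ?thesis
  proof
    assume "Re u > 0"
    then show ?thesis using *[of u] u that unfolding K_def by blast
  next
    assume "Re (- u) > 0"
    then obtain n where "- u = \<epsilon> powi n" using *[of "- u"] u unit_of_minus[OF K] unfolding K_def by blast
    then have "u = - (\<epsilon> powi n)" by (metis minus_minus)
    then show ?thesis using that by blast
  qed
qed

text \<open>A root \<eta> would be a unit with 1 < \<eta> < \<epsilon>.\<close>

lemma fundamental_unit_not_square:
  assumes f: "fundamental_unit d \<epsilon>" and "\<eta> \<in> adjoin \<rat> (csq d)" "Re \<eta> > 0"
  shows "\<eta>\<^sup>2 \<noteq> \<epsilon>"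
proof
  assume e: "\<eta>\<^sup>2 = \<epsilon>"
  note fu = fundamental_unitD[OF f]
  have K: "is_subfield (adjoin \<rat> (csq d))"
    by (rule sqrt_adjoin.is_subfield_adjoin[OF sqrt_adjoin_csq[OF is_subfield_Rats]])
  have "unit_of (adjoin \<rat> (csq d)) \<eta>" using unit_of_square_root[OF K assms(2)] e fu(1) by simp
  moreover have re: "Re \<epsilon> = (Re \<eta>)\<^sup>2"
    using e adjoin_Rats_csq_real[OF assms(2)] by (auto simp: power2_eq_square)
  then have "Re \<eta> > 1" using fu(3) assms(3) by (metis less_eq_real_def not_le one_power2 power_mono)
  ultimately have "Re \<epsilon> \<le> Re \<eta>" using fu(4) by blast
  then show False using re \<open>Re \<eta> > 1\<close> by (simp add: power2_eq_square)
qed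

text \<open>The root u sqrt n1 + v sqrt n2 lies in Q(sqrt d) itself when n1 or n2 is 1, which a
  fundamental unit forbids; only the nontrivial splittings of d remain.\<close>

lemma fundamental_unit_factorization:
  fixes a b :: int
  assumes f: "fundamental_unit d (of_int a + of_int b * csq d)"
    and nrm: "a\<^sup>2 - int d * b\<^sup>2 = 1" and par: "odd a" "even b" and d: "d > 0"
  obtains n1 n2 u v :: nat where "d = n1 * n2" "n1 \<noteq> 1" "n2 \<noteq> 1" "u > 0" "v > 0"
    "a + 1 = int (2 * n1 * u\<^sup>2)" "a - 1 = int (2 * n2 * v\<^sup>2)"
    "of_int a + of_int b * csq d = (of_nat u * csq n1 + of_nat v * csq n2)\<^sup>2"
proof -
  define s where "s = sqrt (real d)"
  have s2: "s * s = real d" by (simp add: s_def)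
  have s0: "s > 0" using d by (simp add: s_def)
  define e where "e = of_int a + of_int b * s"
  have e1: "e > 1" using fundamental_unitD(3)[OF f] by (simp add: e_def s_def)
  have "e * (of_int a - of_int b * s) = of_int (a\<^sup>2 - int d * b\<^sup>2)"
    by (simp add: e_def algebra_simps power2_eq_square s2[symmetric])
  then have "e * (of_int a - of_int b * s) = 1" using nrm by simp
  then have q: "of_int a - of_int b * s = 1 / e" using e1 by (simp add: field_simps)
  \<comment> \<open>The conjugate 1/e is positive and smaller than e, so both coefficients, being
    half sums and half differences, are positive.\<close>
  have "1 / e > 0" "1 / e < 1" using e1 by simp_all
  then have "real_of_int a > 0" "of_int b * s > 0" using q e1 unfolding e_def by linarith+
  then have a0: "a > 0" and b0: "b > 0" using s0 by (simp_all add: zero_less_mult_iff)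
  define a' where "a' = nat a"
  define b' where "b' = nat b"
  have ab: "a = int a'" "b = int b'" using a0 b0 by (simp_all add: a'_def b'_def)
  have "int (a'\<^sup>2) = int (1 + d * b'\<^sup>2)" using nrm ab by simp
  then have "a'\<^sup>2 = 1 + d * b'\<^sup>2" by (simp only: of_nat_eq_iff)
  then obtain n1 n2 u v where n: "d = n1 * n2" "a' + 1 = 2 * n1 * u\<^sup>2" "a' = 2 * n2 * v\<^sup>2 + 1" "b' = 2 * u * v"
    using norm_one_factorization[of a' d b'] par b0 d ab by (metis even_of_nat of_nat_0_less_iff)
  have uv: "u > 0" "v > 0" using n(4) b0 ab by (auto intro: gr0I)
  have "a' = n1 * u\<^sup>2 + n2 * v\<^sup>2" using n(2,3) by linarith
  then have sq: "of_int a + of_int b * csq d = (of_nat u * csq n1 + of_nat v * csq n2)\<^sup>2"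
    unfolding ab n(1,4) csq_mult
    by (simp add: power2_eq_square algebra_simps csq_mult_self)
  have pos: "Re (of_nat u * csq n1 + of_nat v * csq n2) > 0"
    using uv d n(1) by (auto intro!: add_pos_pos mult_pos_pos)
  have "n1 \<noteq> 1"
  proof
    assume "n1 = 1"
    then have "of_nat u * csq n1 + of_nat v * csq n2 = of_nat u + of_nat v * csq d" using n(1) by simp
    then have "of_nat u * csq n1 + of_nat v * csq n2 \<in> adjoin \<rat> (csq d)" by (simp only:) (rule adjoinI; simp)
    then show False using fundamental_unit_not_square[OF f _ pos] sq by simp
  qed
  moreover have "n2 \<noteq> 1"
  proof
    assume "n2 = 1"
    then have "of_nat u * csq n1 + of_nat v * csq n2 = of_nat v + of_nat u * csq d" using n(1) by simp
    then have "of_nat u * csq n1 + of_nat v * csq n2 \<in> adjoin \<rat> (csq d)" by (simp only:) (rule adjoinI; simp)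
    then show False using fundamental_unit_not_square[OF f _ pos] sq by simp
  qed
  moreover have "a + 1 = int (2 * n1 * u\<^sup>2)" "a - 1 = int (2 * n2 * v\<^sup>2)" using n(2,3) ab by linarith+
  ultimately show ?thesis using that n(1) uv sq by blast
qed

lemma prime_mult_eq_cases:
  fixes a b c p :: nat
  assumes "prime p" "a * b = p * c"
  obtains a' where "a = p * a'" "a' * b = c" | b' where "b = p * b'" "a * b' = c"
proof -
  have "p > 0" using assms(1) prime_gt_0_nat by blast
  have "p dvd a \<or> p dvd b" using assms by (metis dvd_triv_left prime_dvd_mult_iff)
  then show ?thesis using assms(2) that \<open>p > 0\<close> by (elim disjE dvdE) auto
qed

section \<open>The biquadratic extension over the Gaussian field\<close>

abbreviation Qi :: "complex set" where
  "Qi \<equiv> adjoin \<rat> \<i>"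

interpretation gaussian: sqrt_adjoin \<rat> \<i>
  by unfold_locales (auto simp: is_subfield_Rats)

lemma Rats_Im_0: "q \<in> \<rat> \<Longrightarrow> Im q = 0"
  by (elim Rats_cases') (metis Im_complex_of_real of_real_divide of_real_of_int_eq)

lemma Rats_cnj: "q \<in> \<rat> \<Longrightarrow> cnj q = q"
  using Rats_Im_0 by (simp add: complex_eq_iff)

lemma gaussian_fieldE:
  assumes "q \<in> Qi"
  obtains a b where "a \<in> \<rat>" "b \<in> \<rat>" "q = a + b * \<i>" "cnj q = a - b * \<i>"
    "a = of_real (Re q)" "b = of_real (Im q)"
proof -
  obtain a b where ab: "a \<in> \<rat>" "b \<in> \<rat>" "q = a + b * \<i>" using assms by (elim adjoinE)
  have "Im a = 0" "Im b = 0" using ab Rats_Im_0 by blast+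
  then have "cnj q = a - b * \<i>" "a = of_real (Re q)" "b = of_real (Im q)"
    using ab(3) by (simp_all add: complex_eq_iff)
  then show ?thesis using that ab by blast
qed

lemma gaussian_field_cnj: "q \<in> Qi \<Longrightarrow> cnj q \<in> Qi"
proof (elim gaussian_fieldE)
  fix a b assume "a \<in> \<rat>" "b \<in> \<rat>" "cnj q = a - b * \<i>"
  then show ?thesis using adjoinI[of a \<rat> "- b" \<i>] by simp
qed

lemma csq_in_gaussian_field_iff: "csq m \<in> Qi \<longleftrightarrow> csq m \<in> \<rat>"
proof
  assume "csq m \<in> Qi"
  then obtain a b where "a \<in> \<rat>" "csq m = a + b * \<i>" "b = of_real (Im (csq m))"
    by (rule gaussian_fieldE)
  then show "csq m \<in> \<rat>" by simp
qed (use gaussian.base_subset in blast)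

lemma quadratic_ext_gaussian: "csq m \<notin> \<rat> \<Longrightarrow> quadratic_ext Qi (csq m)"
  using sqrt_adjoin_csq[OF gaussian.is_subfield_adjoin] csq_in_gaussian_field_iff
  by (simp add: quadratic_ext_def quadratic_ext_axioms_def)

lemma adjoin_gaussian_real:
  assumes "z \<in> adjoin Qi (csq m)" "Im z = 0"
  shows "z \<in> adjoin \<rat> (csq m)"
proof -
  obtain a b where ab: "a \<in> Qi" "b \<in> Qi" "z = a + b * csq m"
    using assms(1) by (rule adjoinE)
  have "complex_of_real (Re a) \<in> \<rat>" "complex_of_real (Re b) \<in> \<rat>"
    using ab(1,2) by (metis gaussian_fieldE)+
  moreover have "z = of_real (Re a) + of_real (Re b) * csq m"
    using assms(2) ab(3) by (simp add: complex_eq_iff)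
  ultimately show ?thesis using adjoinI by metis
qed

lemma rational_algebraic_int_double: "a \<in> \<rat> \<Longrightarrow> algebraic_int (2 * a :: complex) \<Longrightarrow> 2 * a \<in> \<int>"
  using rational_algebraic_int_is_int Rats_mult[OF Rats_number_of] by blast

section \<open>Algebraic integers of absolute value 1\<close>

definition mu4 :: "complex set" where "mu4 = {1, -1, \<i>, - \<i>}"

lemma mu4_mult: "a \<in> mu4 \<Longrightarrow> b \<in> mu4 \<Longrightarrow> a * b \<in> mu4"
  by (auto simp: mu4_def)

lemma mu4_inverse: "a \<in> mu4 \<Longrightarrow> inverse a \<in> mu4"
  by (auto simp: mu4_def)

text \<open>Twice the real and twice the imaginary part are integers s and t with s^2 + t^2 = 4,
  which leaves four points.\<close>

lemma gaussian_field_unit_circle: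
  assumes "q \<in> Qi" "algebraic_int q" "q * cnj q = 1"
  shows "q \<in> mu4"
proof -
  obtain a b where ab: "a \<in> \<rat>" "b \<in> \<rat>" "q = a + b * \<i>" "cnj q = a - b * \<i>"
    "a = of_real (Re q)" "b = of_real (Im q)"
    using assms(1) by (elim gaussian_fieldE)
  have "algebraic_int (q + cnj q)" "algebraic_int ((cnj q - q) * \<i>)"
    using assms(2) by auto
  moreover have "q + cnj q = (a + b * \<i>) + (a - b * \<i>)"
      "(cnj q - q) * \<i> = ((a - b * \<i>) - (a + b * \<i>)) * \<i>"
    by (simp_all only: ab(3)[symmetric] ab(4)[symmetric])
  then have "q + cnj q = 2 * a" "(cnj q - q) * \<i> = 2 * b" by (simp_all add: algebra_simps)
  ultimately have "algebraic_int (2 * a)" "algebraic_int (2 * b)" by (simp_all only:)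
  then have "2 * a \<in> \<int>" "2 * b \<in> \<int>"
    using ab(1,2) rational_algebraic_int_double by blast+
  then obtain s t where st: "2 * a = of_int s" "2 * b = of_int t" by (meson Ints_cases)
  have "(2 * a)\<^sup>2 + (2 * b)\<^sup>2 = 4 * ((a + b * \<i>) * (a - b * \<i>))" by (simp add: algebra_simps power2_eq_square)
  also have "\<dots> = 4" using assms(3) ab(3,4) by simp
  finally have "(of_int (s\<^sup>2 + t\<^sup>2) :: complex) = of_int 4" by (simp add: st)
  then have eq: "s\<^sup>2 + t\<^sup>2 = 4" by (simp only: of_int_eq_iff)
  have "s\<^sup>2 \<le> 4" "t\<^sup>2 \<le> 4" using eq zero_le_power2[of s] zero_le_power2[of t] by linarith+
  then have "\<bar>s\<bar> \<le> 2" "\<bar>t\<bar> \<le> 2" using abs_le_square_iff[of s 2] abs_le_square_iff[of t 2] by simp_all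
  then have "s \<in> {-2, -1, 0, 1, 2}" "t \<in> {-2, -1, 0, 1, 2}" by auto
  then have "(s, t) \<in> {(2, 0), (-2, 0), (0, 2), (0, -2)}" using eq by auto
  moreover have "q = of_int s / 2 + of_int t / 2 * \<i>" using st ab(3) by (simp add: field_simps)
  ultimately show ?thesis by (auto simp: mu4_def)
qed

text \<open>The square of y is the product of two elements of absolute value 1 from smaller fields:
  its norm to Q(\<i>), and an element of the imaginary quadratic field Q(sqrt (-m)), where m \<ge> 5
  leaves only 1 and -1.\<close>

lemma gaussian_quadratic_unit_circle:
  assumes m: "squarefree m" "m \<ge> 5"
    and y: "y \<in> adjoin Qi (csq m)" "algebraic_int y" "y * cnj y = 1"
  shows "y\<^sup>2 \<in> mu4"
proof -
  have irr: "csq m \<notin> \<rat>" using m by (intro squarefree_csq_irrational) auto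
  interpret quadratic_ext Qi "csq m" by (rule quadratic_ext_gaussian[OF irr])
  obtain a b where ab: "a \<in> Qi" "b \<in> Qi" "y = a + b * csq m"
    using y(1) by (rule adjoinE)
  have s: "cj y = a - b * csq m" unfolding ab(3) using ab(1,2) by (rule cj_eq)
  have cn: "cnj y = cnj a + cnj b * csq m" using ab(3) by simp
  have cnG: "cnj a \<in> Qi" "cnj b \<in> Qi" using ab gaussian_field_cnj by auto
  then have cnA: "cnj y \<in> adjoin Qi (csq m)" unfolding cn by (rule adjoinI)
  have "cj (cnj y) = cnj a - cnj b * csq m" unfolding cn using cnG by (rule cj_eq)
  then have sc: "cj (cnj y) = cnj (cj y)" using s by simp
  have s1: "cj y * cnj (cj y) = 1"
    using cj_mult[OF y(1) cnA] y(3) cj_base[OF closed(2)] sc by simp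
  have si: "algebraic_int (cj y)" by (rule cj_algebraic_int[OF y(1,2)])
  have g: "y * cj y \<in> mu4"
  proof (rule gaussian_field_unit_circle)
    show "y * cj y \<in> Qi" by (rule norm_in_base[OF y(1)])
    show "algebraic_int (y * cj y)" using y(2) si by blast
    show "y * cj y * cnj (y * cj y) = 1" using arg_cong2[OF y(3) s1, of "(*)"] by (simp add: ac_simps)
  qed
  \<comment> \<open>\<open>h\<close> is fixed by the composite of \<open>cj\<close> and complex
    conjugation, so it lies in the field generated by \<i> sqrt m.\<close>
  define h where "h = y * cnj (cj y)"
  obtain a1 a2 where a: "a1 \<in> \<rat>" "a2 \<in> \<rat>" "a = a1 + a2 * \<i>" "cnj a = a1 - a2 * \<i>"
    using ab(1) by (metis gaussian_fieldE)
  obtain b1 b2 where b: "b1 \<in> \<rat>" "b2 \<in> \<rat>" "b = b1 + b2 * \<i>" "cnj b = b1 - b2 * \<i>"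
    using ab(2) by (metis gaussian_fieldE)
  define A where "A = a1 * a1 + a2 * a2 - of_nat m * (b1 * b1 + b2 * b2)"
  define B where "B = 2 * (b2 * a1 - b1 * a2)"
  have AB: "A \<in> \<rat>" "B \<in> \<rat>" unfolding A_def B_def using a b by auto
  have h: "h = A + B * (\<i> * csq m)"
  proof -
    have "cnj (cj y) = cnj a - cnj b * csq m" using s by simp
    then have "h = y * (cnj a - cnj b * csq m)" by (simp only: h_def)
    also have "\<dots> = ((a1 + a2 * \<i>) + (b1 + b2 * \<i>) * csq m) * ((a1 - a2 * \<i>) - (b1 - b2 * \<i>) * csq m)"
      by (simp only: ab(3) a(3)[symmetric] a(4)[symmetric] b(3)[symmetric] b(4)[symmetric])
    also have "\<dots> = A + B * (\<i> * csq m)" unfolding A_def B_def csq_mult_self[symmetric]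
      by (simp add: algebra_simps)
    finally show ?thesis .
  qed
  have hc: "cnj h = A - B * (\<i> * csq m)" using AB Rats_cnj unfolding h by simp
  have hi: "algebraic_int h" unfolding h_def using y(2) si by auto
  then have "algebraic_int (h + cnj h)" by auto
  then have "algebraic_int (2 * A)" using h hc by simp
  then have "2 * A \<in> \<int>" using AB(1) rational_algebraic_int_double by blast
  then obtain c where c: "2 * A = of_int c" by (elim Ints_cases)
  have "h * cnj h = (y * cnj y) * (cj y * cnj (cj y))" by (simp add: h_def ac_simps)
  then have h1: "h * cnj h = 1" using s1 y(3) by simp
  have "h * cnj h = A\<^sup>2 + of_nat m * B\<^sup>2"
    unfolding hc unfolding h csq_mult_self[symmetric] by (simp add: algebra_simps power2_eq_square)
  then have e: "A\<^sup>2 + of_nat m * B\<^sup>2 = 1" using h1 by simp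
  have e2: "of_nat m * (2 * B)\<^sup>2 = 4 - (2 * A)\<^sup>2"
    using arg_cong[OF e, of "\<lambda>t. 4 * t"] by (simp add: algebra_simps power2_eq_square)
  then have "of_nat m * (2 * B)\<^sup>2 = of_int (4 - c\<^sup>2)" unfolding c by simp
  then have mi: "of_nat m * (2 * B)\<^sup>2 \<in> \<int>" by (metis Ints_of_int)
  have "2 * B \<in> \<rat>" using AB(2) by (rule Rats_mult[OF Rats_number_of])
  then have "2 * B \<in> \<int>" by (rule squarefree_times_rational_square[OF m(1) _ mi])
  then obtain t where t: "2 * B = of_int t" by (elim Ints_cases)
  have "of_int (int m * t\<^sup>2) = (of_int (4 - c\<^sup>2) :: complex)" using e2 unfolding t c by simp
  then have e3: "int m * t\<^sup>2 = 4 - c\<^sup>2" by (simp only: of_int_eq_iff)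
  \<comment> \<open>A nonzero t would make the left side of m t^2 = 4 - c^2 at least 5.\<close>
  have "t = 0"
  proof (rule ccontr)
    assume "t \<noteq> 0"
    then have "t\<^sup>2 \<ge> 1" by (simp add: int_one_le_iff_zero_less)
    then have "int m * t\<^sup>2 \<ge> int m * 1" by (intro mult_left_mono) auto
    moreover have "c\<^sup>2 \<ge> 0" by simp
    ultimately show False using e3 m(2) by linarith
  qed
  then have "B = 0" using t by simp
  then have "A\<^sup>2 = 1" "h = A" using e h by simp_all
  then have "h \<in> mu4" by (auto simp: mu4_def power2_eq_1_iff)
  moreover have "y\<^sup>2 = (y * cj y) * h"
  proof -
    have "y * cj y * h = y\<^sup>2 * (cj y * cnj (cj y))" by (simp add: h_def power2_eq_square)
    then show ?thesis unfolding s1 by simp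
  qed
  ultimately show ?thesis using g mu4_mult by metis
qed

section \<open>The field L, its three intermediate fields over Q(\<i>) and its Galois group\<close>

locale biquad =
  fixes p1 p2 :: nat
  assumes prime: "prime p1" "prime p2"
    and mod4: "p1 mod 4 = 1" "p2 mod 4 = 1"
    and distinct: "p1 \<noteq> p2"
begin

definition P where "P = csq p1"
definition R where "R = csq (2 * p2)"
definition D where "D = csq (2 * p1 * p2)"

definition k where "k = adjoin Qi D"
definition M1 where "M1 = adjoin Qi P"
definition M2 where "M2 = adjoin Qi R"
definition L where "L = adjoin k P"

lemma D_eq: "D = P * R"
  unfolding P_def R_def D_def csq_mult[symmetric] by (simp add: ac_simps)

lemma p_ge_5: "p1 \<ge> 5" "p2 \<ge> 5"
  using mod4 prime prime_gt_1_nat[of p1] prime_gt_1_nat[of p2] by presburger+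

lemma coprimes: "coprime p1 p2" "coprime 2 p1" "coprime 2 p2" "odd p1" "odd p2"
proof -
  show "coprime p1 p2" using prime distinct by (rule primes_coprime)
  show "odd p1" "odd p2" using mod4 by presburger+
  then show "coprime 2 p1" "coprime 2 p2" by simp_all
qed

lemma squarefrees: "squarefree p1" "squarefree p2" "squarefree (2::nat)" "squarefree (2 * p1)"
  "squarefree (2 * p2)" "squarefree (p1 * p2)" "squarefree (2 * p1 * p2)"
proof -
  show s: "squarefree p1" "squarefree p2" "squarefree (2::nat)"
    using prime by (simp_all add: squarefree_prime)
  show "squarefree (2 * p1)" "squarefree (2 * p2)" "squarefree (p1 * p2)"
    using s coprimes by (simp_all add: squarefree_mult_coprime)
  then show "squarefree (2 * p1 * p2)"
    using s coprimes by (intro squarefree_mult_coprime) simp_all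
qed

lemma irrationals: "csq p1 \<notin> \<rat>" "csq p2 \<notin> \<rat>" "csq 2 \<notin> \<rat>" "csq (2 * p1) \<notin> \<rat>"
  "csq (2 * p2) \<notin> \<rat>" "csq (p1 * p2) \<notin> \<rat>" "csq (2 * p1 * p2) \<notin> \<rat>"
  using p_ge_5 squarefrees by (intro squarefree_csq_irrational; simp)+

lemma PP: "P * P = of_nat p1" and RR: "R * R = of_nat (2 * p2)" and DD: "D * D = of_nat (2 * p1 * p2)"
  unfolding P_def R_def D_def by (rule csq_mult_self)+

lemma PRD_nonzero: "P \<noteq> 0" "R \<noteq> 0" "D \<noteq> 0"
  unfolding P_def R_def D_def using p_ge_5 by auto

lemma PRD_cnj: "cnj P = P" "cnj R = R" "cnj D = D"
  by (simp_all add: P_def R_def D_def)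

lemma PRD_algebraic_int: "algebraic_int P" "algebraic_int R" "algebraic_int D"
  unfolding P_def R_def D_def by (rule algebraic_int_csq)+

sublocale kG: quadratic_ext Qi D
  rewrites "adjoin Qi D = k"
  using quadratic_ext_gaussian[OF irrationals(7), folded D_def] by (simp_all add: k_def)

sublocale M1G: quadratic_ext Qi P
  rewrites "adjoin Qi P = M1"
  using quadratic_ext_gaussian[OF irrationals(1), folded P_def] by (simp_all add: M1_def)

sublocale M2G: quadratic_ext Qi R
  rewrites "adjoin Qi R = M2"
  using quadratic_ext_gaussian[OF irrationals(5), folded R_def] by (simp_all add: M2_def)

end

text \<open>Outside \<open>mu4\<close> such a y is a primitive eighth root of unity, which yields
  sqrt 2 after multiplication by 1 + \<i> or 1 - \<i>, up to sign.\<close>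

lemma mu4_cases:
  assumes "y\<^sup>2 \<in> mu4"
  shows "y \<in> mu4 \<or> csq 2 = y * (1 - \<i>) \<or> csq 2 = - y * (1 - \<i>) \<or> csq 2 = y * (1 + \<i>) \<or> csq 2 = - y * (1 + \<i>)"
proof -
  have *: "csq 2 = w \<or> csq 2 = - w" if "w\<^sup>2 = 2" for w
  proof -
    have "w\<^sup>2 = (csq 2)\<^sup>2" using that csq_square[of 2] by simp
    then show ?thesis using power2_eq_iff[of w "csq 2"] by auto
  qed
  consider "y\<^sup>2 = 1" | "y\<^sup>2 = -1" | "y\<^sup>2 = \<i>" | "y\<^sup>2 = - \<i>" using assms by (auto simp: mu4_def)
  then show ?thesis
  proof cases
    case 1
    then show ?thesis by (auto simp: mu4_def power2_eq_1_iff)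
  next
    case 2
    then have "y\<^sup>2 = \<i>\<^sup>2" by simp
    then have "y = \<i> \<or> y = - \<i>" by (simp only: power2_eq_iff)
    then show ?thesis by (auto simp: mu4_def)
  next
    case 3
    then have "(y * (1 - \<i>))\<^sup>2 = 2" unfolding power_mult_distrib by (simp add: power2_eq_square algebra_simps)
    from *[OF this] show ?thesis by auto
  next
    case 4
    then have "(y * (1 + \<i>))\<^sup>2 = 2" unfolding power_mult_distrib by (simp add: power2_eq_square algebra_simps)
    from *[OF this] show ?thesis by auto
  qed
qed

context biquad
begin

lemma is_subfields: "is_subfield k" "is_subfield M1" "is_subfield M2"
  using kG.is_subfield_adjoin M1G.is_subfield_adjoin M2G.is_subfield_adjoin by simp_all

lemma gaussian_not_mem:
  "P \<notin> Qi" "R \<notin> Qi" "D \<notin> Qi" "csq 2 \<notin> Qi"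
  "csq p2 \<notin> Qi" "csq (2 * p1) \<notin> Qi" "csq (p1 * p2) \<notin> Qi"
  using irrationals by (simp_all only: P_def R_def D_def csq_in_gaussian_field_iff not_False_eq_True)

lemma R_eq: "R = D * P / of_nat p1" and P_eq: "P = D * R / of_nat (2 * p2)"
proof -
  have "D * P = R * (P * P)" "D * R = P * (R * R)" unfolding D_eq by simp_all
  then show "R = D * P / of_nat p1" "P = D * R / of_nat (2 * p2)"
    unfolding PP RR using p_ge_5 by (simp_all add: field_simps)
qed

lemma csq_square_in: "is_subfield F \<Longrightarrow> (csq m)\<^sup>2 \<in> F"
    "is_subfield F \<Longrightarrow> P\<^sup>2 \<in> F" "is_subfield F \<Longrightarrow> R\<^sup>2 \<in> F"
  by (simp_all only: P_def R_def csq_square is_subfield_of_nat)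

lemma P_notin_k: "P \<notin> k"
proof
  assume "P \<in> k"
  then have "P \<in> Qi \<or> D * P \<in> Qi"
    using kG.square_in_adjoin[of P] csq_square_in[OF kG.subfield] gaussian_not_mem by blast
  then have "R \<in> Qi"
    using gaussian_not_mem R_eq kG.closed(8)[of "D * P" "of_nat p1"] kG.closed(9) by metis
  then show False using gaussian_not_mem by blast
qed

lemma R_notin_M1: "R \<notin> M1"
proof
  assume "R \<in> M1"
  then have "R \<in> Qi \<or> P * R \<in> Qi"
    using M1G.square_in_adjoin[of R] csq_square_in[OF kG.subfield] gaussian_not_mem by blast
  then show False using gaussian_not_mem D_eq by metis
qed

lemma P_notin_M2: "P \<notin> M2"
proof
  assume "P \<in> M2"
  then have "P \<in> Qi \<or> R * P \<in> Qi"
    using M2G.square_in_adjoin[of P] csq_square_in[OF kG.subfield] gaussian_not_mem by blast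
  then show False using gaussian_not_mem D_eq by (metis mult.commute)
qed

text \<open>Coordinates over Q(\<i>) in the basis 1, P, R, D. Grouping them over \<open>k\<close>,
  \<open>M1\<close> or \<open>M2\<close> turns the three conjugations into sign changes, after which
  relations between them are checked coordinatewise.\<close>

definition crd where "crd a b c e = a + b * P + c * R + e * D"

lemma crd_k: "crd a b c e = (a + e * D) + (b + c / of_nat p1 * D) * P"
proof -
  have "c * R = c / of_nat p1 * D * P" unfolding R_eq by simp
  then show ?thesis by (simp add: crd_def algebra_simps)
qed

lemma crd_M1: "crd a b c e = (a + b * P) + (c + e * P) * R"
  by (simp add: crd_def D_eq algebra_simps)

lemma crd_M2: "crd a b c e = (a + c * R) + (b + e * R) * P"
  by (simp add: crd_def D_eq algebra_simps)

lemma L_iff: "z \<in> L \<longleftrightarrow> (\<exists>a\<in>Qi. \<exists>b\<in>Qi. \<exists>c\<in>Qi. \<exists>e\<in>Qi. z = crd a b c e)"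
proof
  assume "z \<in> L"
  then obtain u v where uv: "u \<in> k" "v \<in> k" "z = u + v * P" unfolding L_def by (rule adjoinE)
  obtain a e where u: "a \<in> Qi" "e \<in> Qi" "u = a + e * D"
    using uv(1) unfolding k_def by (rule adjoinE)
  obtain b c where v: "b \<in> Qi" "c \<in> Qi" "v = b + c * D"
    using uv(2) unfolding k_def by (rule adjoinE)
  \<comment> \<open>The factor p1 comes from D * P = p1 * R.\<close>
  have "z = crd a b (c * of_nat p1) e" using uv(3) u(3) v(3) p_ge_5 by (simp add: crd_k)
  moreover have "c * of_nat p1 \<in> Qi" using v by (simp add: kG.closed)
  ultimately show "\<exists>a\<in>Qi. \<exists>b\<in>Qi. \<exists>c\<in>Qi. \<exists>e\<in>Qi. z = crd a b c e"
    using u v by blast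
next
  assume "\<exists>a\<in>Qi. \<exists>b\<in>Qi. \<exists>c\<in>Qi. \<exists>e\<in>Qi. z = crd a b c e"
  then obtain a b c e where *: "a \<in> Qi" "b \<in> Qi" "c \<in> Qi"
    "e \<in> Qi" "z = crd a b c e" by blast
  then have "a + e * D \<in> k" "b + c / of_nat p1 * D \<in> k"
    unfolding k_def by - (rule adjoinI; simp add: kG.closed)+
  then show "z \<in> L" unfolding *(5) crd_k L_def by (rule adjoinI)
qed

lemma LE:
  assumes "z \<in> L"
  obtains a b c e where "a \<in> Qi" "b \<in> Qi" "c \<in> Qi"
    "e \<in> Qi" "z = crd a b c e"
  using assms unfolding L_iff by blast

lemma L_eq_M1: "adjoin M1 R = L"
proof (intro Set.set_eqI iffI)
  fix z assume "z \<in> adjoin M1 R"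
  then obtain u v where uv: "u \<in> M1" "v \<in> M1" "z = u + v * R" by (rule adjoinE)
  obtain a b where u: "a \<in> Qi" "b \<in> Qi" "u = a + b * P"
    using uv(1) unfolding M1_def by (rule adjoinE)
  obtain c e where v: "c \<in> Qi" "e \<in> Qi" "v = c + e * P"
    using uv(2) unfolding M1_def by (rule adjoinE)
  have "z = crd a b c e" using uv(3) u(3) v(3) by (simp add: crd_M1)
  then show "z \<in> L" unfolding L_iff using u v by blast
next
  fix z assume "z \<in> L"
  then obtain a b c e where *: "a \<in> Qi" "b \<in> Qi" "c \<in> Qi"
    "e \<in> Qi" "z = crd a b c e" by (rule LE)
  then have "a + b * P \<in> M1" "c + e * P \<in> M1" unfolding M1_def by (auto intro!: adjoinI)
  then show "z \<in> adjoin M1 R" unfolding *(5) crd_M1 by (rule adjoinI)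
qed

lemma L_eq_M2: "adjoin M2 P = L"
proof (intro Set.set_eqI iffI)
  fix z assume "z \<in> adjoin M2 P"
  then obtain u v where uv: "u \<in> M2" "v \<in> M2" "z = u + v * P" by (rule adjoinE)
  obtain a c where u: "a \<in> Qi" "c \<in> Qi" "u = a + c * R"
    using uv(1) unfolding M2_def by (rule adjoinE)
  obtain b e where v: "b \<in> Qi" "e \<in> Qi" "v = b + e * R"
    using uv(2) unfolding M2_def by (rule adjoinE)
  have "z = crd a b c e" using uv(3) u(3) v(3) by (simp add: crd_M2)
  then show "z \<in> L" unfolding L_iff using u v by blast
next
  fix z assume "z \<in> L"
  then obtain a b c e where *: "a \<in> Qi" "b \<in> Qi" "c \<in> Qi"
    "e \<in> Qi" "z = crd a b c e" by (rule LE)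
  then have "a + c * R \<in> M2" "b + e * R \<in> M2" unfolding M2_def by (auto intro!: adjoinI)
  then show "z \<in> adjoin M2 P" unfolding *(5) crd_M2 by (rule adjoinI)
qed

text \<open>These are the three nontrivial elements of Gal(L/Q(\<i>)): \<sigma> fixes D, \<rho>
  fixes P and \<tau> fixes R.\<close>

definition \<sigma> where "\<sigma> = conj_over k P"
definition \<rho> where "\<rho> = conj_over M1 R"
definition \<tau> where "\<tau> = conj_over M2 P"

lemma quadratic_extI: "is_subfield F \<Longrightarrow> csq m \<notin> F \<Longrightarrow> quadratic_ext F (csq m)"
  using sqrt_adjoin_csq by (simp add: quadratic_ext_def quadratic_ext_axioms_def)

sublocale S: quadratic_ext k P
  rewrites "adjoin k P = L" and "conj_over k P = \<sigma>"
  using quadratic_extI[OF is_subfields(1), of p1] P_notin_k by (simp_all add: P_def[symmetric] L_def \<sigma>_def)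

sublocale Rh: quadratic_ext M1 R
  rewrites "adjoin M1 R = L" and "conj_over M1 R = \<rho>"
  using quadratic_extI[OF is_subfields(2), of "2 * p2", folded R_def] R_notin_M1 by (simp_all add: L_eq_M1 \<rho>_def)

sublocale T: quadratic_ext M2 P
  rewrites "adjoin M2 P = L" and "conj_over M2 P = \<tau>"
  using quadratic_extI[OF is_subfields(3), of p1] P_notin_M2 by (simp_all add: P_def[symmetric] L_eq_M2 \<tau>_def)

lemma is_subfield_L: "is_subfield L"
  by (rule S.is_subfield_adjoin)

lemmas L_closed = is_subfieldD[OF is_subfield_L] is_subfield_of_nat[OF is_subfield_L]
  is_subfield_of_int[OF is_subfield_L] is_subfield_numeral[OF is_subfield_L]

lemma gaussian_subset_L: "Qi \<subseteq> L"
  using kG.base_subset S.base_subset by blast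

lemma gens_in_L: "P \<in> L" "R \<in> L" "D \<in> L" "\<i> \<in> L"
  using S.gen_in Rh.gen_in kG.gen_in S.base_subset gaussian.gen_in gaussian_subset_L by blast+

lemma \<sigma>_crd:
  assumes "a \<in> Qi" "b \<in> Qi" "c \<in> Qi" "e \<in> Qi"
  shows "\<sigma> (crd a b c e) = crd a (- b) (- c) e"
proof -
  have "a + e * D \<in> k" "b + c / of_nat p1 * D \<in> k"
    unfolding k_def using assms by - (rule adjoinI; simp add: kG.closed)+
  then have "\<sigma> (crd a b c e) = (a + e * D) - (b + c / of_nat p1 * D) * P"
    unfolding crd_k by (rule S.cj_eq)
  then show ?thesis by (simp add: crd_k algebra_simps)
qed

lemma \<rho>_crd:
  assumes "a \<in> Qi" "b \<in> Qi" "c \<in> Qi" "e \<in> Qi"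
  shows "\<rho> (crd a b c e) = crd a b (- c) (- e)"
proof -
  have "a + b * P \<in> M1" "c + e * P \<in> M1" unfolding M1_def using assms by (auto intro!: adjoinI)
  then have "\<rho> (crd a b c e) = (a + b * P) - (c + e * P) * R" unfolding crd_M1 by (rule Rh.cj_eq)
  then show ?thesis by (simp add: crd_M1 algebra_simps)
qed

lemma \<tau>_crd:
  assumes "a \<in> Qi" "b \<in> Qi" "c \<in> Qi" "e \<in> Qi"
  shows "\<tau> (crd a b c e) = crd a (- b) c (- e)"
proof -
  have "a + c * R \<in> M2" "b + e * R \<in> M2" unfolding M2_def using assms by (auto intro!: adjoinI)
  then have "\<tau> (crd a b c e) = (a + c * R) - (b + e * R) * P" unfolding crd_M2 by (rule T.cj_eq)
  then show ?thesis by (simp add: crd_M2 algebra_simps)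
qed

lemma \<tau>_eq_\<rho>\<sigma>: "z \<in> L \<Longrightarrow> \<tau> z = \<rho> (\<sigma> z)"
  by (elim LE) (simp add: \<sigma>_crd \<rho>_crd \<tau>_crd kG.closed)

lemma \<rho>\<sigma>_commute: "z \<in> L \<Longrightarrow> \<sigma> (\<rho> z) = \<rho> (\<sigma> z)"
  by (elim LE) (simp add: \<sigma>_crd \<rho>_crd kG.closed)

lemma cnj_crd: "cnj (crd a b c e) = crd (cnj a) (cnj b) (cnj c) (cnj e)"
  by (simp add: crd_def PRD_cnj)

lemma cnj_in_L: "z \<in> L \<Longrightarrow> cnj z \<in> L"
  by (elim LE) (auto simp: cnj_crd L_iff intro!: bexI gaussian_field_cnj)

lemma \<sigma>_cnj: "z \<in> L \<Longrightarrow> \<sigma> (cnj z) = cnj (\<sigma> z)"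
  by (elim LE) (simp add: cnj_crd \<sigma>_crd gaussian_field_cnj kG.closed)

lemma \<rho>_cnj: "z \<in> L \<Longrightarrow> \<rho> (cnj z) = cnj (\<rho> z)"
  by (elim LE) (simp add: cnj_crd \<rho>_crd gaussian_field_cnj kG.closed)

lemma \<tau>_cnj: "z \<in> L \<Longrightarrow> \<tau> (cnj z) = cnj (\<tau> z)"
  by (elim LE) (simp add: cnj_crd \<tau>_crd gaussian_field_cnj kG.closed)

lemma \<sigma>_gens: "\<sigma> P = - P" "\<sigma> R = - R" "\<sigma> D = D" "\<sigma> \<i> = \<i>"
proof -
  have 0: "0 \<in> Qi" "1 \<in> Qi" "\<i> \<in> Qi" by (simp_all add: kG.closed gaussian.gen_in)
  show "\<sigma> P = - P" using \<sigma>_crd[of 0 1 0 0] 0 by (simp add: crd_def)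
  show "\<sigma> R = - R" using \<sigma>_crd[of 0 0 1 0] 0 by (simp add: crd_def)
  show "\<sigma> D = D" using \<sigma>_crd[of 0 0 0 1] 0 by (simp add: crd_def)
  show "\<sigma> \<i> = \<i>" using \<sigma>_crd[of \<i> 0 0 0] 0 by (simp add: crd_def)
qed

text \<open>Two applications of \<open>square_in_adjoin\<close> descend from L through M1 to
  Q(\<i>), where one of the roots of 2, p2, 2 p1, p1 p2 would have to lie.\<close>

lemma sqrt2_notin_L: "csq 2 \<notin> L"
proof
  assume "csq 2 \<in> L"
  then have "csq 2 \<in> M1 \<or> R * csq 2 \<in> M1"
    using Rh.square_in_adjoin[of "csq 2"] csq_square_in[OF is_subfields(2)] R_notin_M1 by blast
  moreover have "csq p2 = R * csq 2 / 2" unfolding R_def csq_mult using csq_mult_self[of 2] by simp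
  ultimately have "csq 2 \<in> M1 \<or> csq p2 \<in> M1"
    using is_subfieldD(8)[OF is_subfields(2) _ is_subfield_numeral[OF is_subfields(2)]] by metis
  then have "csq 2 \<in> Qi \<or> P * csq 2 \<in> Qi \<or>
      csq p2 \<in> Qi \<or> P * csq p2 \<in> Qi"
    using M1G.square_in_adjoin[of "csq 2"] M1G.square_in_adjoin[of "csq p2"]
      csq_square_in[OF kG.subfield] gaussian_not_mem by blast
  then show False
    using gaussian_not_mem csq_mult[of p1 2, folded P_def] csq_mult[of p1 p2, folded P_def]
    by (simp only: mult.commute[of p1 2]) metis
qed

lemma mu4_in_gaussian: "z \<in> mu4 \<Longrightarrow> z \<in> Qi"
  using gaussian.gen_in kG.closed by (auto simp: mu4_def)

text \<open>A counterexample would be a primitive eighth root of unity, and together with \<i> it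
  would put sqrt 2 into L.\<close>

lemma mu4_if_square:
  assumes "y \<in> L" "y\<^sup>2 \<in> mu4"
  shows "y \<in> mu4"
proof (rule ccontr)
  assume "y \<notin> mu4"
  moreover have "y * (1 - \<i>) \<in> L" "- y * (1 - \<i>) \<in> L" "y * (1 + \<i>) \<in> L" "- y * (1 + \<i>) \<in> L"
    using assms(1) gens_in_L by (simp_all add: L_closed)
  ultimately have "csq 2 \<in> L" using mu4_cases[OF assms(2)] by metis
  then show False using sqrt2_notin_L by blast
qed

text \<open>The conjugates of z also have absolute value 1, so the relative norms of z to k, M1 and
  M2 lie in \<open>mu4\<close> by the quadratic case. The product of the norms to M1 and M2 is z^2
  times \<open>\<rho> z * \<tau> z\<close>, and this last factor is the \<rho>-conjugate of
  \<open>z * \<sigma> z\<close>, hence in \<open>mu4\<close>. So z^2 is in \<open>mu4\<close>, and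
  then z.\<close>

lemma unit_circle_L:
  assumes z: "z \<in> L" "algebraic_int z" "z * cnj z = 1"
  shows "z \<in> mu4"
proof -
  have c: "\<sigma> z * cnj (\<sigma> z) = 1" "\<rho> z * cnj (\<rho> z) = 1" "\<tau> z * cnj (\<tau> z) = 1"
    using S.cj_mult[OF z(1) cnj_in_L[OF z(1)]] Rh.cj_mult[OF z(1) cnj_in_L[OF z(1)]]
      T.cj_mult[OF z(1) cnj_in_L[OF z(1)]] z(3) S.cj_base[OF S.closed(2)] Rh.cj_base[OF Rh.closed(2)]
      T.cj_base[OF T.closed(2)] by (simp_all add: \<sigma>_cnj[OF z(1)] \<rho>_cnj[OF z(1)] \<tau>_cnj[OF z(1)])
  have i: "algebraic_int (\<sigma> z)" "algebraic_int (\<rho> z)" "algebraic_int (\<tau> z)"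
    using S.cj_algebraic_int Rh.cj_algebraic_int T.cj_algebraic_int z by blast+
  have cc: "(z * w) * cnj (z * w) = 1" if "w * cnj w = 1" for w
    using arg_cong2[OF z(3) that, of "(*)"] by (simp add: ac_simps)
  have n: "z * \<sigma> z \<in> k" "z * \<rho> z \<in> M1" "z * \<tau> z \<in> M2"
    using S.norm_in_base Rh.norm_in_base T.norm_in_base z(1) by blast+
  have mem: "\<sigma> z \<in> L" "\<rho> z \<in> L" "\<tau> z \<in> L" using S.cj_in Rh.cj_in T.cj_in z(1) by blast+
  have s: "z * \<sigma> z \<in> mu4"
  proof (rule mu4_if_square)
    show "(z * \<sigma> z)\<^sup>2 \<in> mu4"
      using n(1) cc[OF c(1)] z(2) i(1) p_ge_5 squarefrees(7) unfolding k_def D_def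
      by (intro gaussian_quadratic_unit_circle[of "2 * p1 * p2"]) (auto intro: order.trans[of 5 p1])
  qed (use z mem in \<open>simp add: L_closed\<close>)
  have r: "z * \<rho> z \<in> mu4"
  proof (rule mu4_if_square)
    show "(z * \<rho> z)\<^sup>2 \<in> mu4"
      using n(2) cc[OF c(2)] z(2) i(2) p_ge_5 squarefrees(1) unfolding M1_def P_def
      by (intro gaussian_quadratic_unit_circle[of p1]) auto
  qed (use z mem in \<open>simp add: L_closed\<close>)
  have t: "z * \<tau> z \<in> mu4"
  proof (rule mu4_if_square)
    show "(z * \<tau> z)\<^sup>2 \<in> mu4"
      using n(3) cc[OF c(3)] z(2) i(3) p_ge_5 squarefrees(5) unfolding M2_def R_def
      by (intro gaussian_quadratic_unit_circle[of "2 * p2"]) auto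
  qed (use z mem in \<open>simp add: L_closed\<close>)
  have "\<rho> (z * \<sigma> z) = \<rho> z * \<tau> z" using Rh.cj_mult[OF z(1) mem(1)] \<tau>_eq_\<rho>\<sigma>[OF z(1)] by simp
  moreover have "\<rho> (z * \<sigma> z) = z * \<sigma> z"
    using s mu4_in_gaussian M1G.base_subset Rh.cj_base by blast
  ultimately have e: "\<rho> z * \<tau> z = z * \<sigma> z" by simp
  have "z\<^sup>2 * (\<rho> z * \<tau> z) = (z * \<rho> z) * (z * \<tau> z)" by (simp add: power2_eq_square)
  then have "z\<^sup>2 * (z * \<sigma> z) \<in> mu4" using r t mu4_mult unfolding e by metis
  moreover have "z\<^sup>2 = z\<^sup>2 * (z * \<sigma> z) * inverse (z * \<sigma> z)"
  proof -
    have "z * \<sigma> z \<noteq> 0" using s by (auto simp: mu4_def)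
    then show ?thesis by (metis mult.assoc mult_1_right right_inverse)
  qed
  ultimately have "z\<^sup>2 \<in> mu4" using s mu4_mult mu4_inverse by metis
  then show ?thesis by (rule mu4_if_square[OF z(1)])
qed

end

section \<open>Units\<close>

lemma norm_one_parity_mod_4_eq_2:
  fixes a b :: int and m :: nat
  assumes "m mod 4 = 2" "a\<^sup>2 - int m * b\<^sup>2 = 1"
  shows "odd a" "even b"
proof -
  obtain j where j: "int m = 4 * j + 2"
    using assms(1) by (metis mult_div_mod_eq of_nat_mult of_nat_add of_nat_numeral)
  have e: "a\<^sup>2 = 1 + 2 * ((2 * j + 1) * b\<^sup>2)" using assms(2) unfolding j by (simp add: algebra_simps)
  have "odd (1 + 2 * ((2 * j + 1) * b\<^sup>2))" by simp
  then have "odd (a\<^sup>2)" unfolding e .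
  then show "odd a" by simp
  then obtain c where c: "a = 2 * c + 1" using oddE by blast
  have "(2 * j + 1) * b\<^sup>2 = 2 * (c\<^sup>2 + c)" using e unfolding c by (simp add: power2_eq_square algebra_simps)
  then have "even ((2 * j + 1) * b\<^sup>2)" by simp
  then show "even b" by simp
qed

text \<open>For odd s the numbers s + 2 and s - 2 are coprime with product p t^2; they are therefore
  e u^2 and (p div e) v^2, and their sum is 2 s.\<close>

lemma norm_four_square_odd:
  fixes s t :: int and p :: nat
  assumes "prime p" "s > 0" "odd s" "s\<^sup>2 - int p * t\<^sup>2 = 4"
  obtains u v :: int and e where "e = 1 \<or> e = int p" "2 * s = e * u\<^sup>2 + (int p div e) * v\<^sup>2" "t = u * v"
proof -
  have p0: "p > 0" using assms(1) prime_gt_0_nat by blast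
  have "s \<noteq> 1" using assms(4) p0 by (auto simp: algebra_simps) (smt (verit) mult_nonneg_nonneg of_nat_0_le_iff zero_le_power2)
  then have s3: "s \<ge> 3" using assms(2,3) by presburger
  define X where "X = nat (s + 2)"
  define Y where "Y = nat (s - 2)"
  have XY: "int X = s + 2" "int Y = s - 2" using s3 by (simp_all add: X_def Y_def)
  have "coprime (s + 2) (s - 2)"
  proof (rule coprimeI)
    fix c assume c: "c dvd s + 2" "c dvd s - 2"
    then have "c dvd (s + 2) - (s - 2)" by (rule dvd_diff)
    then have c4: "c dvd 4" by simp
    have "odd c" using c(1) assms(3) by (metis dvd_trans even_add even_numeral)
    then have "coprime c 2" by simp
    then have "coprime c (2 * 2)" by (simp only: coprime_mult_right_iff)
    then show "is_unit c" using c4 coprime_common_divisor[of c "2 * 2" c] by simp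
  qed
  then have cop: "coprime X Y" using XY by (metis coprime_int_iff)
  have "int (X * Y) = int (p * (nat \<bar>t\<bar>)\<^sup>2)"
    using assms(4) by (simp add: XY algebra_simps power2_eq_square)
  then have eq: "X * Y = p * (nat \<bar>t\<bar>)\<^sup>2" by (simp only: of_nat_eq_iff)
  have "t \<noteq> 0"
  proof
    assume "t = 0"
    then have "s\<^sup>2 = 4" using assms(4) by simp
    then have "even (s\<^sup>2)" by simp
    then show False using assms(3) by simp
  qed
  then have "nat \<bar>t\<bar> > 0" by simp
  then obtain n1 n2 u v where n: "p = n1 * n2" "X = n1 * u\<^sup>2" "Y = n2 * v\<^sup>2" "nat \<bar>t\<bar> = u * v"
    by (rule coprime_mult_eq_times_square[OF cop eq p0])
  have n1: "n1 = 1 \<or> n1 = p" using n(1) assms(1) by (metis mult.right_neutral prime_product)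
  have n2: "int n2 = int p div int n1" using n(1) p0 by auto
  \<comment> \<open>The factorization only sees the absolute value of t; \<open>sgn t\<close>
    restores the sign in t = u v.\<close>
  have "2 * s = int n1 * (int u)\<^sup>2 + int n2 * (sgn t * int v)\<^sup>2"
  proof -
    have "(sgn t)\<^sup>2 = 1" using \<open>t \<noteq> 0\<close> by (simp add: sgn_if)
    then have "int n1 * (int u)\<^sup>2 + int n2 * (sgn t * int v)\<^sup>2 = int X + int Y"
      unfolding n(2,3) by (simp add: power_mult_distrib)
    then show ?thesis by (simp add: XY)
  qed
  moreover have "t = int u * (sgn t * int v)"
  proof -
    have "t = sgn t * int (nat \<bar>t\<bar>)" by (simp add: sgn_mult_abs)
    then show ?thesis by (metis n(4) mult.left_commute of_nat_mult)
  qed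
  ultimately show ?thesis using n1 n2 by (intro that[of "int n1" "int u" "sgn t * int v"]) auto
qed

text \<open>As p is prime, the root u sqrt n1 + v sqrt n2 has {n1, n2} = {1, p} and lies in
  Z[sqrt p]. Hence the norm 1 integer (s + t sqrt p)/2 is a square in Q(sqrt p). For even s the
  factorization is applied to a = s/2 instead.\<close>

lemma norm_four_square:
  fixes s t :: int and p :: nat
  assumes p: "prime p" "p mod 4 = 1" and "s > 0" "s\<^sup>2 - int p * t\<^sup>2 = 4"
  obtains u v :: int where "2 * (of_int s + of_int t * csq p) = (of_int u + of_int v * csq p)\<^sup>2"
proof -
  have p0: "p > 0" using p prime_gt_0_nat by blast
  note thesisI = that
  have *: thesis if e: "e = 1 \<or> e = int p" "2 * s = e * u\<^sup>2 + (int p div e) * v\<^sup>2" "t = u * v" for e u v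
    using e(1)
  proof
    assume 1: "e = 1"
    then have "2 * (of_int s :: complex) = of_int (u\<^sup>2 + int p * v\<^sup>2)"
      using e(2) by (metis div_by_1 mult_1 of_int_mult of_int_numeral)
    then have "2 * (of_int s + of_int t * csq p) = (of_int u + of_int v * csq p)\<^sup>2"
      using csq_mult_self[of p] by (simp add: e(3) distrib_left) (simp add: power2_eq_square algebra_simps)
    then show thesis by (rule thesisI)
  next
    assume 1: "e = int p"
    then have "2 * (of_int s :: complex) = of_int (int p * u\<^sup>2 + v\<^sup>2)"
      using e(2) p0 by (metis div_self mult_1 of_int_mult of_int_numeral of_nat_0_less_iff less_irrefl)
    then have "2 * (of_int s + of_int t * csq p) = (of_int v + of_int u * csq p)\<^sup>2"
      using csq_mult_self[of p] by (simp add: e(3) distrib_left) (simp add: power2_eq_square algebra_simps)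
    then show thesis by (rule thesisI)
  qed
  show thesis
  proof (cases "even s")
    case False
    then show ?thesis using norm_four_square_odd[OF p(1) assms(3) _ assms(4)] * by blast
  next
    case True
    then obtain a where a: "s = 2 * a" by blast
    have "int p * t\<^sup>2 = 2 * (2 * a\<^sup>2 - 2)" using assms(4) unfolding a by (simp add: power2_eq_square)
    then have "even (int p * t\<^sup>2)" by simp
    moreover have "odd p" using p(2) by presburger
    ultimately have "even t" by simp
    then obtain b where b: "t = 2 * b" by blast
    have ab: "a\<^sup>2 - int p * b\<^sup>2 = 1" using assms(4) unfolding a b by (simp add: power2_eq_square)
    have par: "odd a" "even b" using norm_one_parity[OF p(2) ab] by auto
    have a0: "a > 0" using assms(3) a by simp
    show ?thesis
    proof (cases "b = 0")
      case True
      then have "a = 1" using ab a0 by (simp add: power2_eq_1_iff)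
      then show ?thesis using thesisI[of 2 0] a b True by simp
    next
      case False
      have "int ((nat a)\<^sup>2) = int (1 + p * (nat \<bar>b\<bar>)\<^sup>2)" using ab a0 by simp
      then have "(nat a)\<^sup>2 = 1 + p * (nat \<bar>b\<bar>)\<^sup>2" by (simp only: of_nat_eq_iff)
      moreover have "odd (nat a)" "even (nat \<bar>b\<bar>)" using par a0 by (simp_all add: even_nat_iff)
      ultimately obtain n1 n2 u v where n: "p = n1 * n2" "nat a + 1 = 2 * n1 * u\<^sup>2"
        "nat a = 2 * n2 * v\<^sup>2 + 1" "nat \<bar>b\<bar> = 2 * u * v"
        using norm_one_factorization[of "nat a" p "nat \<bar>b\<bar>"] p0 False by (metis zero_less_abs_iff zero_less_nat_eq)
      have n1: "n1 = 1 \<or> n1 = p" using n(1) p(1) by (metis mult.right_neutral prime_product)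
      have n2: "int n2 = int p div int n1" using n(1) p0 by auto
      have "a = int n1 * (int u)\<^sup>2 + int n2 * (int v)\<^sup>2"
      proof -
        have "nat a = n1 * u\<^sup>2 + n2 * v\<^sup>2" using n(2,3) by linarith
        then have "int (nat a) = int (n1 * u\<^sup>2 + n2 * v\<^sup>2)" by simp
        then show ?thesis using a0 by simp
      qed
      moreover have "(sgn b)\<^sup>2 = 1" using False by (simp add: sgn_if)
      ultimately have 1: "2 * s = int n1 * (2 * int u)\<^sup>2 + int n2 * (2 * (sgn b * int v))\<^sup>2"
        by (simp add: a power_mult_distrib)
      have "b = sgn b * int (nat \<bar>b\<bar>)" by (simp add: sgn_mult_abs)
      then have 2: "t = 2 * int u * (2 * (sgn b * int v))" unfolding b n(4) by simp
      show ?thesis using *[OF _ 1[unfolded n2] 2] n1 by auto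
    qed
  qed
qed

section \<open>Units of L and complex conjugation\<close>

context biquad
begin

abbreviation "QP \<equiv> adjoin \<rat> P"
abbreviation "QR \<equiv> adjoin \<rat> R"
abbreviation "QD \<equiv> adjoin \<rat> D"

lemma is_subfield_QPRD: "is_subfield QP" "is_subfield QR" "is_subfield QD"
  unfolding P_def R_def D_def
  by (rule sqrt_adjoin.is_subfield_adjoin[OF sqrt_adjoin_csq[OF is_subfield_Rats]])+

lemma QPRD_subset: "QP \<subseteq> M1" "QR \<subseteq> M2" "QD \<subseteq> k" "QP \<subseteq> L" "QR \<subseteq> L" "QD \<subseteq> L"
proof -
  show 1: "QP \<subseteq> M1" "QR \<subseteq> M2" "QD \<subseteq> k"
    unfolding M1_def M2_def k_def by (rule adjoin_mono[OF gaussian.base_subset])+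
  show "QP \<subseteq> L" "QR \<subseteq> L" "QD \<subseteq> L"
    using 1 Rh.base_subset T.base_subset S.base_subset by blast+
qed

lemma QPRD_real: "z \<in> QP \<Longrightarrow> Im z = 0" "z \<in> QR \<Longrightarrow> Im z = 0" "z \<in> QD \<Longrightarrow> Im z = 0"
  unfolding P_def R_def D_def by (rule adjoin_Rats_csq_real, assumption)+

lemma unit_L_iff: "unit_of L u \<longleftrightarrow> u \<in> L \<and> u \<noteq> 0 \<and> algebraic_int u \<and> algebraic_int (inverse u)"
  by (rule unit_of_iff[OF is_subfield_L])

lemma unit_of_subfield: "unit_of K u \<Longrightarrow> K \<subseteq> L \<Longrightarrow> unit_of L u"
  unfolding unit_L_iff by (auto dest: unit_ofD)

lemma unit_of_subfieldI: "unit_of L u \<Longrightarrow> u \<in> K \<Longrightarrow> is_subfield K \<Longrightarrow> unit_of K u"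
  by (simp add: unit_L_iff unit_of_iff)

lemmas unit_L_mult = unit_of_mult[OF is_subfield_L]
  and unit_L_inverse = unit_of_inverse[OF is_subfield_L]
  and unit_L_power_int = unit_of_power_int[OF is_subfield_L]

lemma unit_L_mu4: "z \<in> mu4 \<Longrightarrow> unit_of L z"
  using gens_in_L L_closed by (auto simp: unit_L_iff mu4_def)

lemma unit_L_conj:
  assumes "unit_of L u"
  shows "unit_of L (\<sigma> u)" "unit_of L (\<rho> u)" "unit_of L (\<tau> u)" "unit_of L (cnj u)"
proof -
  have u: "u \<in> L" "u \<noteq> 0" "algebraic_int u" "algebraic_int (inverse u)" "inverse u \<in> L"
    using assms L_closed(6) by (auto simp: unit_L_iff)
  show "unit_of L (\<sigma> u)" unfolding unit_L_iff
    using u S.cj_in S.cj_eq_0_iff S.cj_algebraic_int S.cj_inverse by metis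
  show "unit_of L (\<rho> u)" unfolding unit_L_iff
    using u Rh.cj_in Rh.cj_eq_0_iff Rh.cj_algebraic_int Rh.cj_inverse by metis
  show "unit_of L (\<tau> u)" unfolding unit_L_iff
    using u T.cj_in T.cj_eq_0_iff T.cj_algebraic_int T.cj_inverse by metis
  have "inverse (cnj u) = cnj (inverse u)" by simp
  then show "unit_of L (cnj u)" unfolding unit_L_iff
    using u cnj_in_L by (auto simp del: complex_cnj_inverse)
qed

lemma \<sigma>_mu4: "\<zeta> \<in> mu4 \<Longrightarrow> \<sigma> \<zeta> = \<zeta>"
  using mu4_in_gaussian kG.base_subset S.cj_base by blast

text \<open>The quotient of v by its complex conjugate is an algebraic integer of absolute value 1,
  so \<open>unit_circle_L\<close> applies.\<close>

lemma unit_L_cnj_quotient: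
  assumes "unit_of L v"
  obtains \<zeta> where "\<zeta> \<in> mu4" "v = \<zeta> * cnj v"
proof -
  have c: "unit_of L (v * inverse (cnj v))" using assms by (intro unit_L_mult unit_L_inverse unit_L_conj)
  have v0: "v \<noteq> 0" "cnj v \<noteq> 0" using assms by (auto simp: unit_L_iff)
  have "v * inverse (cnj v) * cnj (v * inverse (cnj v)) = (v * inverse v) * (cnj v * inverse (cnj v))"
    by simp
  also have "\<dots> = 1" using v0 by (simp only: right_inverse mult_1 not_False_eq_True)
  finally have "v * inverse (cnj v) \<in> mu4"
    using c by (intro unit_circle_L) (simp_all add: unit_L_iff)
  moreover have "v = v * inverse (cnj v) * cnj v" using v0 by simp
  ultimately show ?thesis by (rule that)
qed

text \<open>The root of unity \<zeta> with v = \<zeta> * cnj v is fixed by \<sigma>, so it cancels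
  in the quotient, which thus equals its own complex conjugate.\<close>

lemma unit_L_\<sigma>_quotient_real:
  assumes "unit_of L v"
  shows "Im (\<sigma> v / v) = 0"
proof -
  have v: "v \<in> L" "v \<noteq> 0" using assms by (auto simp: unit_L_iff)
  obtain \<zeta> where z: "\<zeta> \<in> mu4" "v = \<zeta> * cnj v" using assms by (rule unit_L_cnj_quotient)
  have zL: "\<zeta> \<in> L" using z(1) mu4_in_gaussian gaussian_subset_L by blast
  have z0: "\<zeta> \<noteq> 0" using z(1) by (auto simp: mu4_def)
  have "\<sigma> v = \<zeta> * cnj (\<sigma> v)"
    using S.cj_mult[OF zL cnj_in_L[OF v(1)]] z(2) \<sigma>_mu4[OF z(1)] \<sigma>_cnj[OF v(1)] by simp
  then have "\<sigma> v / v = (\<zeta> * cnj (\<sigma> v)) / (\<zeta> * cnj v)" using z(2) by simp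
  also have "\<dots> = cnj (\<sigma> v / v)" using z0 by simp
  finally have "cnj (\<sigma> v / v) = \<sigma> v / v" by simp
  then show ?thesis using complex_cnj_cancel_iff by (metis add.inverse_neutral cnj.simps(2) equal_neg_zero)
qed

lemma csq_2p1_notin_k: "csq (2 * p1) \<notin> k"
proof
  assume "csq (2 * p1) \<in> k"
  then have "csq (2 * p1) \<in> Qi \<or> D * csq (2 * p1) \<in> Qi"
    using kG.square_in_adjoin[of "csq (2 * p1)"] csq_square_in[OF kG.subfield] gaussian_not_mem by blast
  moreover have "D * csq (2 * p1) = of_nat (2 * p1) * csq p2"
    unfolding D_def csq_mult[of "2 * p1" p2] using csq_mult_self[of "2 * p1"] by (simp only: ac_simps)
  then have "csq p2 = D * csq (2 * p1) / of_nat (2 * p1)" using p_ge_5 by simp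
  ultimately show False
    using gaussian_not_mem kG.closed(8)[OF _ kG.closed(9)] by metis
qed

lemma csq_in_subfieldI:
  assumes "is_subfield K" "\<i> \<in> K" "z \<in> K" "z\<^sup>2 = of_nat n \<or> z\<^sup>2 = - of_nat n"
  shows "csq n \<in> K"
proof -
  have "z\<^sup>2 = (csq n)\<^sup>2 \<or> (\<i> * z)\<^sup>2 = (csq n)\<^sup>2" using assms(4) by (auto simp: csq_square power_mult_distrib)
  then have "csq n = z \<or> csq n = - z \<or> csq n = \<i> * z \<or> csq n = - (\<i> * z)"
    by (auto simp: power2_eq_iff)
  then show ?thesis using assms(1-3) is_subfieldD(5,7)[OF assms(1)] by metis
qed

lemma power_int_parity:
  fixes z :: complex
  assumes "z \<noteq> 0"
  obtains m :: int where "z powi n = (z powi m)\<^sup>2" | m :: int where "z powi n = (z powi m)\<^sup>2 * z"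
proof (cases "even n")
  case True
  then obtain m where "n = m + m" by (metis evenE mult_2)
  then have "z powi n = (z powi m)\<^sup>2" using assms by (simp only: power2_eq_square power_int_add simp_thms)
  then show ?thesis by (rule that)
next
  case False
  then obtain m where "n = m + m + 1" using oddE by (metis mult_2)
  then have "z powi n = (z powi m)\<^sup>2 * z"
    using assms by (simp only: power2_eq_square power_int_add simp_thms power_int_1_right)
  then show ?thesis by (rule that(2))
qed

text \<open>If \<open>2\<epsilon>\<^sub>3\<close> is a square in \<open>\<rat>(\<surd>d)\<close>, then \<open>v/\<surd>p\<^sub>1\<close> would be an element of \<open>k\<close> that is real up to one of
  the factors \<open>1, \<i>, 1 + \<i>, 1 - \<i>\<close>, and \<open>\<surd>p\<^sub>1\<close> or \<open>\<surd>(2p\<^sub>1)\<close> would lie in \<open>k\<close>.\<close>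
lemma no_antiinvariant_unit:
  assumes f: "fundamental_unit (2 * p1 * p2) \<epsilon>" and C: "C \<in> QD" "C\<^sup>2 = 2 * \<epsilon>"
    and v: "unit_of L v"
  shows "\<sigma> v \<noteq> - v"
proof
  assume sv: "\<sigma> v = - v"
  define \<beta> where "\<beta> = v / P"
  have vL: "v \<in> L" "v \<noteq> 0" using v by (auto simp: unit_L_iff)
  have bL: "\<beta> \<in> L" unfolding \<beta>_def using vL gens_in_L by (simp add: L_closed)
  have "\<sigma> \<beta> = \<beta>" unfolding \<beta>_def using vL gens_in_L sv by (simp add: S.cj_divide \<sigma>_gens)
  then have bk: "\<beta> \<in> k" using S.cj_fixed_iff[OF bL] by simp
  obtain \<zeta> where z: "\<zeta> \<in> mu4" "v = \<zeta> * cnj v" using v by (rule unit_L_cnj_quotient)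
  have bz: "\<beta> = \<zeta> * cnj \<beta>" unfolding \<beta>_def using z(2) by (simp add: PRD_cnj)
  have ik: "\<i> \<in> k" using gaussian.gen_in kG.base_subset by blast
  note kc = S.closed
  \<comment> \<open>The equation \<beta> = \<zeta> * cnj \<beta> fixes the argument of \<beta> up to
    sign: one of \<beta>, \<i> \<beta>, \<beta>/(1 + \<i>), \<beta>/(1 - \<i>) is real. The value c
    = 2 compensates for the square of 1 + \<i> or 1 - \<i>.\<close>
  have "\<exists>r c. r \<in> k \<and> Im r = 0 \<and> c \<in> {1, 2::nat} \<and> (\<exists>\<xi>\<in>mu4. of_nat c * r\<^sup>2 = \<beta>\<^sup>2 * \<xi>)"
  proof -
    consider "\<zeta> = 1" | "\<zeta> = -1" | "\<zeta> = \<i>" | "\<zeta> = - \<i>" using z(1) by (auto simp: mu4_def)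
    then show ?thesis
    proof cases
      case 1
      then have "Im \<beta> = 0" using bz by (auto simp: complex_eq_iff)
      then show ?thesis using bk by (intro exI[of _ \<beta>] exI[of _ 1]) (auto simp: mu4_def)
    next
      case 2
      then have "Im (\<i> * \<beta>) = 0" using bz by (auto simp: complex_eq_iff)
      moreover have "(\<i> * \<beta>)\<^sup>2 = \<beta>\<^sup>2 * (-1)" by (simp add: power_mult_distrib)
      ultimately show ?thesis using kc(5)[OF ik bk] by (intro exI[of _ "\<i> * \<beta>"] exI[of _ 1]) (auto simp: mu4_def)
    next
      case 3
      define r where "r = \<beta> / (1 + \<i>)"
      have b: "\<beta> = r * (1 + \<i>)" unfolding r_def by (simp add: complex_eq_iff)
      have "r * (1 + \<i>) = cnj r * (1 + \<i>)" using bz unfolding 3 b by (simp add: algebra_simps)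
      then have "Im r = 0" by (auto simp: complex_eq_iff)
      moreover have "of_nat 2 * r\<^sup>2 = \<beta>\<^sup>2 * (- \<i>)" unfolding b by (simp add: power2_eq_square algebra_simps)
      moreover have "r \<in> k" unfolding r_def using bk ik kc(2) by (simp add: kc)
      ultimately show ?thesis by (intro exI[of _ r] exI[of _ 2]) (auto simp: mu4_def)
    next
      case 4
      define r where "r = \<beta> / (1 - \<i>)"
      have b: "\<beta> = r * (1 - \<i>)" unfolding r_def by (simp add: complex_eq_iff)
      have "r * (1 - \<i>) = cnj r * (1 - \<i>)" using bz unfolding 4 b by (simp add: algebra_simps)
      then have "Im r = 0" by (auto simp: complex_eq_iff)
      moreover have "of_nat 2 * r\<^sup>2 = \<beta>\<^sup>2 * \<i>" unfolding b by (simp add: power2_eq_square algebra_simps)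
      moreover have "r \<in> k" unfolding r_def using bk ik kc(2) by (simp add: kc)
      ultimately show ?thesis by (intro exI[of _ r] exI[of _ 2]) (auto simp: mu4_def)
    qed
  qed
  then obtain r c \<xi> where r: "r \<in> k" "Im r = 0" "c \<in> {1, 2::nat}" "\<xi> \<in> mu4" "of_nat c * r\<^sup>2 = \<beta>\<^sup>2 * \<xi>"
    by blast
  have rD: "r \<in> QD" using adjoin_gaussian_real r(1,2) unfolding k_def D_def by blast
  \<comment> \<open>This form places w in the real field Q(sqrt d); the form v^2 \<xi> derived below
    shows that it is a unit. So w is a power of \<epsilon> up to sign, and the parity of the
    exponent decides which root ends up in k.\<close>
  define w where "w = of_nat (c * p1) * r\<^sup>2"
  have "w = of_nat p1 * (of_nat c * r\<^sup>2)" by (simp add: w_def)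
  also have "\<dots> = P * P * (\<beta>\<^sup>2 * \<xi>)" unfolding r(5) PP ..
  also have "\<dots> = v * v * \<xi>" unfolding \<beta>_def using PRD_nonzero by (simp add: power2_eq_square)
  finally have w: "w = v * v * \<xi>" .
  then have wU: "unit_of L w" using v r(4) by (auto intro: unit_L_mult unit_L_mu4)
  have "w \<in> QD" unfolding w_def using rD is_subfieldD(5)[OF is_subfield_QPRD(3)]
      is_subfield_of_nat[OF is_subfield_QPRD(3)] by (simp add: power2_eq_square)
  then have "unit_of QD w" using unit_of_subfieldI[OF wU] is_subfield_QPRD(3) by blast
  then obtain n where n: "w = \<epsilon> powi n \<or> w = - (\<epsilon> powi n)"
    using units_real_quadratic[OF f] unfolding D_def by blast
  have e: "\<epsilon> \<in> k" "\<epsilon> \<noteq> 0" using fundamental_unitD(1)[OF f] unit_ofD(1,3) QPRD_subset(3) unfolding D_def by blast+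
  have ek: "\<epsilon> powi m \<in> k" for m
    using e is_subfield_power[OF is_subfields(1)] kc(6) by (auto simp: power_int_def)
  have e0: "\<epsilon> powi m \<noteq> 0" for m using e by simp
  have Ck: "C \<in> k" using C(1) QPRD_subset(3) by blast
  have c0: "c > 0" using r(3) by auto
  have r0: "r \<noteq> 0" using w vL r(4) by (auto simp: w_def mu4_def)
  have "csq (c * p1) \<in> k \<or> csq (2 * (c * p1)) \<in> k"
    using power_int_parity[OF e(2), of n]
  proof cases
    case (1 m)
    define q where "q = \<epsilon> powi m / r"
    have "q\<^sup>2 = of_nat (c * p1) \<or> q\<^sup>2 = - of_nat (c * p1)"
      using n r0 unfolding 1 w_def q_def by (auto simp: power_divide field_simps)
    moreover have "q \<in> k" unfolding q_def using ek r by (simp add: kc)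
    ultimately show ?thesis using csq_in_subfieldI[OF is_subfields(1) ik] by blast
  next
    case (2 m)
    \<comment> \<open>For an odd exponent, C supplies the missing root of \<epsilon> at the cost of
      a factor 2.\<close>
    define q where "q = \<epsilon> powi m * C / r"
    have "q\<^sup>2 = (\<epsilon> powi m)\<^sup>2 * (2 * \<epsilon>) / r\<^sup>2" by (simp add: q_def power_divide power_mult_distrib C(2))
    then have "q\<^sup>2 * r\<^sup>2 = 2 * \<epsilon> powi n" using r0 unfolding 2 by simp
    moreover have "of_nat (2 * (c * p1)) * r\<^sup>2 = 2 * w" "- of_nat (2 * (c * p1)) * r\<^sup>2 = - (2 * w)"
      by (simp_all add: w_def)
    ultimately have "q\<^sup>2 * r\<^sup>2 = of_nat (2 * (c * p1)) * r\<^sup>2 \<or> q\<^sup>2 * r\<^sup>2 = - of_nat (2 * (c * p1)) * r\<^sup>2"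
      using n by (elim disjE) (simp_all only: minus_minus mult_minus_right simp_thms)
    then have "q\<^sup>2 = of_nat (2 * (c * p1)) \<or> q\<^sup>2 = - of_nat (2 * (c * p1))"
      using r0 by (simp only: mult_right_cancel power_not_zero simp_thms)
    moreover have "q \<in> k" unfolding q_def using ek r Ck by (simp add: kc)
    ultimately show ?thesis using csq_in_subfieldI[OF is_subfields(1) ik] by blast
  qed
  moreover have "csq (2 * (2 * p1)) = 2 * P" unfolding csq_mult P_def using csq_mult_self[of 2] by simp
  ultimately have "P \<in> k \<or> csq (2 * p1) \<in> k \<or> 2 * P \<in> k" using r(3) by (auto simp: P_def simp del: of_nat_mult)
  moreover have "2 * P \<in> k \<Longrightarrow> P \<in> k" using kc(8)[of "2 * P" 2] kc by simp
  ultimately show False using P_notin_k csq_2p1_notin_k by blast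
qed

end

context biquad
begin

lemma \<sigma>_QP: "a \<in> \<rat> \<Longrightarrow> b \<in> \<rat> \<Longrightarrow> \<sigma> (a + b * P) = a - b * P"
  using \<sigma>_crd[of a b 0 0] subsetD[OF gaussian.base_subset] kG.closed(1) by (simp add: crd_def)

lemma \<sigma>_QR: "a \<in> \<rat> \<Longrightarrow> b \<in> \<rat> \<Longrightarrow> \<sigma> (a + b * R) = a - b * R"
  using \<sigma>_crd[of a 0 b 0] subsetD[OF gaussian.base_subset] kG.closed(1) by (simp add: crd_def)

text \<open>Write A = (s + t sqrt p1)/2 with s^2 - p1 t^2 = 4. Then s is nonzero, and
  \<open>norm_four_square\<close> applies to A or to -A according to the sign of s.\<close>

lemma QP_norm_one:
  assumes A: "A \<in> QP" "algebraic_int A" "A * \<sigma> A = 1"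
  obtains A1 where "A1 \<in> QP" "A = A1\<^sup>2 \<or> A = - A1\<^sup>2"
proof -
  obtain a b where ab: "a \<in> \<rat>" "b \<in> \<rat>" "A = a + b * P" using A(1) by (rule adjoinE)
  have sA: "\<sigma> A = a - b * P" unfolding ab(3) using ab(1,2) by (rule \<sigma>_QP)
  have i: "2 * a \<in> \<int>" "2 * b \<in> \<int>"
    using quadratic_integer_coeffs[OF irrationals(1) ab(1,2)] A(2) squarefrees(1) unfolding ab(3) P_def by blast+
  then obtain s t where st: "2 * a = of_int s" "2 * b = of_int t" by (meson Ints_cases)
  have "(2 * a)\<^sup>2 - of_nat p1 * (2 * b)\<^sup>2 = 4 * ((a + b * P) * (a - b * P))"
    unfolding PP[symmetric] by (simp add: power2_eq_square algebra_simps)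
  also have "\<dots> = 4" using A(3) by (simp only: ab(3)[symmetric] sA[symmetric] mult_1_right)
  finally have "(of_int (s\<^sup>2 - int p1 * t\<^sup>2) :: complex) = of_int 4" by (simp add: st)
  then have e: "s\<^sup>2 - int p1 * t\<^sup>2 = 4" by (simp only: of_int_eq_iff)
  note thesisI = that
  have half: "thesis" if h: "2 * (of_int \<alpha> + of_int \<beta> * csq p1) = (of_int u + of_int v * csq p1)\<^sup>2"
      "\<alpha> = s \<and> \<beta> = t \<or> \<alpha> = - s \<and> \<beta> = - t" for \<alpha> \<beta> u v :: int
  proof (rule thesisI)
    let ?A1 = "of_int u / 2 + of_int v / 2 * P"
    show "?A1 \<in> QP" by (rule adjoinI) (auto intro!: Rats_divide)
    have "4 * ?A1\<^sup>2 = (of_int u + of_int v * P)\<^sup>2" by (simp add: power2_eq_square field_simps)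
    also have "\<dots> = 2 * (of_int \<alpha> + of_int \<beta> * P)" using h(1) by (simp add: P_def)
    also have "\<dots> = 4 * A \<or> \<dots> = 4 * (- A)"
      using h(2) st ab(3) by (auto simp: algebra_simps simp flip: st)
    finally show "A = ?A1\<^sup>2 \<or> A = - ?A1\<^sup>2" by auto
  qed
  have "s \<noteq> 0"
  proof
    assume "s = 0"
    moreover have "int p1 * t\<^sup>2 \<ge> 0" by simp
    moreover have "- (int p1 * t\<^sup>2) = 4" using e \<open>s = 0\<close> by simp
    ultimately show False by linarith
  qed
  then consider "s > 0" | "- s > 0" by linarith
  then show thesis
  proof cases
    case 1
    then obtain u v where "2 * (of_int s + of_int t * csq p1) = (of_int u + of_int v * csq p1)\<^sup>2"
      using norm_four_square[OF prime(1) mod4(1) 1 e] by metis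
    then show ?thesis by (rule half) simp
  next
    case 2
    have "(- s)\<^sup>2 - int p1 * (- t)\<^sup>2 = 4" using e by simp
    then obtain u v where "2 * (of_int (- s) + of_int (- t) * csq p1) = (of_int u + of_int v * csq p1)\<^sup>2"
      using norm_four_square[OF prime(1) mod4(1) 2] by metis
    then show ?thesis by (rule half) simp
  qed
qed

text \<open>\<rho> and \<tau> commute with complex conjugation, so the norms to M1 and M2 are real,
  and the real elements of these fields form Q(sqrt p1) and Q(sqrt (2 p2)).\<close>

lemma real_L_norms:
  assumes "w \<in> L" "Im w = 0"
  shows "w * \<rho> w \<in> QP" "w * \<tau> w \<in> QR"
proof -
  have cw: "cnj w = w" using assms(2) by (simp add: complex_eq_iff)
  have "cnj (\<rho> w) = \<rho> w" "cnj (\<tau> w) = \<tau> w" using \<rho>_cnj[OF assms(1)] \<tau>_cnj[OF assms(1)] cw by simp_all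
  then have "Im (\<rho> w) = 0" "Im (\<tau> w) = 0"
    by (metis add.inverse_neutral cnj.simps(2) equal_neg_zero)+
  then have "Im (w * \<rho> w) = 0" "Im (w * \<tau> w) = 0" using assms(2) by simp_all
  moreover have "w * \<rho> w \<in> M1" "w * \<tau> w \<in> M2" using Rh.norm_in_base T.norm_in_base assms(1) by blast+
  ultimately show "w * \<rho> w \<in> QP" "w * \<tau> w \<in> QR"
    unfolding M1_def M2_def P_def R_def by (metis adjoin_gaussian_real)+
qed

lemma \<sigma>_power_int: "z \<in> L \<Longrightarrow> \<sigma> (z powi n) = \<sigma> z powi n"
  using S.cj_power S.cj_inverse is_subfield_power[OF is_subfield_L] by (auto simp: power_int_def power_inverse)

lemma sign_power_int: "s = 1 \<or> s = (-1::complex) \<Longrightarrow> s powi n = 1 \<or> s powi n = -1"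
  by (cases "even n") (auto simp: power_int_minus_left)

end

section \<open>Units of relative norm 1 as quotients of conjugate units\<close>

locale biquad_units = biquad +
  fixes x y :: int and \<epsilon>2 :: complex
  assumes f2: "fundamental_unit (2 * p2) \<epsilon>2"
    and f3: "fundamental_unit (2 * p1 * p2) (of_int x + of_int y * csq (2 * p1 * p2))"
    and norm2: "\<exists>a b :: rat. \<epsilon>2 = of_rat a + of_rat b * csq (2 * p2) \<and> a\<^sup>2 - of_nat (2 * p2) * b\<^sup>2 = 1"
    and norm3: "x\<^sup>2 - int (2 * p1 * p2) * y\<^sup>2 = 1"
begin

abbreviation "\<epsilon>3 \<equiv> of_int x + of_int y * csq (2 * p1 * p2)"

lemma mod4_2: "2 * p2 mod 4 = 2" "2 * p1 * p2 mod 4 = 2"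
proof -
  obtain a b where ab: "p1 = 4 * a + 1" "p2 = 4 * b + 1" using mod4 by (metis mult_div_mod_eq)
  show "2 * p2 mod 4 = 2" using mod4(2) by presburger
  have "2 * p1 * p2 = 4 * (8 * a * b + 2 * a + 2 * b) + 2" unfolding ab by (simp add: algebra_simps)
  then show "2 * p1 * p2 mod 4 = 2" by presburger
qed

lemma \<epsilon>2_coeffs:
  obtains a b :: int where "\<epsilon>2 = of_int a + of_int b * R" "a\<^sup>2 - int (2 * p2) * b\<^sup>2 = 1"
proof -
  obtain a b :: rat where ab: "\<epsilon>2 = of_rat a + of_rat b * csq (2 * p2)" "a\<^sup>2 - of_nat (2 * p2) * b\<^sup>2 = 1"
    using norm2 by blast
  have "algebraic_int \<epsilon>2" using fundamental_unitD(1)[OF f2] unit_ofD(2) by blast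
  then have "of_rat a \<in> (\<int> :: complex set)" "of_rat b \<in> (\<int> :: complex set)"
    using quadratic_integer_mod_4_eq_2[OF squarefrees(5) mod4_2(1), of "of_rat a" "of_rat b"] ab(1) by simp_all
  then obtain a' b' where i: "of_rat a = (of_int a' :: complex)" "of_rat b = (of_int b' :: complex)" by (meson Ints_cases)
  then have r: "a = of_int a'" "b = of_int b'" by (metis of_rat_eq_iff of_rat_of_int_eq)+
  have "(of_int (a'\<^sup>2 - int (2 * p2) * b'\<^sup>2) :: rat) = of_int 1" using ab(2) unfolding r by simp
  then have "a'\<^sup>2 - int (2 * p2) * b'\<^sup>2 = 1" by (simp only: of_int_eq_iff)
  then show ?thesis using that ab(1) i unfolding R_def by metis
qed

lemma \<epsilon>2_unit: "unit_of QR \<epsilon>2" "\<epsilon>2 \<in> L" "\<epsilon>2 \<noteq> 0" "unit_of L \<epsilon>2"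
proof -
  show 1: "unit_of QR \<epsilon>2" using fundamental_unitD(1)[OF f2] unfolding R_def by blast
  then show "unit_of L \<epsilon>2" by (rule unit_of_subfield) (rule QPRD_subset)
  then show "\<epsilon>2 \<in> L" "\<epsilon>2 \<noteq> 0" by (auto simp: unit_L_iff)
qed

lemma \<epsilon>2_norm: "\<epsilon>2 * \<sigma> \<epsilon>2 = 1"
proof -
  obtain a b :: int where ab: "\<epsilon>2 = of_int a + of_int b * R" "a\<^sup>2 - int (2 * p2) * b\<^sup>2 = 1" by (rule \<epsilon>2_coeffs)
  have "\<sigma> \<epsilon>2 = of_int a - of_int b * R" unfolding ab(1) by (rule \<sigma>_QR) auto
  then have "\<epsilon>2 * \<sigma> \<epsilon>2 = (of_int a + of_int b * R) * (of_int a - of_int b * R)" by (simp only: ab(1))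
  also have "\<dots> = of_int a * of_int a - of_int b * of_int b * (R * R)" by (simp add: algebra_simps)
  also have "\<dots> = of_int (a\<^sup>2 - int (2 * p2) * b\<^sup>2)" unfolding RR by (simp add: power2_eq_square)
  finally show ?thesis unfolding ab(2) by simp
qed

text \<open>The only nontrivial splitting of 2 p2 is {2, p2}, so the root of \<epsilon>2 is a
  combination of sqrt 2 and sqrt p2; multiplying it by sqrt 2 moves it into Q(sqrt (2 p2)).\<close>

lemma two_\<epsilon>2_square:
  obtains C where "C \<in> QR" "C\<^sup>2 = 2 * \<epsilon>2"
proof -
  obtain a b :: int where ab: "\<epsilon>2 = of_int a + of_int b * R" "a\<^sup>2 - int (2 * p2) * b\<^sup>2 = 1" by (rule \<epsilon>2_coeffs)
  have par: "odd a" "even b" using norm_one_parity_mod_4_eq_2[OF mod4_2(1) ab(2)] by auto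
  obtain n1 n2 u v :: nat where n: "2 * p2 = n1 * n2" "n1 \<noteq> 1" "n2 \<noteq> 1"
    "of_int a + of_int b * csq (2 * p2) = (of_nat u * csq n1 + of_nat v * csq n2)\<^sup>2"
    using fundamental_unit_factorization[OF f2[unfolded ab(1) R_def] ab(2) par] p_ge_5
    by (metis mult_pos_pos not_gr0 pos2 rel_simps(76) le_zero_eq)
  have "n1 = 2 \<and> n2 = p2 \<or> n1 = p2 \<and> n2 = 2"
    using prime_mult_eq_cases[OF prime(2), of n1 n2 2] n(1-3)
    by (smt (verit) mult.commute mult.right_neutral prime_product two_is_prime_nat)
  then obtain u' v' :: nat where e: "\<epsilon>2 = (of_nat u' * csq 2 + of_nat v' * csq p2)\<^sup>2"
    using n(4) ab(1) unfolding R_def by (metis add.commute)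
  define C where "C = 2 * of_nat u' + of_nat v' * R"
  have "C = csq 2 * (of_nat u' * csq 2 + of_nat v' * csq p2)"
    unfolding C_def R_def csq_mult using csq_mult_self[of 2] by (simp add: algebra_simps)
  then have "C\<^sup>2 = 2 * \<epsilon>2" unfolding e by (simp only: power_mult_distrib csq_square) simp
  moreover have "C \<in> QR" unfolding C_def by (rule adjoinI) auto
  ultimately show ?thesis using that by blast
qed

text \<open>The element \<open>\<eta> = \<surd>(\<i>\<epsilon>\<^sub>2)\<close>; its existence makes \<open>\<epsilon>\<^sub>2\<close> equal to \<open>\<plusminus>\<eta>/\<sigma>(\<eta>)\<close>.\<close>
lemma \<epsilon>2_coboundary:
  obtains \<eta> s where "unit_of L \<eta>" "s = 1 \<or> s = -1" "\<epsilon>2 * \<sigma> \<eta> = s * \<eta>"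
proof -
  obtain C where C: "C \<in> QR" "C\<^sup>2 = 2 * \<epsilon>2" by (rule two_\<epsilon>2_square)
  have CL: "C \<in> L" using C(1) QPRD_subset by blast
  have "(C * \<sigma> C)\<^sup>2 = C\<^sup>2 * \<sigma> (C\<^sup>2)" using CL by (simp add: S.cj_power power_mult_distrib)
  also have "\<dots> = (2 * \<epsilon>2) * (2 * \<sigma> \<epsilon>2)"
    unfolding C(2) using S.cj_mult[OF L_closed(11) \<epsilon>2_unit(2)] S.cj_base[OF S.closed(11)] by simp
  also have "\<dots> = 2\<^sup>2" using \<epsilon>2_norm by (simp add: power2_eq_square)
  finally have "C * \<sigma> C = 2 \<or> C * \<sigma> C = - 2" by (simp only: power2_eq_iff)
  then obtain s where s: "s = 1 \<or> s = (-1::complex)" "C * \<sigma> C = 2 * s" by auto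
  \<comment> \<open>\<open>g\<close> is fixed by \<sigma> and has square \<i>/2, which cancels the 2
    in C^2 = 2 \<epsilon>2 and makes C * g a unit.\<close>
  define g where "g = (1 + \<i>) / 2"
  have gG: "g \<in> Qi"
    unfolding g_def using gaussian.gen_in kG.closed(2) by (simp add: kG.closed)
  then have gL: "g \<in> L" and gs: "\<sigma> g = g" using gaussian_subset_L kG.base_subset S.cj_base by blast+
  define \<eta> where "\<eta> = C * g"
  have e: "\<eta>\<^sup>2 = \<i> * \<epsilon>2" unfolding \<eta>_def power_mult_distrib C(2) g_def by (simp add: power2_eq_square field_simps)
  have eL: "\<eta> \<in> L" unfolding \<eta>_def using CL gL by (simp add: L_closed)
  have "unit_of L (\<eta>\<^sup>2)" unfolding e by (rule unit_L_mult[OF unit_L_mu4 \<epsilon>2_unit(4)]) (simp add: mu4_def)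
  then have u: "unit_of L \<eta>" by (rule unit_of_square_root[OF is_subfield_L eL])
  have "2 * (\<epsilon>2 * \<sigma> C) = C * (C * \<sigma> C)" using C(2) by (simp add: power2_eq_square)
  also have "\<dots> = 2 * (s * C)" using s(2) by simp
  finally have "\<epsilon>2 * \<sigma> C = s * C" by simp
  then have "\<epsilon>2 * \<sigma> \<eta> = s * \<eta>" unfolding \<eta>_def using S.cj_mult[OF CL gL] gs by simp
  then show ?thesis using that u s(1) by blast
qed

text \<open>Hilbert 90 up to sign for real units. The norms of w to Q(sqrt p1) and Q(sqrt (2 p2))
  are a square and a power of \<epsilon>2, up to sign, and their product is w^2 because
  \<open>\<rho> w * \<tau> w\<close> is the \<rho>-conjugate of \<open>w * \<sigma> w\<close>. The
  exponent of \<epsilon>2 must be even, so w itself is a product of factors that are quotients v /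
  \<sigma>(v) up to sign.\<close>

lemma real_norm_one_coboundary:
  assumes w: "unit_of L w" "Im w = 0" "w * \<sigma> w = 1"
  obtains v s where "unit_of L v" "s = 1 \<or> s = -1" "w * \<sigma> v = s * v"
proof -
  have wL: "w \<in> L" "w \<noteq> 0" using w(1) by (auto simp: unit_L_iff)
  have uA: "unit_of L (w * \<rho> w)" "unit_of L (w * \<tau> w)" using w(1) by (auto intro: unit_L_mult unit_L_conj)
  note AB = real_L_norms[OF wL(1) w(2)]
  have mem: "\<sigma> w \<in> L" "\<rho> w \<in> L" using S.cj_in Rh.cj_in wL(1) by blast+
  have rn: "\<rho> w * \<tau> w = 1"
    using Rh.cj_mult[OF wL(1) mem(1)] \<tau>_eq_\<rho>\<sigma>[OF wL(1)] w(3) Rh.cj_base[OF Rh.closed(2)] by simp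
  have "(w * \<rho> w) * \<sigma> (w * \<rho> w) = (w * \<sigma> w) * (\<rho> w * \<tau> w)"
    using S.cj_mult[OF wL(1) mem(2)] \<rho>\<sigma>_commute[OF wL(1)] \<tau>_eq_\<rho>\<sigma>[OF wL(1)] by simp
  then have nA: "(w * \<rho> w) * \<sigma> (w * \<rho> w) = 1" using w(3) rn by simp
  have iA: "algebraic_int (w * \<rho> w)" using uA(1) by (simp add: unit_L_iff)
  obtain A1 where A1: "A1 \<in> QP" "w * \<rho> w = A1\<^sup>2 \<or> w * \<rho> w = - A1\<^sup>2"
    by (rule QP_norm_one[OF AB(1) iA nA])
  have A1L: "A1 \<in> L" using A1(1) QPRD_subset by blast
  have "unit_of QR (w * \<tau> w)" using unit_of_subfieldI[OF uA(2) AB(2)] is_subfield_QPRD(2) by blast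
  then obtain n where n: "w * \<tau> w = \<epsilon>2 powi n \<or> w * \<tau> w = - (\<epsilon>2 powi n)"
    using units_real_quadratic[OF f2] unfolding R_def by blast
  have "(w * \<rho> w) * (w * \<tau> w) = w\<^sup>2 * (\<rho> w * \<tau> w)" by (simp add: power2_eq_square)
  then have w2: "w\<^sup>2 = (w * \<rho> w) * (w * \<tau> w)" using rn by simp
  have w2': "w\<^sup>2 = A1\<^sup>2 * \<epsilon>2 powi n \<or> w\<^sup>2 = - (A1\<^sup>2 * \<epsilon>2 powi n)" unfolding w2 using A1(2) n by auto
  have eL: "\<epsilon>2 powi m \<in> L" "\<epsilon>2 powi m \<noteq> 0" for m
    using unit_L_power_int[OF \<epsilon>2_unit(4)] by (auto simp: unit_L_iff)
  have er: "Im (\<epsilon>2 powi m) = 0" for m using Re_power_int_of_real fundamental_unitD(2)[OF f2] by blast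
  show ?thesis
    using power_int_parity[OF \<epsilon>2_unit(3), of n]
  proof cases
    case (2 m)
    obtain C where C: "C \<in> QR" "C\<^sup>2 = 2 * \<epsilon>2" by (rule two_\<epsilon>2_square)
    have CL: "C \<in> L" using C(1) QPRD_subset by blast
    \<comment> \<open>For an odd exponent the root C of 2 \<epsilon>2 gives q^2 = 2 or q^2 = -2, so
      sqrt 2 would be in L.\<close>
    define q where "q = A1 * \<epsilon>2 powi m * C / w"
    have "q\<^sup>2 * w\<^sup>2 = A1\<^sup>2 * (\<epsilon>2 powi m)\<^sup>2 * C\<^sup>2" unfolding q_def using wL by (simp add: power_divide power_mult_distrib)
    also have "\<dots> = 2 * (A1\<^sup>2 * \<epsilon>2 powi n)" unfolding C(2) 2 by simp
    finally have q1: "q\<^sup>2 * w\<^sup>2 = 2 * (A1\<^sup>2 * \<epsilon>2 powi n)" .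
    have "q\<^sup>2 * w\<^sup>2 = 2 * w\<^sup>2 \<or> q\<^sup>2 * w\<^sup>2 = - 2 * w\<^sup>2"
      unfolding q1 using w2' by (elim disjE) (simp_all only: mult_minus_right mult_minus_left minus_minus simp_thms)
    then have "q\<^sup>2 = 2 \<or> q\<^sup>2 = - 2"
      using wL(2) by (simp only: mult_right_cancel power_not_zero simp_thms)
    then have "q\<^sup>2 = of_nat 2 \<or> q\<^sup>2 = - of_nat 2" by simp
    moreover have "q \<in> L" unfolding q_def using A1L eL CL wL by (simp add: L_closed)
    ultimately have "csq 2 \<in> L" using csq_in_subfieldI[OF is_subfield_L gens_in_L(4)] by blast
    then show ?thesis using sqrt2_notin_L by blast
  next
    case (1 m)
    define B where "B = A1 * \<epsilon>2 powi m"
    have Br: "Im B = 0" unfolding B_def using QPRD_real(1)[OF A1(1)] er by simp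
    have "w\<^sup>2 = B\<^sup>2 \<or> w\<^sup>2 = - B\<^sup>2" using w2' unfolding 1 B_def by (simp add: power_mult_distrib)
    \<comment> \<open>Both w and B are real and w is nonzero.\<close>
    moreover have "w\<^sup>2 \<noteq> - B\<^sup>2"
    proof
      assume "w\<^sup>2 = - B\<^sup>2"
      then have "(Re w)\<^sup>2 = - (Re B)\<^sup>2" using w(2) Br by (simp add: complex_eq_iff power2_eq_square)
      then have "(Re w)\<^sup>2 \<le> 0" by simp
      then have "Re w = 0" by simp
      then show False using wL(2) w(2) by (simp add: complex_eq_iff)
    qed
    ultimately have "w\<^sup>2 = B\<^sup>2" by blast
    then have wB: "w = B \<or> w = - B" by (simp only: power2_eq_iff)
    have em: "\<epsilon>2 powi m * \<sigma> (\<epsilon>2 powi m) = 1"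
      using \<sigma>_power_int[OF \<epsilon>2_unit(2)] \<epsilon>2_norm by (simp flip: power_int_mult_distrib)
    have "w * \<sigma> w = B * \<sigma> B"
      using wB S.cj_minus[of B] A1L eL by (auto simp: B_def L_closed)
    also have "\<dots> = (A1 * \<sigma> A1) * (\<epsilon>2 powi m * \<sigma> (\<epsilon>2 powi m))"
      unfolding B_def using S.cj_mult[OF A1L eL(1)] by simp
    finally have nA1: "A1 * \<sigma> A1 = 1" using em w(3) by simp
    have "unit_of L A1"
    proof (rule unit_of_square_root[OF is_subfield_L A1L])
      have "A1\<^sup>2 = w * \<rho> w \<or> A1\<^sup>2 = - (w * \<rho> w)" using A1(2) by auto
      then show "unit_of L (A1\<^sup>2)" using uA(1) unit_of_minus[OF is_subfield_L uA(1)] by auto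
    qed
    then have "algebraic_int A1" by (simp add: unit_L_iff)
    then obtain A2 where A2: "A2 \<in> QP" "A1 = A2\<^sup>2 \<or> A1 = - A2\<^sup>2"
      using QP_norm_one[OF A1(1) _ nA1] by blast
    have A2L: "A2 \<in> L" using A2(1) QPRD_subset by blast
    have uA2: "unit_of L A2"
    proof (rule unit_of_square_root[OF is_subfield_L A2L])
      have "A2\<^sup>2 = A1 \<or> A2\<^sup>2 = - A1" using A2(2) by auto
      then show "unit_of L (A2\<^sup>2)" using \<open>unit_of L A1\<close> unit_of_minus[OF is_subfield_L] by auto
    qed
    have "(A2 * \<sigma> A2)\<^sup>2 = A2\<^sup>2 * \<sigma> (A2\<^sup>2)" using S.cj_power[OF A2L] by (simp add: power_mult_distrib)
    also have "\<dots> = A1 * \<sigma> A1"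
      using A2(2) S.cj_minus[of "A2\<^sup>2"] is_subfield_power[OF is_subfield_L A2L, of 2] by auto
    finally have "(A2 * \<sigma> A2)\<^sup>2 = 1" using nA1 by simp
    then have A2n: "A2 * \<sigma> A2 = 1 \<or> A2 * \<sigma> A2 = -1" by (simp add: power2_eq_1_iff)
    obtain \<eta> s where eta: "unit_of L \<eta>" "s = 1 \<or> s = (-1::complex)" "\<epsilon>2 * \<sigma> \<eta> = s * \<eta>"
      by (rule \<epsilon>2_coboundary)
    have etaL: "\<eta> \<in> L" "\<eta> powi m \<in> L" using eta(1) unit_L_power_int[OF eta(1)] by (auto simp: unit_L_iff)
    \<comment> \<open>A2 / \<sigma>(A2) is A2^2 and \<eta> / \<sigma>(\<eta>) is \<epsilon>2, each
      up to sign, so v / \<sigma>(v) is w up to sign.\<close>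
    define v where "v = A2 * \<eta> powi m"
    have uv: "unit_of L v" unfolding v_def using uA2 eta(1) by (intro unit_L_mult unit_L_power_int)
    have "\<epsilon>2 powi m * \<sigma> (\<eta> powi m) = (\<epsilon>2 * \<sigma> \<eta>) powi m"
      using \<sigma>_power_int[OF etaL(1)] by (simp add: power_int_mult_distrib)
    then have em2: "\<epsilon>2 powi m * \<sigma> (\<eta> powi m) = s powi m * \<eta> powi m"
      unfolding eta(3) by (simp add: power_int_mult_distrib)
    have "A2\<^sup>2 * \<epsilon>2 powi m * \<sigma> v = A2 * (A2 * \<sigma> A2) * (\<epsilon>2 powi m * \<sigma> (\<eta> powi m))"
      unfolding v_def using S.cj_mult[OF A2L etaL(2)] by (simp add: power2_eq_square)
    also have "\<dots> = (A2 * \<sigma> A2) * s powi m * v" unfolding em2 v_def by simp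
    finally have "A2\<^sup>2 * \<epsilon>2 powi m * \<sigma> v = (A2 * \<sigma> A2) * s powi m * v" .
    moreover have "w = A2\<^sup>2 * \<epsilon>2 powi m \<or> w = - (A2\<^sup>2 * \<epsilon>2 powi m)" using wB A2(2) unfolding B_def by auto
    ultimately have "w * \<sigma> v = v \<or> w * \<sigma> v = - v"
      using A2n sign_power_int[OF eta(2), of m] by auto
    then show ?thesis using that[OF uv, of 1] that[OF uv, of "-1"] by auto
  qed
qed

end

context biquad_units
begin

lemma norm_minus_one_unit:
  assumes "a\<^sup>2 - int p1 * b\<^sup>2 = -1"
  defines "e1 \<equiv> of_int a + of_int b * P"
  shows "unit_of L e1" "e1 * \<sigma> e1 = -1" "Im e1 = 0" "\<sigma> e1 = of_int a - of_int b * P"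
proof -
  show s: "\<sigma> e1 = of_int a - of_int b * P" unfolding e1_def by (rule \<sigma>_QP) auto
  have "e1 * \<sigma> e1 = of_int a * of_int a - of_int b * of_int b * (P * P)"
    unfolding s by (simp add: e1_def algebra_simps)
  also have "\<dots> = of_int (a\<^sup>2 - int p1 * b\<^sup>2)" unfolding PP by (simp add: power2_eq_square)
  finally show n: "e1 * \<sigma> e1 = -1" unfolding assms(1) by simp
  then have "inverse e1 = - \<sigma> e1"
    by (metis inverse_unique minus_minus mult_minus_right)
  then have "inverse e1 = of_int (- a) + of_int b * P" unfolding s by simp
  moreover have "algebraic_int (of_int c + of_int d * P)" for c d
    using PRD_algebraic_int(1) int_imp_algebraic_int by (metis Ints_of_int algebraic_int_plus algebraic_int_times)
  moreover have "e1 \<noteq> 0" using n by auto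
  moreover have "e1 \<in> L" unfolding e1_def using gens_in_L by (simp add: L_closed)
  ultimately show "unit_of L e1" unfolding unit_L_iff e1_def by metis
  show "Im e1 = 0" by (simp add: e1_def P_def)
qed

text \<open>Comparing \<open>u * \<sigma> u\<close> with its complex conjugate gives \<zeta>^2 = 1
  for the root of unity in u = \<zeta> * cnj u. Thus u is real or purely imaginary, and the second
  case is reduced to the first.\<close>

lemma norm_one_coboundary:
  assumes ab: "a\<^sup>2 - int p1 * b\<^sup>2 = -1" and u: "unit_of L u" "u * \<sigma> u = 1"
  obtains v s where "unit_of L v" "s = 1 \<or> s = -1"
    "u * \<sigma> v = s * v \<or> u * \<sigma> v = s * (- \<i> / (of_int a + of_int b * P)) * v"
proof -
  define e1 where "e1 = of_int a + of_int b * P"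
  note e1 = norm_minus_one_unit[OF ab, folded e1_def]
  have uL: "u \<in> L" "u \<noteq> 0" and eL: "e1 \<in> L" "e1 \<noteq> 0" using u(1) e1(1) by (auto simp: unit_L_iff)
  obtain \<zeta> where z: "\<zeta> \<in> mu4" "u = \<zeta> * cnj u" using u(1) by (rule unit_L_cnj_quotient)
  have zL: "\<zeta> \<in> L" using z(1) mu4_in_gaussian gaussian_subset_L by blast
  have su: "\<sigma> u = \<zeta> * cnj (\<sigma> u)"
    using S.cj_mult[OF zL cnj_in_L[OF uL(1)]] z(2) \<sigma>_mu4[OF z(1)] \<sigma>_cnj[OF uL(1)] by simp
  have "u * \<sigma> u = (\<zeta> * cnj u) * (\<zeta> * cnj (\<sigma> u))" by (simp only: z(2)[symmetric] su[symmetric])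
  also have "\<dots> = \<zeta>\<^sup>2 * cnj (u * \<sigma> u)" by (simp add: power2_eq_square)
  finally have "\<zeta>\<^sup>2 = 1" using u(2) by simp
  then have "\<zeta> = 1 \<or> \<zeta> = -1" by (simp add: power2_eq_1_iff)
  then show ?thesis
  proof
    assume "\<zeta> = 1"
    then have "Im u = 0" using z(2) by (auto simp: complex_eq_iff)
    then show ?thesis using real_norm_one_coboundary[OF u(1) _ u(2)] that by metis
  next
    assume "\<zeta> = -1"
    then have Re: "Re u = 0" using z(2) by (auto simp: complex_eq_iff)
    \<comment> \<open>\<i> * e1 has relative norm (\<i> * \<i>) * (-1) = 1, so w is a real unit that
      still has relative norm 1.\<close>
    define w where "w = \<i> * e1 * u"
    have ue: "unit_of L (\<i> * e1)" using unit_L_mult[OF unit_L_mu4 e1(1)] by (simp add: mu4_def)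
    have uw: "unit_of L w" unfolding w_def by (rule unit_L_mult[OF ue u(1)])
    have "Im w = 0" unfolding w_def using Re e1(3) by simp
    moreover have "\<sigma> w = \<i> * \<sigma> e1 * \<sigma> u"
      unfolding w_def using S.cj_mult gens_in_L(4) eL uL \<sigma>_gens(4) by (simp add: L_closed)
    then have "w * \<sigma> w = (\<i> * \<i>) * ((e1 * \<sigma> e1) * (u * \<sigma> u))"
      unfolding w_def by (simp only: ac_simps)
    then have "w * \<sigma> w = 1" unfolding e1(2) u(2) by simp
    ultimately obtain v s where v: "unit_of L v" "s = 1 \<or> s = -1" "w * \<sigma> v = s * v"
      using real_norm_one_coboundary[OF uw] by metis
    have "u * \<sigma> v = (- \<i> / e1) * (w * \<sigma> v)" unfolding w_def using eL by simp
    then have "u * \<sigma> v = s * (- \<i> / e1) * v" unfolding v(3) by simp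
    then show ?thesis using that v unfolding e1_def by metis
  qed
qed

section \<open>The square root of \<epsilon>3 and units negated by \<sigma>\<close>

lemma \<epsilon>3_unit: "unit_of QD \<epsilon>3" "unit_of L \<epsilon>3"
proof -
  show 1: "unit_of QD \<epsilon>3" using fundamental_unitD(1)[OF f3] unfolding D_def by blast
  then show "unit_of L \<epsilon>3" by (rule unit_of_subfield) (rule QPRD_subset)
qed

text \<open>\<sigma> negates P and R, hence q. If q^2 = 2 \<epsilon>3, the factor (1 - \<i>)/2,
  which is fixed by \<sigma> and has square -\<i>/2, turns q into a root of the unit -\<i>
  \<epsilon>3.\<close>

lemma antiinvariant_unitI:
  assumes q: "q = of_nat r * P + of_nat s * R" "q\<^sup>2 = \<epsilon>3 \<or> q\<^sup>2 = 2 * \<epsilon>3"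
  obtains v where "unit_of L v" "\<sigma> v = - v"
proof -
  have qL: "q \<in> L" unfolding q(1) using gens_in_L by (simp add: L_closed)
  have "\<sigma> q = \<sigma> (of_nat r * P) + \<sigma> (of_nat s * R)"
    unfolding q(1) using gens_in_L by (intro S.cj_add) (simp_all add: L_closed)
  also have "\<dots> = - q" unfolding q(1)
    using S.cj_mult[OF L_closed(9) gens_in_L(1)] S.cj_mult[OF L_closed(9) gens_in_L(2)]
      S.cj_base[OF S.closed(9)] \<sigma>_gens by simp
  finally have sq: "\<sigma> q = - q" .
  from q(2) show ?thesis
  proof
    assume "q\<^sup>2 = \<epsilon>3"
    then have "unit_of L q" using unit_of_square_root[OF is_subfield_L qL] \<epsilon>3_unit by simp
    then show ?thesis using that sq by blast
  next
    assume e: "q\<^sup>2 = 2 * \<epsilon>3"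
    define g where "g = (1 - \<i>) / 2"
    have gG: "g \<in> Qi"
      unfolding g_def using gaussian.gen_in kG.closed(2) by (simp add: kG.closed)
    then have gL: "g \<in> L" and gs: "\<sigma> g = g" using gaussian_subset_L kG.base_subset S.cj_base by blast+
    have gqL: "g * q \<in> L" using gL qL by (simp add: L_closed)
    have g2: "g\<^sup>2 * 2 = - \<i>" by (simp add: g_def power2_eq_square field_simps)
    have "(g * q)\<^sup>2 = (g\<^sup>2 * 2) * \<epsilon>3" unfolding power_mult_distrib e by simp
    then have "(g * q)\<^sup>2 = - \<i> * \<epsilon>3" unfolding g2 .
    moreover have "unit_of L (- \<i> * \<epsilon>3)"
      by (rule unit_L_mult[OF unit_L_mu4 \<epsilon>3_unit(2)]) (simp add: mu4_def)
    ultimately have "unit_of L (g * q)" using unit_of_square_root[OF is_subfield_L gqL] by simp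
    moreover have "\<sigma> (g * q) = - (g * q)" using S.cj_mult[OF gL qL] gs sq by simp
    ultimately show ?thesis by (rule that)
  qed
qed

lemma two_p2_factors:
  fixes m n :: nat
  assumes "m * n = 2 * p2"
  shows "m = 1 \<and> n = 2 * p2 \<or> m = 2 \<and> n = p2 \<or> m = p2 \<and> n = 2 \<or> m = 2 * p2 \<and> n = 1"
proof -
  have two: "a = 1 \<and> b = 2 \<or> a = 2 \<and> b = 1" if "a * b = 2" for a b :: nat
    using that prime_product[of a b] two_is_prime_nat by auto
  have "m * n = p2 * 2" using assms by simp
  then consider (1) a where "m = p2 * a" "a * n = 2" | (2) b where "n = p2 * b" "m * b = 2"
    by (rule prime_mult_eq_cases[OF prime(2)])
  then show ?thesis
  proof cases
    case (1 a) then show ?thesis using two[of a n] by auto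
  next
    case (2 b) then show ?thesis using two[of m b] by auto
  qed
qed

lemma two_p1_p2_factors:
  fixes m n :: nat
  assumes "m * n = 2 * p1 * p2" "m \<noteq> 1" "n \<noteq> 1"
  shows "m = 2 \<and> n = p1 * p2 \<or> m = p1 * p2 \<and> n = 2 \<or> m = p1 \<and> n = 2 * p2 \<or> m = 2 * p2 \<and> n = p1
    \<or> m = p2 \<and> n = 2 * p1 \<or> m = 2 * p1 \<and> n = p2"
proof -
  have "m * n = p1 * (2 * p2)" using assms(1) by simp
  then consider (1) a where "m = p1 * a" "a * n = 2 * p2" | (2) b where "n = p1 * b" "m * b = 2 * p2"
    by (rule prime_mult_eq_cases[OF prime(1)])
  then show ?thesis
  proof cases
    case (1 a) then show ?thesis using two_p2_factors[of a n] assms(2,3) by auto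
  next
    case (2 b) then show ?thesis using two_p2_factors[of m b] assms(2,3) by auto
  qed
qed

text \<open>The root of \<epsilon>3 is u sqrt n1 + v sqrt n2 with x + 1 = 2 n1 u^2 and x - 1 = 2 n2
  v^2. The splitting {2, p1 p2} makes x + 1 or x - 1 a square, and sqrt 2 times the root lies in
  Q(sqrt d). For {p1, 2 p2} the root itself, and for {p2, 2 p1} its product with sqrt 2, is a
  combination of P and R; there x + 1 and x - 1 are squares times squarefree numbers other than
  1.\<close>

lemma \<epsilon>3_dichotomy:
  "(\<exists>n::nat. x + 1 = int n ^ 2 \<or> x - 1 = int n ^ 2) \<and> (\<exists>C\<in>QD. C\<^sup>2 = 2 * \<epsilon>3)
   \<or> \<not> (\<exists>n::nat. x + 1 = int n ^ 2 \<or> x - 1 = int n ^ 2) \<and> (\<exists>v. unit_of L v \<and> \<sigma> v = - v)"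
proof -
  have par: "odd x" "even y" using norm_one_parity_mod_4_eq_2[OF mod4_2(2) norm3] by auto
  have d0: "2 * p1 * p2 > 0" using p_ge_5 by simp
  obtain n1 n2 u v :: nat where n: "2 * p1 * p2 = n1 * n2" "n1 \<noteq> 1" "n2 \<noteq> 1" "u > 0" "v > 0"
    "x + 1 = int (2 * n1 * u\<^sup>2)" "x - 1 = int (2 * n2 * v\<^sup>2)"
    "\<epsilon>3 = (of_nat u * csq n1 + of_nat v * csq n2)\<^sup>2"
    by (rule fundamental_unit_factorization[OF f3 norm3 par d0])
  have D2: "csq 2 * csq (p1 * p2) = D" unfolding D_def csq_mult[symmetric] by (simp add: ac_simps)
  have s2: "csq 2 * csq 2 = 2" using csq_mult_self[of 2] by simp
  have P2: "csq 2 * csq (2 * p1) = 2 * P" unfolding P_def csq_mult using s2 by (simp flip: mult.assoc)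
  have R2: "csq 2 * csq p2 = R" unfolding R_def csq_mult ..
  have CD: "\<exists>C\<in>QD. C\<^sup>2 = 2 * \<epsilon>3" if "\<epsilon>3 = (of_nat r * csq 2 + of_nat s * csq (p1 * p2))\<^sup>2" for r s :: nat
  proof
    let ?C = "of_nat (2 * r) + of_nat s * D"
    show "?C \<in> QD" by (rule adjoinI) auto
    have "?C = csq 2 * (of_nat r * csq 2 + of_nat s * csq (p1 * p2))"
      unfolding D2[symmetric] using s2 by (simp add: algebra_simps)
    then have "?C\<^sup>2 = (csq 2)\<^sup>2 * \<epsilon>3" unfolding that by (simp only: power_mult_distrib)
    then show "?C\<^sup>2 = 2 * \<epsilon>3" unfolding csq_square by simp
  qed
  have av2: "\<exists>v. unit_of L v \<and> \<sigma> v = - v" if "\<epsilon>3 = (of_nat r * csq p2 + of_nat s * csq (2 * p1))\<^sup>2" for r s :: nat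
  proof -
    let ?q = "of_nat (2 * s) * P + of_nat r * R"
    have "?q = csq 2 * (of_nat r * csq p2 + of_nat s * csq (2 * p1))"
      unfolding distrib_left mult.left_commute[of "csq 2"] P2 R2 by simp
    then have "?q\<^sup>2 = (csq 2)\<^sup>2 * \<epsilon>3" unfolding that by (simp only: power_mult_distrib)
    then have "?q\<^sup>2 = 2 * \<epsilon>3" unfolding csq_square by simp
    then show ?thesis using antiinvariant_unitI[OF refl] by metis
  qed
  have av1: "\<exists>v. unit_of L v \<and> \<sigma> v = - v" if "\<epsilon>3 = (of_nat r * P + of_nat s * R)\<^sup>2" for r s :: nat
    using antiinvariant_unitI[OF refl] that by metis
  have nsq: "\<not> (\<exists>n::nat. x + 1 = int n ^ 2 \<or> x - 1 = int n ^ 2)"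
    if "x + 1 = int (m1 * r\<^sup>2)" "x - 1 = int (m2 * s\<^sup>2)" "squarefree m1" "squarefree m2" "m1 \<noteq> 1" "m2 \<noteq> 1"
      "r > 0" "s > 0" for m1 m2 r s :: nat
  proof
    assume "\<exists>n::nat. x + 1 = int n ^ 2 \<or> x - 1 = int n ^ 2"
    then obtain n where "x + 1 = int (n\<^sup>2) \<or> x - 1 = int (n\<^sup>2)" by auto
    then have "m1 * r\<^sup>2 = n\<^sup>2 \<or> m2 * s\<^sup>2 = n\<^sup>2" unfolding that(1,2) by (simp only: of_nat_eq_iff)
    then show False using squarefree_times_square that by blast
  qed
  \<comment> \<open>When n1 or n2 is even, its factor 2 joins the leading 2 to form a square, so
    that the remaining coefficient is squarefree.\<close>
  have four: "2 * (2 * c) * w\<^sup>2 = c * (2 * w)\<^sup>2" for c w :: nat by (simp add: power2_eq_square)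
  note sf = squarefrees
  have ne: "p1 \<noteq> 1" "p2 \<noteq> 1" "2 * p1 \<noteq> 1" "2 * p2 \<noteq> 1" "2 * u > 0" "2 * v > 0" using p_ge_5 n(4,5) by auto
  consider "n1 = 2" "n2 = p1 * p2" | "n1 = p1 * p2" "n2 = 2" | "n1 = p1" "n2 = 2 * p2" | "n1 = 2 * p2" "n2 = p1"
    | "n1 = p2" "n2 = 2 * p1" | "n1 = 2 * p1" "n2 = p2"
    using two_p1_p2_factors[OF n(1)[symmetric] n(2,3)] by blast
  then show ?thesis
  proof cases
    case 1
    then have "x + 1 = int (2 * u) ^ 2" using n(6) by (simp add: power2_eq_square)
    then show ?thesis using CD n(8) 1 by blast
  next
    case 2
    then have "x - 1 = int (2 * v) ^ 2" using n(7) by (simp add: power2_eq_square)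
    then show ?thesis using CD[of v u] n(8) 2 by (metis add.commute)
  next
    case 3
    then show ?thesis
      using nsq[of "2 * p1" u p2 "2 * v", OF n(6)[unfolded 3] n(7)[unfolded 3 four] sf(4) sf(2) ne(3) ne(2) n(4) ne(6)]
        av1[of u v] n(8) unfolding P_def R_def by blast
  next
    case 4
    then show ?thesis
      using nsq[of p2 "2 * u" "2 * p1" v, OF n(6)[unfolded 4 four] n(7)[unfolded 4] sf(2) sf(4) ne(2) ne(3) ne(5) n(5)]
        av1[of v u] n(8) unfolding P_def R_def by (metis add.commute)
  next
    case 5
    then show ?thesis
      using nsq[of "2 * p2" u p1 "2 * v", OF n(6)[unfolded 5] n(7)[unfolded 5 four] sf(5) sf(1) ne(4) ne(1) n(4) ne(6)]
        av2[of u v] n(8) by blast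
  next
    case 6
    then show ?thesis
      using nsq[of p1 "2 * u" "2 * p2" v, OF n(6)[unfolded 6 four] n(7)[unfolded 6] sf(1) sf(5) ne(1) ne(4) ne(5) n(5)]
        av2[of v u] n(8) by (metis add.commute)
  qed
qed

end

section \<open>Ideals and capitulation\<close>

lemma same_ideal_classI:
  "nonzero_ideal_of R I \<Longrightarrow> nonzero_ideal_of R J \<Longrightarrow> a \<in> R \<Longrightarrow> b \<in> R \<Longrightarrow> a \<noteq> 0 \<Longrightarrow> b \<noteq> 0 \<Longrightarrow>
    (\<lambda>z. a * z) ` I = (\<lambda>z. b * z) ` J \<Longrightarrow> (I, J) \<in> same_ideal_class R"
  unfolding same_ideal_class_def by blast

lemma same_ideal_classE:
  assumes "(I, J) \<in> same_ideal_class R"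
  obtains a b where "nonzero_ideal_of R I" "nonzero_ideal_of R J" "a \<in> R" "b \<in> R" "a \<noteq> 0" "b \<noteq> 0"
    "(\<lambda>z. a * z) ` I = (\<lambda>z. b * z) ` J"
  using assms unfolding same_ideal_class_def by blast

lemma same_ideal_class_sym: "(I, J) \<in> same_ideal_class R \<Longrightarrow> (J, I) \<in> same_ideal_class R"
  by (elim same_ideal_classE) (rule same_ideal_classI[OF _ _ _ _ _ _ sym])

lemma same_ideal_class_refl: "1 \<in> R \<Longrightarrow> nonzero_ideal_of R I \<Longrightarrow> (I, I) \<in> same_ideal_class R"
  using same_ideal_classI[of R I I 1 1] by simp

lemma same_ideal_class_trans:
  assumes R: "\<And>a b. a \<in> R \<Longrightarrow> b \<in> R \<Longrightarrow> a * b \<in> R"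
    and IJ: "(I, J) \<in> same_ideal_class R" and JK: "(J, K) \<in> same_ideal_class R"
  shows "(I, K) \<in> same_ideal_class R"
proof -
  obtain a b where ab: "nonzero_ideal_of R I" "a \<in> R" "b \<in> R" "a \<noteq> 0" "b \<noteq> 0"
    "(\<lambda>z. a * z) ` I = (\<lambda>z. b * z) ` J" using IJ by (rule same_ideal_classE)
  obtain c d where cd: "nonzero_ideal_of R K" "c \<in> R" "d \<in> R" "c \<noteq> 0" "d \<noteq> 0"
    "(\<lambda>z. c * z) ` J = (\<lambda>z. d * z) ` K" using JK by (rule same_ideal_classE)
  have "(\<lambda>z. (a * c) * z) ` I = (\<lambda>z. c * z) ` ((\<lambda>z. a * z) ` I)" by (simp add: image_image ac_simps)
  also have "\<dots> = (\<lambda>z. b * z) ` ((\<lambda>z. c * z) ` J)" unfolding ab(6) by (simp add: image_image ac_simps)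
  also have "\<dots> = (\<lambda>z. (b * d) * z) ` K" unfolding cd(6) by (simp add: image_image ac_simps)
  finally show ?thesis using ab cd R by (intro same_ideal_classI[of R I K "a * c" "b * d"]) auto
qed

locale integer_ring =
  fixes K :: "complex set"
  assumes K: "is_subfield K"
begin

abbreviation "OK \<equiv> ring_of_integers K"

lemma OK_closed: "0 \<in> OK" "1 \<in> OK" "u \<in> OK \<Longrightarrow> v \<in> OK \<Longrightarrow> u + v \<in> OK" "u \<in> OK \<Longrightarrow> v \<in> OK \<Longrightarrow> u - v \<in> OK"
  "u \<in> OK \<Longrightarrow> v \<in> OK \<Longrightarrow> u * v \<in> OK" "u \<in> OK \<Longrightarrow> - u \<in> OK" "of_int n \<in> OK" "of_nat m \<in> OK"
  using ring_of_integers_closed[OF K] is_subfieldD(1,2)[OF K] is_subfield_of_int[OF K] is_subfield_of_nat[OF K]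
  by (auto simp: ring_of_integers_def intro: int_imp_algebraic_int)

definition pr where "pr g = (\<lambda>r. g * r) ` OK"

lemma pr_ideal: "g \<in> OK \<Longrightarrow> is_ideal_of OK (pr g)"
  unfolding is_ideal_of_def pr_def
proof (intro conjI ballI)
  assume g: "g \<in> OK"
  show "(\<lambda>r. g * r) ` OK \<subseteq> OK" using g OK_closed(5) by blast
  show "0 \<in> (\<lambda>r. g * r) ` OK" using OK_closed(1) by force
  fix a assume a: "a \<in> (\<lambda>r. g * r) ` OK"
  then obtain s where s: "s \<in> OK" "a = g * s" by blast
  { fix b assume "b \<in> (\<lambda>r. g * r) ` OK"
    then obtain t where t: "t \<in> OK" "b = g * t" by blast
    have "a + b = g * (s + t)" unfolding s t by (simp add: distrib_left)
    then show "a + b \<in> (\<lambda>r. g * r) ` OK" using OK_closed(3)[OF s(1) t(1)] by blast }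
  { fix r assume r: "r \<in> OK"
    have "r * a = g * (r * s)" unfolding s by simp
    then show "r * a \<in> (\<lambda>r. g * r) ` OK" using OK_closed(5)[OF r s(1)] by blast }
qed

lemma prI: "z = g * r \<Longrightarrow> r \<in> OK \<Longrightarrow> z \<in> pr g"
  unfolding pr_def by blast

lemma prE:
  assumes "z \<in> pr g"
  obtains r where "r \<in> OK" "z = g * r"
  using assms unfolding pr_def by blast

lemma ideal_closed:
  assumes "is_ideal_of OK J"
  shows "a \<in> J \<Longrightarrow> b \<in> J \<Longrightarrow> a + b \<in> J" "a \<in> J \<Longrightarrow> r \<in> OK \<Longrightarrow> r * a \<in> J" "0 \<in> J" "a \<in> J \<Longrightarrow> a \<in> OK"
    "a \<in> J \<Longrightarrow> b \<in> J \<Longrightarrow> a - b \<in> J"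
proof -
  show *: "a \<in> J \<Longrightarrow> b \<in> J \<Longrightarrow> a + b \<in> J" "\<And>a r. a \<in> J \<Longrightarrow> r \<in> OK \<Longrightarrow> r * a \<in> J" "0 \<in> J" "a \<in> J \<Longrightarrow> a \<in> OK" for b
    using assms unfolding is_ideal_of_def by auto
  have "-1 \<in> OK" using OK_closed(6)[OF OK_closed(2)] .
  then show "a \<in> J \<Longrightarrow> b \<in> J \<Longrightarrow> a - b \<in> J" using *(1)[of "(-1) * b"] *(2)[of b "-1"] by simp
qed

abbreviation "ext \<equiv> ideal_extension OK"

lemma ext_ideal: "I \<subseteq> OK \<Longrightarrow> is_ideal_of OK (ext I)"
proof -
  assume I: "I \<subseteq> OK"
  have OK: "is_ideal_of OK OK" unfolding is_ideal_of_def using OK_closed(1,3,5) by simp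
  have iff: "z \<in> ext I \<longleftrightarrow> (\<forall>J. is_ideal_of OK J \<longrightarrow> I \<subseteq> J \<longrightarrow> z \<in> J)" for z
    unfolding ideal_extension_def by blast
  show ?thesis unfolding is_ideal_of_def
  proof (intro conjI ballI)
    show "ext I \<subseteq> OK" using OK I iff by blast
    show "0 \<in> ext I" unfolding iff using ideal_closed(3) by blast
    fix a assume a: "a \<in> ext I"
    show "a + b \<in> ext I" if "b \<in> ext I" for b
      using a that unfolding iff using ideal_closed(1) by blast
    show "r * a \<in> ext I" if "r \<in> OK" for r
      using a that unfolding iff using ideal_closed(2) by blast
  qed
qed

lemma ext_superset: "I \<subseteq> ext I"
  unfolding ideal_extension_def by blast

lemma ext_least: "is_ideal_of OK J \<Longrightarrow> I \<subseteq> J \<Longrightarrow> ext I \<subseteq> J"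
  unfolding ideal_extension_def by blast

text \<open>Extension is an intersection of ideals, so its elements have no explicit form. To show
  that all z in \<open>ext I\<close> satisfy \<open>z * c \<in> J\<close> it suffices, by minimality
  against this ideal, to check z in I.\<close>

lemma colon_ideal:
  assumes "is_ideal_of OK J"
  shows "is_ideal_of OK {z \<in> OK. z * c \<in> J}"
  unfolding is_ideal_of_def
proof (intro conjI ballI)
  show "0 \<in> {z \<in> OK. z * c \<in> J}" using ideal_closed(3)[OF assms] OK_closed(1) by simp
  fix a assume a: "a \<in> {z \<in> OK. z * c \<in> J}"
  { fix b assume b: "b \<in> {z \<in> OK. z * c \<in> J}"
    show "a + b \<in> {z \<in> OK. z * c \<in> J}"
      using a b ideal_closed(1)[OF assms, of "a * c" "b * c"] OK_closed(3) by (simp add: distrib_right) }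
  { fix r assume r: "r \<in> OK"
    show "r * a \<in> {z \<in> OK. z * c \<in> J}"
      using a r ideal_closed(2)[OF assms, of "a * c" r] OK_closed(5) by (simp add: mult.assoc) }
qed auto

end

section \<open>Extension and contraction of ideals between k and L\<close>

context biquad
begin

sublocale OL: integer_ring L by unfold_locales (rule is_subfield_L)
sublocale Ok: integer_ring k by unfold_locales (rule is_subfields(1))

abbreviation "\<O>L \<equiv> ring_of_integers L"
abbreviation "\<O>k \<equiv> ring_of_integers k"

lemma Ok_subset_OL: "\<O>k \<subseteq> \<O>L"
  using S.base_subset by (auto simp: ring_of_integers_def)

lemma Ok_iff: "z \<in> \<O>k \<longleftrightarrow> z \<in> \<O>L \<and> z \<in> k"
  using S.base_subset by (auto simp: ring_of_integers_def)

lemma k_iff: "z \<in> L \<Longrightarrow> z \<in> k \<longleftrightarrow> \<sigma> z = z"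
  using S.cj_fixed_iff by blast

lemma OL_L: "z \<in> \<O>L \<Longrightarrow> z \<in> L"
  by (simp add: ring_of_integers_def)

lemma \<sigma>_OL: "z \<in> \<O>L \<Longrightarrow> \<sigma> z \<in> \<O>L"
  using S.cj_in S.cj_algebraic_int by (auto simp: ring_of_integers_def)

lemma norm_OL: "z \<in> \<O>L \<Longrightarrow> z * \<sigma> z \<in> \<O>k"
  using OL.OK_closed(5) \<sigma>_OL S.norm_in_base OL_L by (auto simp: Ok_iff)

text \<open>Integrality uses p1 = 4 m + 1: the element is a root of X^2 - X - m.\<close>

lemma half_one_plus_P:
  "(1 + P) / 2 \<in> \<O>L" "(1 + P) / 2 + \<sigma> ((1 + P) / 2) = 1"
proof -
  define \<theta> where "\<theta> = (1 + P) / 2"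
  obtain m where m: "p1 = 4 * m + 1" using mod4(1) by (metis mult_div_mod_eq)
  have t: "\<theta> = 1 / 2 + 1 / 2 * P" by (simp add: \<theta>_def field_simps)
  have "\<sigma> \<theta> = 1 / 2 - 1 / 2 * P" unfolding t by (rule \<sigma>_QP) auto
  then show "(1 + P) / 2 + \<sigma> ((1 + P) / 2) = 1" unfolding \<theta>_def[symmetric] by (simp add: t)
  have "\<theta> * \<theta> - \<theta> = (P * P - 1) / 4" unfolding \<theta>_def by (simp add: field_simps)
  also have "\<dots> = (of_nat p1 - 1) / 4" by (simp only: PP)
  also have "\<dots> = of_nat m" using arg_cong[OF m, of "of_nat :: nat \<Rightarrow> complex"] by simp
  finally have "\<theta> * \<theta> - \<theta> - of_nat m = 0" by simp
  then have "poly (map_poly of_int [:- int m, -1, 1:]) \<theta> = 0"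
    by (simp add: map_poly_pCons algebra_simps)
  moreover have "lead_coeff [:- int m, -1, 1:] = 1" by simp
  ultimately have "algebraic_int \<theta>" unfolding algebraic_int_altdef_ipoly by blast
  moreover have "\<theta> \<in> L" unfolding \<theta>_def using gens_in_L(1) L_closed(2) by (simp add: L_closed)
  ultimately show "(1 + P) / 2 \<in> \<O>L" unfolding \<theta>_def by (simp add: ring_of_integers_def)
qed

text \<open>\<open>L/k\<close> being unramified shows up here as the integral element \<open>(1 + \<surd>p\<^sub>1)/2\<close> of relative trace 1:
  it makes extension of ideals from \<open>k\<close> to \<open>L\<close> injective.\<close>
lemma ideal_contraction:
  assumes I: "is_ideal_of \<O>k I" and z: "z \<in> OL.ext I" "z \<in> k"
  shows "z \<in> I"
proof -
  \<comment> \<open>The elements whose trace against every integer of L falls into I form an ideal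
    that contains I, hence its extension. Testing z in k against the element of trace 1 returns
    z.\<close>
  define T where "T = {z \<in> \<O>L. \<forall>\<omega>\<in>\<O>L. z * \<omega> + \<sigma> (z * \<omega>) \<in> I}"
  have "is_ideal_of \<O>L T" unfolding is_ideal_of_def
  proof (intro conjI ballI)
    show "T \<subseteq> \<O>L" by (auto simp: T_def)
    show "0 \<in> T" using OL.OK_closed(1) Ok.ideal_closed(3)[OF I] S.cj_base[OF S.closed(1)] by (simp add: T_def)
    fix a assume a: "a \<in> T"
    { fix b assume b: "b \<in> T"
      have "(a + b) * \<omega> + \<sigma> ((a + b) * \<omega>) \<in> I" if w: "\<omega> \<in> \<O>L" for \<omega>
      proof -
        have ab: "a * \<omega> \<in> L" "b * \<omega> \<in> L" using a b w OL.OK_closed(5) OL_L by (auto simp: T_def)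
        have "(a + b) * \<omega> + \<sigma> ((a + b) * \<omega>) = (a * \<omega> + \<sigma> (a * \<omega>)) + (b * \<omega> + \<sigma> (b * \<omega>))"
          by (simp add: distrib_right S.cj_add[OF ab])
        then show ?thesis using Ok.ideal_closed(1)[OF I] a b w by (simp add: T_def)
      qed
      then show "a + b \<in> T" using a b OL.OK_closed(3) by (simp add: T_def) }
    { fix r assume r: "r \<in> \<O>L"
      have "(r * a) * \<omega> + \<sigma> ((r * a) * \<omega>) \<in> I" if w: "\<omega> \<in> \<O>L" for \<omega>
      proof -
        have "(r * a) * \<omega> = a * (r * \<omega>)" by simp
        then show ?thesis using a OL.OK_closed(5)[OF r w] by (simp only: T_def mem_Collect_eq)
      qed
      then show "r * a \<in> T" using a r OL.OK_closed(5) by (simp add: T_def) }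
  qed
  moreover have "I \<subseteq> T"
  proof
    fix i assume i: "i \<in> I"
    have ik: "i \<in> \<O>k" using Ok.ideal_closed(4)[OF I i] .
    have "i * \<omega> + \<sigma> (i * \<omega>) \<in> I" if w: "\<omega> \<in> \<O>L" for \<omega>
    proof -
      have iL: "i \<in> L" "\<sigma> i = i" using ik Ok_subset_OL OL_L Ok_iff k_iff by blast+
      have "i * \<omega> + \<sigma> (i * \<omega>) = (\<omega> + \<sigma> \<omega>) * i"
        using S.cj_mult[OF iL(1) OL_L[OF w]] iL(2) by (simp add: algebra_simps)
      moreover have "\<omega> + \<sigma> \<omega> \<in> \<O>k"
        using OL.OK_closed(3)[OF w \<sigma>_OL[OF w]] S.trace_in_base[OF OL_L[OF w]] by (simp add: Ok_iff)
      ultimately show ?thesis using Ok.ideal_closed(2)[OF I i] by simp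
    qed
    then show "i \<in> T" using ik Ok_subset_OL by (auto simp: T_def)
  qed
  ultimately have zT: "z \<in> T" using OL.ext_least z(1) by blast
  define \<theta> where "\<theta> = (1 + P) / 2"
  have th: "\<theta> \<in> \<O>L" "\<theta> + \<sigma> \<theta> = 1" using half_one_plus_P unfolding \<theta>_def by auto
  have zL: "z \<in> L" "\<sigma> z = z" using z(2) S.base_subset S.cj_base by blast+
  have "z * \<theta> + \<sigma> (z * \<theta>) = z * (\<theta> + \<sigma> \<theta>)"
    using S.cj_mult[OF zL(1) OL_L[OF th(1)]] zL(2) by (simp add: algebra_simps)
  then have "z * \<theta> + \<sigma> (z * \<theta>) = z" unfolding th(2) by simp
  then show ?thesis using zT th(1) unfolding T_def by force
qed

text \<open>The contraction to k of the principal ideal of g. By \<open>ideal_contraction\<close> it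
  is the only ideal of k that can extend to that principal ideal.\<close>

definition cont where "cont g = OL.pr g \<inter> k"

lemma cont_ideal:
  assumes "g \<in> \<O>L"
  shows "is_ideal_of \<O>k (cont g)"
proof -
  note pr = OL.ideal_closed[OF OL.pr_ideal[OF assms]]
  show ?thesis unfolding is_ideal_of_def cont_def
    using pr Ok.OK_closed Ok_subset_OL S.closed(1,3,5) by (auto simp: Ok_iff)
qed

lemma cont_nonzero: "g \<in> \<O>L \<Longrightarrow> g \<noteq> 0 \<Longrightarrow> nonzero_ideal_of \<O>k (cont g)"
proof -
  assume g: "g \<in> \<O>L" "g \<noteq> 0"
  have "g * \<sigma> g \<in> cont g" using OL.prI[OF refl \<sigma>_OL] norm_OL g(1) by (auto simp: cont_def Ok_iff)
  moreover have "g * \<sigma> g \<noteq> 0" using g S.cj_eq_0_iff[OF OL_L[OF g(1)]] by simp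
  ultimately show ?thesis unfolding nonzero_ideal_of_def using cont_ideal[OF g(1)] by blast
qed

lemma cont_subset_OL: "g \<in> \<O>L \<Longrightarrow> cont g \<subseteq> \<O>L"
  using OL.ideal_closed(4)[OF OL.pr_ideal] by (auto simp: cont_def)

text \<open>The principal ideal of \<open>g\<close> is extended from an ideal of \<open>k\<close>.\<close>
definition extended where "extended g \<longleftrightarrow> g \<in> OL.ext (cont g)"

lemma ext_cont:
  assumes "g \<in> \<O>L" "extended g"
  shows "OL.ext (cont g) = OL.pr g"
proof
  show "OL.ext (cont g) \<subseteq> OL.pr g" by (rule OL.ext_least[OF OL.pr_ideal[OF assms(1)]]) (auto simp: cont_def)
  note e = OL.ideal_closed[OF OL.ext_ideal[OF cont_subset_OL[OF assms(1)]]]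
  show "OL.pr g \<subseteq> OL.ext (cont g)"
    using assms(2) e(2) unfolding extended_def by (auto elim!: OL.prE simp: mult.commute[of g])
qed

text \<open>A product of elements of \<open>cont g\<close> and \<open>cont h\<close> lies in
  \<open>cont (g * h)\<close>. Two colon ideals lift this to g * h, replacing one factor at a time
  by its generator.\<close>

lemma extended_mult:
  assumes g: "g \<in> \<O>L" "extended g" and h: "h \<in> \<O>L" "extended h"
  shows "extended (g * h)"
proof -
  have gh: "g * h \<in> \<O>L" using g h OL.OK_closed(5) by blast
  define J where "J = OL.ext (cont (g * h))"
  have J: "is_ideal_of \<O>L J" unfolding J_def by (rule OL.ext_ideal[OF cont_subset_OL[OF gh]])
  have 1: "h * g' \<in> J" if g': "g' \<in> cont g" for g'
  proof -
    have "cont h \<subseteq> {z \<in> \<O>L. z * g' \<in> J}"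
    proof
      fix h' assume h': "h' \<in> cont h"
      obtain r where r: "r \<in> \<O>L" "g' = g * r" using g' unfolding cont_def by (auto elim: OL.prE)
      obtain s where s: "s \<in> \<O>L" "h' = h * s" using h' unfolding cont_def by (auto elim: OL.prE)
      have "h' * g' \<in> OL.pr (g * h)"
        by (rule OL.prI[of _ _ "r * s"]) (use r s OL.OK_closed(5) in \<open>auto simp: ac_simps\<close>)
      then have "h' * g' \<in> cont (g * h)" using g' h' S.closed(5) by (simp add: cont_def)
      then show "h' \<in> {z \<in> \<O>L. z * g' \<in> J}"
        using OL.ext_superset cont_subset_OL[OF h(1)] h' unfolding J_def by auto
    qed
    then show ?thesis using OL.ext_least[OF OL.colon_ideal[OF J]] h(2) unfolding extended_def by blast
  qed
  have "cont g \<subseteq> {z \<in> \<O>L. z * h \<in> J}" using 1 cont_subset_OL[OF g(1)] by (auto simp: mult.commute)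
  then have "g \<in> {z \<in> \<O>L. z * h \<in> J}"
    using OL.ext_least[OF OL.colon_ideal[OF J]] g(2) unfolding extended_def by blast
  then show ?thesis unfolding extended_def J_def by blast
qed

lemma extended_1: "extended 1"
proof -
  have "1 \<in> cont 1" using OL.prI[of 1 1 1] OL.OK_closed(2) S.closed(2) by (simp add: cont_def)
  then show ?thesis unfolding extended_def using OL.ext_superset by blast
qed

lemma bezout:
  obtains c d :: int where "(of_int c * of_nat p1 + of_int d * of_nat (2 * p2) :: complex) = 1"
proof -
  have "coprime (int p1) (int (2 * p2))" using coprimes by (simp add: coprime_commute)
  then obtain c d where "c * int p1 + d * int (2 * p2) = 1" by (metis bezout_int coprime_iff_gcd_eq_1)
  then have "(of_int (c * int p1 + d * int (2 * p2)) :: complex) = 1" by simp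
  then show ?thesis using that[of c d] by simp
qed

lemma gens_OL: "P \<in> \<O>L" "R \<in> \<O>L" "D \<in> \<O>L" "\<i> \<in> \<O>L" "D \<in> k" "\<i> \<in> k"
  using gens_in_L PRD_algebraic_int kG.gen_in gaussian.gen_in kG.base_subset
  by (auto simp: ring_of_integers_def)

text \<open>The contraction contains p1 = P * P and D = P * R. The squares p1 and 2 p2 of the
  cofactors P and R are coprime, so a Bezout relation recovers P.\<close>

lemma extended_P: "extended P"
proof -
  define J where "J = OL.ext (cont P)"
  have J: "is_ideal_of \<O>L J" unfolding J_def by (rule OL.ext_ideal[OF cont_subset_OL[OF gens_OL(1)]])
  have "of_nat p1 \<in> cont P" unfolding cont_def
    using OL.prI[OF PP[symmetric] gens_OL(1)] S.closed(9) by blast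
  moreover have "D \<in> cont P" unfolding cont_def using OL.prI[OF D_eq gens_OL(2)] gens_OL(5) by blast
  ultimately have m: "of_nat p1 \<in> J" "D \<in> J" unfolding J_def using OL.ext_superset by blast+
  obtain c d :: int where cd: "(of_int c * of_nat p1 + of_int d * of_nat (2 * p2) :: complex) = 1" by (rule bezout)
  have "P = P * (of_int c * of_nat p1 + of_int d * (R * R))" unfolding RR cd by simp
  also have "\<dots> = (of_int c * P) * of_nat p1 + (of_int d * R) * D" by (simp add: D_eq algebra_simps)
  also have "\<dots> \<in> J" using m gens_OL OL.OK_closed by (intro OL.ideal_closed(1,2)[OF J]) auto
  finally show ?thesis unfolding extended_def J_def .
qed

end

context biquad_units
begin

section \<open>The capitulating ideal attached to a unit of norm -1\<close>

context
  fixes a b :: int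
  assumes ab: "a\<^sup>2 - int p1 * b\<^sup>2 = -1" and even_a: "even a"
begin

definition "e1 = of_int a + of_int b * P"
text \<open>The numerator is a Hilbert 90 element for \<kappa>: applying \<sigma> to e1 - \<i> gives
  -1/e1 - \<i>, which is \<kappa> (e1 - \<i>). The denominator lies in k and removes a factor 2, so
  that the square of \<delta> becomes a unit times a - \<i>.\<close>

definition "\<delta> = (e1 - \<i>) / (1 + \<i>)"
definition "\<kappa> = - \<i> / e1"

lemmas e1_unit = norm_minus_one_unit[OF ab, folded e1_def]

lemma e1_nonzero: "e1 \<noteq> 0"
  using e1_unit(1) by (simp add: unit_L_iff)

lemma \<sigma>_e1: "\<sigma> e1 = - 1 / e1"
  using e1_unit(2) e1_nonzero by (simp add: field_simps)

lemma e1_minus_inverse: "e1 - 1 / e1 = 2 * of_int a"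
proof -
  have "e1 - 1 / e1 = e1 + \<sigma> e1" unfolding \<sigma>_e1 by simp
  then show ?thesis unfolding e1_unit(4) unfolding e1_def by simp
qed

lemma e1_square: "e1 * e1 = 2 * of_int a * e1 + 1"
  using e1_minus_inverse e1_nonzero by (simp add: field_simps)

lemma \<delta>_square: "\<delta>\<^sup>2 = - \<i> * e1 * (of_int a - \<i>)"
proof -
  have "(e1 - \<i>)\<^sup>2 = e1 * e1 - 2 * \<i> * e1 - 1" by (simp add: power2_eq_square algebra_simps)
  also have "\<dots> = 2 * e1 * (of_int a - \<i>)" unfolding e1_square by (simp add: algebra_simps)
  finally have "\<delta>\<^sup>2 = 2 * e1 * (of_int a - \<i>) / (2 * \<i>)"
    unfolding \<delta>_def power_divide by (simp add: power2_eq_square algebra_simps)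
  also have "\<dots> = 2 * (e1 * (of_int a - \<i>)) / (2 * \<i>)" by simp
  also have "\<dots> = - \<i> * (e1 * (of_int a - \<i>))" by (simp only: mult_divide_mult_cancel_left_if) simp
  finally show ?thesis by simp
qed

lemma gaussian_integers_OL: "of_int c + of_int d * \<i> \<in> \<O>L" "of_int c - of_int d * \<i> \<in> \<O>L"
  using OL.OK_closed(3,4,5,7) gens_OL(4) by simp_all

lemma a_pm_i: "of_int a - \<i> \<in> \<O>L" "of_int a + \<i> \<in> \<O>L" "of_int a - \<i> \<noteq> 0" "of_int a + \<i> \<noteq> 0"
  using gaussian_integers_OL[of a 1] by (simp_all add: complex_eq_iff)

lemma e1_OL: "e1 \<in> \<O>L" "1 / e1 \<in> \<O>L"
  using e1_unit(1) by (simp_all add: unit_of_def divide_inverse)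

lemma OL_square_root: "z \<in> L \<Longrightarrow> z\<^sup>2 \<in> \<O>L \<Longrightarrow> z \<in> \<O>L"
  using algebraic_int_square_root by (simp add: ring_of_integers_def)

lemma \<delta>_OL: "\<delta> \<in> \<O>L" "\<delta> \<noteq> 0"
proof -
  have "\<delta> \<in> L" unfolding \<delta>_def using OL_L[OF e1_OL(1)] gens_in_L L_closed(2) by (simp add: L_closed)
  moreover have "\<delta>\<^sup>2 \<in> \<O>L" unfolding \<delta>_square
    using gens_OL(4) e1_OL(1) a_pm_i(1) OL.OK_closed(5,6) by simp
  ultimately show "\<delta> \<in> \<O>L" by (rule OL_square_root)
  have "\<delta>\<^sup>2 \<noteq> 0" unfolding \<delta>_square using e1_nonzero a_pm_i(3) by simp
  then show "\<delta> \<noteq> 0" by auto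
qed

lemma \<sigma>_\<delta>: "\<sigma> \<delta> = \<kappa> * \<delta>"
proof -
  have "\<sigma> \<delta> = (\<sigma> e1 - \<i>) / (1 + \<i>)"
    unfolding \<delta>_def using OL_L[OF e1_OL(1)] gens_in_L(4) L_closed(2,3,4) S.cj_divide S.cj_add S.cj_diff \<sigma>_gens(4)
      S.cj_base[OF S.closed(2)] by simp
  also have "- 1 / e1 - \<i> = - \<i> / e1 * (e1 - \<i>)" using e1_nonzero by (simp add: field_simps)
  then have "(\<sigma> e1 - \<i>) / (1 + \<i>) = \<kappa> * \<delta>" unfolding \<sigma>_e1 \<kappa>_def \<delta>_def by simp
  finally show ?thesis .
qed

text \<open>The extension \<open>J\<close> of the contraction contains a - \<i>, b D and b p1. The
  last two give b P = \<delta> \<theta> by the Bezout relation, and a further factor \<theta> gives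
  (a + \<i>) \<delta> up to a unit. As (a - \<i>) \<delta> is in \<open>J\<close> too, coprimality
  of a + \<i> and a - \<i>, which is where evenness of a enters, yields \<delta>.\<close>

lemma extended_\<delta>: "extended \<delta>"
proof -
  \<comment> \<open>The companion of \<delta>: its square is a unit times a + \<i>, since (a +
    \<i>)(a - \<i>) = a^2 + 1 = p1 b^2 = (b P)^2.\<close>
  define \<theta> where "\<theta> = of_int b * P / \<delta>"
  have dth: "\<delta> * \<theta> = of_int b * P" using \<delta>_OL(2) by (simp add: \<theta>_def)
  have "a\<^sup>2 + 1 = int p1 * b\<^sup>2" using ab by linarith
  then have "(of_int (a\<^sup>2 + 1) :: complex) = of_int (int p1 * b\<^sup>2)" by (simp only:)
  then have nrm: "(of_int a + \<i>) * (of_int a - \<i>) = of_int b * of_int b * (P * P)"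
    unfolding PP by (simp add: power2_eq_square algebra_simps)
  have "\<delta>\<^sup>2 * \<theta>\<^sup>2 = of_int b * of_int b * (P * P)" unfolding power_mult_distrib[symmetric] dth by (simp add: power2_eq_square)
  also have "\<dots> = \<delta>\<^sup>2 * (\<i> * (1 / e1) * (of_int a + \<i>))"
  proof -
    have "- \<i> * e1 * X * (\<i> * (1 / e1) * Y) = Y * X" for X Y using e1_nonzero by (simp add: ac_simps)
    then show ?thesis unfolding nrm[symmetric] \<delta>_square by simp
  qed
  finally have "\<delta>\<^sup>2 * \<theta>\<^sup>2 = \<delta>\<^sup>2 * (\<i> * (1 / e1) * (of_int a + \<i>))" .
  moreover have "\<delta>\<^sup>2 \<noteq> 0" using \<delta>_OL(2) by simp
  ultimately have th2: "\<theta>\<^sup>2 = \<i> * (1 / e1) * (of_int a + \<i>)" using mult_left_cancel by blast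
  have thOL: "\<theta> \<in> \<O>L"
  proof (rule OL_square_root)
    show "\<theta> \<in> L" unfolding \<theta>_def using OL_L[OF \<delta>_OL(1)] gens_in_L by (simp add: L_closed)
    show "\<theta>\<^sup>2 \<in> \<O>L" unfolding th2 using gens_OL(4) e1_OL(2) a_pm_i(2) by (intro OL.OK_closed(5))
  qed
  define J where "J = OL.ext (cont \<delta>)"
  have J: "is_ideal_of \<O>L J" unfolding J_def by (rule OL.ext_ideal[OF cont_subset_OL[OF \<delta>_OL(1)]])
  note Jc = OL.ideal_closed[OF J]
  have cJ: "z \<in> J" if "z = \<delta> * r" "r \<in> \<O>L" "z \<in> k" for z r
    using OL.prI[OF that(1,2)] that(3) OL.ext_superset unfolding J_def cont_def by blast
  have J1: "of_int a - \<i> \<in> J"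
  proof (rule cJ)
    show "of_int a - \<i> = \<delta> * (\<delta> * (\<i> * (1 / e1)))"
    proof -
      have "- \<i> * e1 * X * (\<i> * (1 / e1)) = X" for X using e1_nonzero by (simp add: ac_simps)
      then show ?thesis unfolding mult.assoc[symmetric, of \<delta>] power2_eq_square[symmetric] \<delta>_square by simp
    qed
    show "\<delta> * (\<i> * (1 / e1)) \<in> \<O>L" using \<delta>_OL(1) gens_OL(4) e1_OL(2) by (intro OL.OK_closed(5))
    show "of_int a - \<i> \<in> k" using gens_OL(6) by (simp add: S.closed)
  qed
  have J2: "of_int b * D \<in> J"
  proof (rule cJ)
    show "of_int b * D = \<delta> * (\<theta> * R)" unfolding mult.assoc[symmetric] dth by (simp add: D_eq)
    show "\<theta> * R \<in> \<O>L" using thOL gens_OL(2) OL.OK_closed(5) by simp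
    show "of_int b * D \<in> k" using gens_OL(5) by (simp add: S.closed)
  qed
  have J3: "of_int b * of_nat p1 \<in> J"
  proof (rule cJ)
    show "of_int b * of_nat p1 = \<delta> * (\<theta> * P)" unfolding mult.assoc[symmetric] dth by (simp add: PP[symmetric])
    show "\<theta> * P \<in> \<O>L" using thOL gens_OL(1) OL.OK_closed(5) by simp
    show "of_int b * of_nat p1 \<in> k" by (simp add: S.closed)
  qed
  obtain c d :: int where cd: "(of_int c * of_nat p1 + of_int d * of_nat (2 * p2) :: complex) = 1" by (rule bezout)
  have "of_int b * P = of_int b * P * (of_int c * of_nat p1 + of_int d * (R * R))" unfolding RR cd by simp
  also have "\<dots> = (of_int c * P) * (of_int b * of_nat p1) + (of_int d * R) * (of_int b * D)"
    by (simp add: D_eq algebra_simps)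
  also have "\<dots> \<in> J" using J2 J3 gens_OL OL.OK_closed(5,7) Jc(1,2) by simp
  finally have "\<theta> * (\<delta> * \<theta>) \<in> J" using Jc(2)[OF _ thOL] dth by simp
  moreover have "\<theta> * (\<delta> * \<theta>) = \<delta> * (\<i> * (1 / e1) * (of_int a + \<i>))"
    unfolding th2[symmetric] by (simp add: power2_eq_square)
  ultimately have Q: "\<delta> * (\<i> * (1 / e1) * (of_int a + \<i>)) \<in> J" by (simp only:)
  have "- \<i> * e1 \<in> \<O>L" using gens_OL(4) e1_OL(1) by (intro OL.OK_closed(5,6))
  from Jc(2)[OF Q this] have "- \<i> * e1 * (\<delta> * (\<i> * (1 / e1) * (of_int a + \<i>))) \<in> J" .
  moreover have "- \<i> * e1 * (\<delta> * (\<i> * (1 / e1) * Y)) = Y * \<delta>" for Y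
    using e1_nonzero by (simp add: ac_simps)
  ultimately have J4: "(of_int a + \<i>) * \<delta> \<in> J" by (simp only:)
  have J5: "(of_int a - \<i>) * \<delta> \<in> J" using Jc(2)[OF J1 \<delta>_OL(1)] by (simp add: mult.commute)
  obtain h where h: "a = 2 * h" using even_a by blast
  \<comment> \<open>With a = 2 h the first product is (4 h^2 + 1) \<delta>, and since (a + \<i>) -
    (a - \<i>) = 2 \<i>, the subtracted term is exactly 4 h^2 \<delta>.\<close>
  have "\<delta> = (of_int a + \<i>) * ((of_int a - \<i>) * \<delta>)
      - of_int (2 * h\<^sup>2) * (- \<i>) * ((of_int a + \<i>) * \<delta> - (of_int a - \<i>) * \<delta>)"
    unfolding h by (simp add: algebra_simps power2_eq_square)
  moreover have "of_int (2 * h\<^sup>2) * (- \<i>) \<in> \<O>L" using gens_OL(4) by (intro OL.OK_closed(5,6,7))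
  then have "(of_int a + \<i>) * ((of_int a - \<i>) * \<delta>)
      - of_int (2 * h\<^sup>2) * (- \<i>) * ((of_int a + \<i>) * \<delta> - (of_int a - \<i>) * \<delta>) \<in> J"
    by (rule Jc(5)[OF Jc(2)[OF J5 a_pm_i(2)] Jc(2)[OF Jc(5)[OF J4 J5]]])
  ultimately show ?thesis unfolding extended_def J_def by (simp only:)
qed

lemma \<kappa>_nonreal: "Im \<kappa> \<noteq> 0" "Im (- \<kappa>) \<noteq> 0"
proof -
  have "Re e1 \<noteq> 0" using e1_nonzero e1_unit(3) by (auto simp: complex_eq_iff)
  then show "Im \<kappa> \<noteq> 0" "Im (- \<kappa>) \<noteq> 0"
    unfolding \<kappa>_def using e1_unit(3) by (auto simp: Im_divide power2_eq_square)
qed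

end

lemma Ok_fixed: "z \<in> \<O>k \<Longrightarrow> z \<in> L" "z \<in> \<O>k \<Longrightarrow> \<sigma> z = z"
  using S.base_subset S.cj_base unfolding Ok_iff by blast+

text \<open>The equation says that \<alpha> v / g is fixed by \<sigma>, so it is an element A / B of
  k. Scaling by it carries the principal ideal of g to that of \<alpha>, and intersecting with k
  carries \<open>cont g\<close> to I, where \<open>ideal_contraction\<close> returns from the
  extension to I.\<close>

lemma classify:
  assumes I: "nonzero_ideal_of \<O>k I" and \<alpha>: "\<alpha> \<in> \<O>L" "\<alpha> \<noteq> 0" "OL.ext I = OL.pr \<alpha>"
    and g: "g \<in> \<O>L" "g \<noteq> 0" and v: "unit_of L v" and eq: "\<sigma> (\<alpha> * v) * g = \<sigma> g * (\<alpha> * v)"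
  shows "(I, cont g) \<in> same_ideal_class \<O>k"
proof -
  have Ii: "is_ideal_of \<O>k I" using I by (simp add: nonzero_ideal_of_def)
  have vO: "v \<in> \<O>L" "inverse v \<in> \<O>L" "v \<noteq> 0" using v by (auto simp: unit_of_def)
  define \<alpha>' where "\<alpha>' = \<alpha> * v"
  have a': "\<alpha>' \<in> \<O>L" "\<alpha>' \<noteq> 0" unfolding \<alpha>'_def using \<alpha> vO OL.OK_closed(5) by simp_all
  have pr: "OL.pr \<alpha> = OL.pr \<alpha>'"
  proof (intro Set.set_eqI iffI)
    fix z assume "z \<in> OL.pr \<alpha>"
    then obtain r where r: "r \<in> \<O>L" "z = \<alpha> * r" by (rule OL.prE)
    have "z = \<alpha>' * (inverse v * r)" unfolding r(2) \<alpha>'_def using vO(3) by simp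
    then show "z \<in> OL.pr \<alpha>'" using OL.prI OL.OK_closed(5)[OF vO(2) r(1)] by blast
  next
    fix z assume "z \<in> OL.pr \<alpha>'"
    then obtain r where r: "r \<in> \<O>L" "z = \<alpha>' * r" by (rule OL.prE)
    have "z = \<alpha> * (v * r)" unfolding r(2) \<alpha>'_def by simp
    then show "z \<in> OL.pr \<alpha>" using OL.prI OL.OK_closed(5)[OF vO(1) r(1)] by blast
  qed
  \<comment> \<open>The fraction \<alpha>' / g is expanded by \<sigma> g so that the denominator
    becomes a norm, hence both terms are integers of k.\<close>
  define A where "A = \<alpha>' * \<sigma> g"
  define B where "B = g * \<sigma> g"
  have gL: "g \<in> L" "\<sigma> g \<in> L" "\<alpha>' \<in> L" using OL_L g \<sigma>_OL a' by blast+
  have sg: "\<sigma> g \<noteq> 0" using S.cj_eq_0_iff[OF gL(1)] g(2) by simp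
  have AB0: "A \<noteq> 0" "B \<noteq> 0" using sg g a' by (simp_all add: A_def B_def)
  have B: "B \<in> \<O>k" unfolding B_def by (rule norm_OL[OF g(1)])
  have AO: "A \<in> \<O>L" unfolding A_def using a' \<sigma>_OL g OL.OK_closed(5) by blast
  have "\<sigma> A = \<sigma> \<alpha>' * g" unfolding A_def using S.cj_mult[OF gL(3,2)] S.cj_cj[OF gL(1)] by simp
  also have "\<dots> = A" using eq unfolding A_def \<alpha>'_def by (simp add: mult.commute)
  finally have A: "A \<in> \<O>k" using AO k_iff[OF OL_L[OF AO]] by (simp add: Ok_iff)
  have AgB: "B * \<alpha>' = A * g" by (simp add: A_def B_def)
  have ABk: "A \<in> k" "B \<in> k" using A B by (simp_all add: Ok_iff)
  have "(\<lambda>z. B * z) ` I = (\<lambda>z. A * z) ` cont g"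
  proof (intro Set.set_eqI iffI)
    fix z assume "z \<in> (\<lambda>z. B * z) ` I"
    then obtain i where i: "i \<in> I" "z = B * i" by blast
    then have "i \<in> OL.pr \<alpha>'" using OL.ext_superset[of I] \<alpha>(3) pr by blast
    then obtain r where r: "r \<in> \<O>L" "i = \<alpha>' * r" by (rule OL.prE)
    have zA: "z = A * (g * r)" unfolding i(2) r(2) using AgB by (simp flip: mult.assoc)
    have ik: "i \<in> k" using Ok.ideal_closed(4)[OF Ii i(1)] by (simp add: Ok_iff)
    have "g * r = B * i / A" using zA i(2) AB0 by (simp add: field_simps)
    also have "\<dots> \<in> k" using ABk ik by (simp add: S.closed)
    finally have "g * r \<in> cont g" unfolding cont_def using OL.prI[OF refl r(1)] by blast
    then show "z \<in> (\<lambda>z. A * z) ` cont g" using zA by blast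
  next
    fix z assume "z \<in> (\<lambda>z. A * z) ` cont g"
    then obtain y where y: "y \<in> cont g" "z = A * y" by blast
    then obtain r where r: "r \<in> \<O>L" "y = g * r" unfolding cont_def by (auto elim: OL.prE)
    have zB: "z = B * (\<alpha>' * r)" unfolding y(2) r(2) using AgB by (simp flip: mult.assoc)
    have yk: "y \<in> k" using y(1) by (simp add: cont_def)
    have "\<alpha>' * r = A * y / B" using zB y(2) AB0 by (simp add: field_simps)
    also have "\<dots> \<in> k" using ABk yk by (simp add: S.closed)
    finally have "\<alpha>' * r \<in> k" .
    moreover have "\<alpha>' * r \<in> OL.ext I" unfolding \<alpha>(3) pr by (rule OL.prI[OF refl r(1)])
    ultimately have "\<alpha>' * r \<in> I" using ideal_contraction[OF Ii] by blast
    then show "z \<in> (\<lambda>z. B * z) ` I" using zB by blast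
  qed
  then show ?thesis using same_ideal_classI I cont_nonzero[OF g] A B AB0 by blast
qed

text \<open>Extending a * cont g = b * cont h to L makes a g and b h associated by a unit r. Since a
  and b are fixed by \<sigma>, they cancel when this relation is compared with its
  conjugate.\<close>

lemma same_class_ratio:
  assumes g: "g \<in> \<O>L" "g \<noteq> 0" "extended g" and h: "h \<in> \<O>L" "h \<noteq> 0" "extended h"
    and gh: "(cont g, cont h) \<in> same_ideal_class \<O>k"
  obtains v where "unit_of L v" "\<sigma> g * h * v = g * \<sigma> h * \<sigma> v"
proof -
  obtain a b where ab: "a \<in> \<O>k" "b \<in> \<O>k" "a \<noteq> 0" "b \<noteq> 0" "(\<lambda>z. a * z) ` cont g = (\<lambda>z. b * z) ` cont h"
    using gh by (rule same_ideal_classE)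
  have step: "\<exists>r\<in>\<O>L. a' * g' = b' * h' * r" if ab': "a' \<in> \<O>k" "b' \<in> \<O>k" "(\<lambda>z. a' * z) ` cont g' = (\<lambda>z. b' * z) ` cont h'"
    "g' \<in> \<O>L" "extended g'" "h' \<in> \<O>L" for a' b' g' h'
  proof -
    have bh: "b' * h' \<in> \<O>L" using ab' OL.OK_closed(5) Ok_subset_OL by blast
    have "cont g' \<subseteq> {z \<in> \<O>L. z * a' \<in> OL.pr (b' * h')}"
    proof
      fix z assume z: "z \<in> cont g'"
      then have "a' * z \<in> (\<lambda>z. b' * z) ` cont h'" using ab'(3) by blast
      then obtain y where y: "y \<in> cont h'" "a' * z = b' * y" by blast
      then obtain r where "r \<in> \<O>L" "y = h' * r" unfolding cont_def by (auto elim: OL.prE)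
      then have "z * a' \<in> OL.pr (b' * h')" using y(2) by (intro OL.prI[of _ _ r]) (auto simp: ac_simps)
      then show "z \<in> {z \<in> \<O>L. z * a' \<in> OL.pr (b' * h')}" using z cont_subset_OL[OF ab'(4)] by blast
    qed
    then have "g' \<in> {z \<in> \<O>L. z * a' \<in> OL.pr (b' * h')}"
      using OL.ext_least[OF OL.colon_ideal[OF OL.pr_ideal[OF bh]]] ab'(5) unfolding extended_def by blast
    then obtain r where "r \<in> \<O>L" "g' * a' = b' * h' * r" by (auto elim: OL.prE)
    then show ?thesis by (intro bexI[of _ r]) (simp_all add: mult.commute)
  qed
  obtain r where r: "r \<in> \<O>L" "a * g = b * h * r" using step[OF ab(1,2,5) g(1,3) h(1)] by blast
  obtain s where s: "s \<in> \<O>L" "b * h = a * g * s" using step[OF ab(2,1) ab(5)[symmetric] h(1,3) g(1)] by blast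
  have "a * g * (s * r) = a * g" using r(2) s(2) by simp
  then have sr: "s * r = 1" using ab(3) g(2) by simp
  then have r0: "r \<noteq> 0" by auto
  have "inverse r = s" using sr by (metis inverse_unique mult.commute)
  then have u: "unit_of L r" using r(1) s(1) r0 by (simp add: unit_of_def)
  have L: "a \<in> L" "b \<in> L" "g \<in> L" "h \<in> L" "r \<in> L" "\<sigma> a = a" "\<sigma> b = b"
    using Ok_fixed[OF ab(1)] Ok_fixed[OF ab(2)] OL_L[OF g(1)] OL_L[OF h(1)] OL_L[OF r(1)] by simp_all
  have bhL: "b * h \<in> L" using L(2,4) by (rule L_closed(5))
  have "\<sigma> (a * g) = \<sigma> (b * h * r)" using r(2) by simp
  then have 1: "a * \<sigma> g = b * \<sigma> h * \<sigma> r"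
    using S.cj_mult[OF L(1,3)] S.cj_mult[OF bhL L(5)] S.cj_mult[OF L(2,4)] L(6,7) by simp
  have "(a * b) * (\<sigma> g * h * r) = (a * \<sigma> g) * (b * h * r)" by simp
  also have "\<dots> = (a * b) * (g * \<sigma> h * \<sigma> r)" unfolding 1 unfolding r(2)[symmetric] by simp
  finally have "\<sigma> g * h * r = g * \<sigma> h * \<sigma> r" using ab(3,4) by simp
  then show ?thesis using that u by blast
qed

end

section \<open>Counting the capitulating classes\<close>

context biquad_units
begin

abbreviation "kernel_ideals \<equiv> {I. nonzero_ideal_of \<O>k I \<and> principal_ideal_of \<O>L (OL.ext I)}"

definition cls where "cls g = same_ideal_class \<O>k `` {cont g}"

lemma cls_eq_iff:
  assumes "g \<in> \<O>L" "g \<noteq> 0" "h \<in> \<O>L" "h \<noteq> 0"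
  shows "cls g = cls h \<longleftrightarrow> (cont g, cont h) \<in> same_ideal_class \<O>k"
proof
  assume "cls g = cls h"
  moreover have "cont h \<in> cls h"
    unfolding cls_def using same_ideal_class_refl[OF Ok.OK_closed(2) cont_nonzero[OF assms(3,4)]] by blast
  ultimately show "(cont g, cont h) \<in> same_ideal_class \<O>k" unfolding cls_def by blast
next
  assume "(cont g, cont h) \<in> same_ideal_class \<O>k"
  then show "cls g = cls h" unfolding cls_def
    using same_ideal_class_sym same_ideal_class_trans[of "\<O>k", OF Ok.OK_closed(5)] by blast
qed

lemma cont_in_kernel: "g \<in> \<O>L \<Longrightarrow> g \<noteq> 0 \<Longrightarrow> extended g \<Longrightarrow> cont g \<in> kernel_ideals"
  using cont_nonzero ext_cont unfolding principal_ideal_of_def OL.pr_def by auto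

text \<open>An ideal extended from k is stable under \<sigma>, so \<sigma> \<alpha> is a multiple of
  \<alpha>. Applying \<sigma> twice gives \<open>u * \<sigma> u = 1\<close>, which also makes u a
  unit.\<close>

lemma kernel_ideal_generator:
  assumes "I \<in> kernel_ideals"
  obtains \<alpha> u where "\<alpha> \<in> \<O>L" "\<alpha> \<noteq> 0" "OL.ext I = OL.pr \<alpha>" "unit_of L u" "u * \<sigma> u = 1" "\<sigma> \<alpha> = \<alpha> * u"
proof -
  have I: "nonzero_ideal_of \<O>k I" "is_ideal_of \<O>k I" "I \<noteq> {0}" and "principal_ideal_of \<O>L (OL.ext I)"
    using assms by (auto simp: nonzero_ideal_of_def)
  then obtain \<alpha> where \<alpha>: "\<alpha> \<in> \<O>L" "OL.ext I = OL.pr \<alpha>" unfolding principal_ideal_of_def OL.pr_def by blast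
  have a0: "\<alpha> \<noteq> 0"
  proof
    assume "\<alpha> = 0"
    have "i = 0" if "i \<in> I" for i
      using that OL.ext_superset[of I] \<open>\<alpha> = 0\<close> unfolding \<alpha>(2) OL.pr_def by auto
    then have "I \<subseteq> {0}" by blast
    then show False using I Ok.ideal_closed(3)[OF I(2)] by blast
  qed
  note pr = OL.ideal_closed[OF OL.pr_ideal[OF \<alpha>(1)]]
  \<comment> \<open>The preimage under \<sigma> of the principal ideal; it is an ideal containing I,
    so it contains the extension.\<close>
  define T where "T = {z \<in> \<O>L. \<sigma> z \<in> OL.pr \<alpha>}"
  have "is_ideal_of \<O>L T" unfolding is_ideal_of_def
  proof (intro conjI ballI)
    show "T \<subseteq> \<O>L" by (auto simp: T_def)
    show "0 \<in> T" using OL.OK_closed(1) pr(3) S.cj_base[OF S.closed(1)] by (simp add: T_def)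
    fix s assume s: "s \<in> T"
    { fix t assume t: "t \<in> T"
      have "\<sigma> (s + t) = \<sigma> s + \<sigma> t" using s t OL_L by (intro S.cj_add) (auto simp: T_def)
      then show "s + t \<in> T" using s t OL.OK_closed(3) pr(1) by (simp add: T_def) }
    { fix r assume r: "r \<in> \<O>L"
      have "\<sigma> (r * s) = \<sigma> r * \<sigma> s" using s r OL_L by (intro S.cj_mult) (auto simp: T_def)
      then show "r * s \<in> T" using s r OL.OK_closed(5) pr(2) \<sigma>_OL[OF r] by (simp add: T_def) }
  qed
  moreover have "I \<subseteq> T"
  proof
    fix i assume i: "i \<in> I"
    then have "i \<in> \<O>k" using Ok.ideal_closed(4)[OF I(2)] by blast
    then show "i \<in> T" using Ok_fixed(2) Ok_subset_OL OL.ext_superset[of I] i unfolding T_def \<alpha>(2) by auto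
  qed
  ultimately have "OL.pr \<alpha> \<subseteq> T" using OL.ext_least unfolding \<alpha>(2)[symmetric] by blast
  moreover have "\<alpha> \<in> OL.pr \<alpha>" using OL.prI[of \<alpha> \<alpha> 1] OL.OK_closed(2) by simp
  ultimately have "\<sigma> \<alpha> \<in> OL.pr \<alpha>" unfolding T_def by blast
  then obtain u where u: "u \<in> \<O>L" "\<sigma> \<alpha> = \<alpha> * u" by (rule OL.prE)
  have "\<alpha> = \<sigma> (\<alpha> * u)" using S.cj_cj[OF OL_L[OF \<alpha>(1)]] u(2) by simp
  also have "\<dots> = \<alpha> * (u * \<sigma> u)" using S.cj_mult[OF OL_L[OF \<alpha>(1)] OL_L[OF u(1)]] u(2) by simp
  finally have n: "u * \<sigma> u = 1" using a0 by simp
  then have "u \<noteq> 0" "inverse u = \<sigma> u" by (auto intro: inverse_unique)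
  then have "unit_of L u" using u(1) \<sigma>_OL[OF u(1)] by (simp add: unit_of_def)
  then show ?thesis using that \<alpha> a0 n u(2) by blast
qed

text \<open>For generators that \<sigma> multiplies by l and m, equality of classes becomes
  solvability of l/m = \<sigma>(v)/v in units of L; \<open>eigen_cls_eqI\<close> is the converse
  direction.\<close>

lemma eigen_class_ratio:
  assumes g: "g \<in> \<O>L" "g \<noteq> 0" "extended g" "\<sigma> g = l * g" and h: "h \<in> \<O>L" "h \<noteq> 0" "extended h" "\<sigma> h = m * h"
    and "cls g = cls h"
  obtains v where "unit_of L v" "l * v = m * \<sigma> v"
proof -
  have "(cont g, cont h) \<in> same_ideal_class \<O>k" using cls_eq_iff g h assms(9) by blast
  then obtain v where v: "unit_of L v" "\<sigma> g * h * v = g * \<sigma> h * \<sigma> v"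
    using same_class_ratio[OF g(1-3) h(1-3)] by blast
  have "(g * h) * (l * v) = (g * h) * (m * \<sigma> v)" using v(2) unfolding g(4) h(4) by (simp add: ac_simps)
  then have "l * v = m * \<sigma> v" using g(2) h(2) by simp
  then show ?thesis using that v(1) by blast
qed

lemma eigen_cls_eqI:
  assumes g: "g \<in> \<O>L" "g \<noteq> 0" "extended g" "\<sigma> g = l * g" and h: "h \<in> \<O>L" "h \<noteq> 0" "\<sigma> h = m * h"
    and v: "unit_of L v" "l * \<sigma> v = m * v"
  shows "cls g = cls h"
proof -
  have vL: "v \<in> L" using v(1) by (simp add: unit_L_iff)
  have "\<sigma> (g * v) = \<sigma> g * \<sigma> v" by (rule S.cj_mult[OF OL_L[OF g(1)] vL])
  then have "\<sigma> (g * v) = g * (l * \<sigma> v)" unfolding g(4) by simp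
  then have "\<sigma> (g * v) * h = \<sigma> h * (g * v)" unfolding v(2) h(3) by simp
  then have "(cont g, cont h) \<in> same_ideal_class \<O>k"
    using classify[OF cont_nonzero[OF g(1,2)] g(1,2) ext_cont[OF g(1,3)] h(1,2) v(1)] by blast
  then show ?thesis using cls_eq_iff g h by blast
qed

text \<open>The generators 1, P, d, P d have the \<sigma>-eigenvalues 1, -1, \<kappa>', -\<kappa>',
  and \<open>norm_one_coboundary\<close> matches every kernel ideal with one of them. Which of the
  four classes coincide is then a question about quotients \<sigma>(v)/v.\<close>

theorem card_kernel:
  "card (kernel_ideals // same_ideal_class \<O>k)
    = (if (\<exists>n::nat. x + 1 = int n ^ 2 \<or> x - 1 = int n ^ 2) then 4 else 2)"
proof -
  have "sqrt (real p1) \<notin> \<rat>"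
  proof
    assume "sqrt (real p1) \<in> \<rat>"
    then have "csq p1 \<in> \<rat>" by (elim Rats_cases') (simp add: Rats_divide)
    then show False using irrationals(1) by blast
  qed
  then obtain a b :: int where ab: "a\<^sup>2 - int p1 * b\<^sup>2 = -1" "even a"
    using negative_Pell_solution_exists[OF prime(1) mod4(1)] by blast
  define d where "d = \<delta> a b"
  define \<kappa>' where "\<kappa>' = \<kappa> a b"
  note d = \<delta>_OL[OF ab, folded d_def] \<sigma>_\<delta>[OF ab, folded d_def \<kappa>'_def] extended_\<delta>[OF ab, folded d_def]
  note kap = \<kappa>_nonreal[OF ab, folded \<kappa>'_def]
  have kap_eq: "\<kappa>' = - \<i> / (of_int a + of_int b * P)" unfolding \<kappa>'_def \<kappa>_def[OF ab] e1_def[OF ab] ..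
  have one: "1 \<in> \<O>L" "(1::complex) \<noteq> 0" "extended 1" "\<sigma> 1 = 1 * 1"
    using OL.OK_closed(2) extended_1 S.cj_base[OF S.closed(2)] by simp_all
  have PP': "P \<in> \<O>L" "P \<noteq> 0" "extended P" "\<sigma> P = (-1) * P"
    using gens_OL(1) PRD_nonzero(1) extended_P \<sigma>_gens(1) by simp_all
  have dd: "d \<in> \<O>L" "d \<noteq> 0" "extended d" "\<sigma> d = \<kappa>' * d" using d by simp_all
  have Pd: "P * d \<in> \<O>L" "P * d \<noteq> 0" "extended (P * d)" "\<sigma> (P * d) = (- \<kappa>') * (P * d)"
    using PP' dd OL.OK_closed(5) extended_mult S.cj_mult[OF OL_L[OF PP'(1)] OL_L[OF dd(1)]] by simp_all
  have quot: "kernel_ideals // same_ideal_class \<O>k = {cls 1, cls P, cls d, cls (P * d)}"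
  proof
    show "{cls 1, cls P, cls d, cls (P * d)} \<subseteq> kernel_ideals // same_ideal_class \<O>k"
      unfolding cls_def using cont_in_kernel one PP' dd Pd by (auto intro!: quotientI)
    show "kernel_ideals // same_ideal_class \<O>k \<subseteq> {cls 1, cls P, cls d, cls (P * d)}"
    proof
      fix X assume "X \<in> kernel_ideals // same_ideal_class \<O>k"
      then obtain I where I: "I \<in> kernel_ideals" "X = same_ideal_class \<O>k `` {I}" by (rule quotientE)
      have nI: "nonzero_ideal_of \<O>k I" using I(1) by simp
      obtain \<alpha> u where au: "\<alpha> \<in> \<O>L" "\<alpha> \<noteq> 0" "OL.ext I = OL.pr \<alpha>" "unit_of L u" "u * \<sigma> u = 1" "\<sigma> \<alpha> = \<alpha> * u"
        by (rule kernel_ideal_generator[OF I(1)])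
      obtain v s where v: "unit_of L v" "s = 1 \<or> s = -1" "u * \<sigma> v = s * v \<or> u * \<sigma> v = s * \<kappa>' * v"
        unfolding kap_eq by (rule norm_one_coboundary[OF ab(1) au(4,5)])
      have vL: "v \<in> L" using v(1) by (simp add: unit_L_iff)
      have *: "X = cls g" if g: "g \<in> \<O>L" "g \<noteq> 0" "\<sigma> g = l * g" "u * \<sigma> v = l * v" for g l
      proof -
        have "\<sigma> (\<alpha> * v) = \<alpha> * (u * \<sigma> v)" using S.cj_mult[OF OL_L[OF au(1)] vL] au(6) by simp
        then have "\<sigma> (\<alpha> * v) * g = \<sigma> g * (\<alpha> * v)" unfolding g(3,4) by simp
        then have c: "(I, cont g) \<in> same_ideal_class \<O>k" by (rule classify[OF nI au(1-3) g(1,2) v(1)])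
        then show ?thesis unfolding I(2) cls_def
          using same_ideal_class_sym same_ideal_class_trans[of "\<O>k", OF Ok.OK_closed(5)] by blast
      qed
      have "u * \<sigma> v = 1 * v \<or> u * \<sigma> v = (-1) * v \<or> u * \<sigma> v = \<kappa>' * v \<or> u * \<sigma> v = (- \<kappa>') * v"
        using v(2,3) by auto
      then show "X \<in> {cls 1, cls P, cls d, cls (P * d)}"
        using *[OF one(1,2,4)] *[OF PP'(1,2,4)] *[OF dd(1,2,4)] *[OF Pd(1,2,4)] by blast
    qed
  qed
  \<comment> \<open>Because \<sigma>(v)/v is real, either equation would make \<kappa>'
    real.\<close>
  have sep: "False" if v: "unit_of L v" "\<kappa>' * \<sigma> v = v \<or> \<kappa>' * \<sigma> v = - v" for v
  proof -
    have v0: "v \<noteq> 0" using v(1) by (simp add: unit_L_iff)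
    define q where "q = \<sigma> v / v"
    have r: "Im q = 0" unfolding q_def by (rule unit_L_\<sigma>_quotient_real[OF v(1)])
    have "\<sigma> v = q * v" unfolding q_def using v0 by simp
    then have "(\<kappa>' * q) * v = 1 * v \<or> (\<kappa>' * q) * v = (-1) * v" using v(2) by (simp add: mult.assoc)
    then have "\<kappa>' * q = 1 \<or> \<kappa>' * q = -1" using v0 mult_right_cancel by blast
    then have "Im (\<kappa>' * q) = 0" "q \<noteq> 0" by (auto simp del: times_complex.simps)
    then have "Im \<kappa>' * Re q = 0" "Re q \<noteq> 0" using r by (auto simp: complex_eq_iff)
    then show False using kap by simp
  qed
  have ne: "cls 1 \<noteq> cls d" "cls 1 \<noteq> cls (P * d)" "cls P \<noteq> cls d" "cls P \<noteq> cls (P * d)"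
  proof -
    show "cls 1 \<noteq> cls d"
    proof
      assume "cls 1 = cls d"
      then obtain v where "unit_of L v" "1 * v = \<kappa>' * \<sigma> v" by (rule eigen_class_ratio[OF one dd])
      then show False using sep[of v] by simp
    qed
    show "cls 1 \<noteq> cls (P * d)"
    proof
      assume "cls 1 = cls (P * d)"
      then obtain v where v: "unit_of L v" "1 * v = (- \<kappa>') * \<sigma> v" by (rule eigen_class_ratio[OF one Pd])
      then have "\<kappa>' * \<sigma> v = - v" by (metis minus_minus mult_1 mult_minus_left)
      then show False using sep[OF v(1)] by blast
    qed
    show "cls P \<noteq> cls d"
    proof
      assume "cls P = cls d"
      then obtain v where "unit_of L v" "(-1) * v = \<kappa>' * \<sigma> v" by (rule eigen_class_ratio[OF PP' dd])
      then show False using sep[of v] by simp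
    qed
    show "cls P \<noteq> cls (P * d)"
    proof
      assume "cls P = cls (P * d)"
      then obtain v where "unit_of L v" "(-1) * v = (- \<kappa>') * \<sigma> v" by (rule eigen_class_ratio[OF PP' Pd])
      then show False using sep[of v] by simp
    qed
  qed
  show ?thesis
  proof (cases "\<exists>n::nat. x + 1 = int n ^ 2 \<or> x - 1 = int n ^ 2")
    case True
    then obtain C where "C \<in> QD" "C\<^sup>2 = 2 * \<epsilon>3" using \<epsilon>3_dichotomy by blast
    then have anti: "\<sigma> v \<noteq> - v" if "unit_of L v" for v using no_antiinvariant_unit[OF f3] that by blast
    have k0: "\<kappa>' \<noteq> 0" using kap by auto
    have "cls 1 \<noteq> cls P"
    proof
      assume "cls 1 = cls P"
      then obtain v where v: "unit_of L v" "1 * v = (-1) * \<sigma> v" by (rule eigen_class_ratio[OF one PP'])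
      then show False using anti[OF v(1)] by (metis minus_minus mult_1 mult_minus_left)
    qed
    moreover have "cls d \<noteq> cls (P * d)"
    proof
      assume "cls d = cls (P * d)"
      then obtain v where v: "unit_of L v" "\<kappa>' * v = (- \<kappa>') * \<sigma> v" by (rule eigen_class_ratio[OF dd Pd])
      have "\<kappa>' * v = \<kappa>' * (- \<sigma> v)" using v(2) by simp
      then have "v = - \<sigma> v" using k0 mult_left_cancel by blast
      then show False using anti[OF v(1)] by (metis minus_minus)
    qed
    ultimately show ?thesis using True ne unfolding quot by simp
  next
    case False
    \<comment> \<open>This unit identifies the classes of generators whose eigenvalues differ by the
      sign, leaving two classes.\<close>
    then obtain v where v: "unit_of L v" "\<sigma> v = - v" using \<epsilon>3_dichotomy by blast
    have "cls 1 = cls P" by (rule eigen_cls_eqI[OF one PP'(1,2,4) v(1)]) (simp add: v(2))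
    moreover have "cls d = cls (P * d)" by (rule eigen_cls_eqI[OF dd Pd(1,2,4) v(1)]) (simp add: v(2))
    ultimately have "{cls 1, cls P, cls d, cls (P * d)} = {cls 1, cls d}" by auto
    then show ?thesis using False ne(1) unfolding quot by simp
  qed
qed

lemma field_gen_k: "field_gen {csq (2 * p1 * p2), \<i>} = k"
proof
  have "D \<in> k" "\<i> \<in> k" using gens_OL(5,6) by blast+
  then show "field_gen {csq (2 * p1 * p2), \<i>} \<subseteq> k"
    using field_gen_subset_iff[OF is_subfields(1)] unfolding D_def by simp
  have "k \<subseteq> F" if "is_subfield F" "{D, \<i>} \<subseteq> F" for F
    using kG.adjoin_subset_iff[OF that(1)] gaussian.adjoin_subset_iff[OF that(1)]
      is_subfield_Rats_subset[OF that(1)] that(2) by blast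
  then show "k \<subseteq> field_gen {csq (2 * p1 * p2), \<i>}" unfolding field_gen_def D_def by blast
qed

lemma field_gen_L: "field_gen {csq (2 * p1 * p2), \<i>, csq p1} = L"
proof
  show "field_gen {csq (2 * p1 * p2), \<i>, csq p1} \<subseteq> L"
    using field_gen_subset_iff[OF is_subfield_L] gens_in_L unfolding D_def P_def by simp
  have "L \<subseteq> F" if "is_subfield F" "{D, \<i>, P} \<subseteq> F" for F
    using S.adjoin_subset_iff[OF that(1)] kG.adjoin_subset_iff[OF that(1)] gaussian.adjoin_subset_iff[OF that(1)]
      is_subfield_Rats_subset[OF that(1)] that(2) by blast
  then show "L \<subseteq> field_gen {csq (2 * p1 * p2), \<i>, csq p1}" unfolding field_gen_def D_def P_def by blast
qed

end

text \<open>For \<open>p\<^sub>1 = p\<^sub>2\<close> the real quadratic field is \<open>\<rat>(\<surd>2)\<close>, whose fundamental unit is at most \<open>1 + \<surd>2\<close>.\<close>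
lemma no_square_case:
  fixes p :: nat and x y :: int
  assumes "p > 0" and f: "fundamental_unit (2 * p * p) (of_int x + of_int y * csq (2 * p * p))"
    and n: "x\<^sup>2 - int (2 * p * p) * y\<^sup>2 = 1"
  shows False
proof -
  define K where "K = adjoin \<rat> (csq (2 * p * p))"
  have K: "is_subfield K" unfolding K_def
    by (rule sqrt_adjoin.is_subfield_adjoin[OF sqrt_adjoin_csq[OF is_subfield_Rats]])
  have "csq (2 * p * p) = csq 2 * (csq p * csq p)" unfolding csq_mult by simp
  then have c: "csq (2 * p * p) = of_nat p * csq 2" unfolding csq_mult_self by simp
  have "1 + 1 / of_nat p * csq (2 * p * p) \<in> K" unfolding K_def by (rule adjoinI) (auto intro!: Rats_divide)
  then have m: "1 + csq 2 \<in> K" unfolding c using assms(1) by simp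
  have inv: "(1 + csq 2) * (csq 2 - 1) = 1" using csq_mult_self[of 2] by (simp add: algebra_simps)
  then have i: "inverse (1 + csq 2) = csq 2 - 1" by (rule inverse_unique)
  have "algebraic_int (1 + csq 2)" "algebraic_int (csq 2 - 1)"
    by (intro algebraic_int_plus algebraic_int_diff algebraic_int_csq int_imp_algebraic_int; simp)+
  moreover have "1 + csq 2 \<noteq> 0" using inv by auto
  ultimately have "unit_of K (1 + csq 2)" using m i K by (simp add: unit_of_iff del: of_nat_numeral)
  then have le: "Re (of_int x + of_int y * csq (2 * p * p)) \<le> Re (1 + csq 2)"
    by (rule fundamental_unitD(4)[OF f, folded K_def]) simp
  define s where "s = sqrt (real (2 * p * p))"
  define e where "e = of_int x + of_int y * s"
  have e1: "e > 1" using fundamental_unitD(3)[OF f] by (simp add: e_def s_def)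
  have "sqrt 2 < 2" by (rule real_less_lsqrt) auto
  then have e3: "e < 3" using le by (simp add: e_def s_def)
  have "e * (of_int x - of_int y * s) = (of_int x)\<^sup>2 - (s * s) * (of_int y)\<^sup>2"
    by (simp add: e_def algebra_simps power2_eq_square)
  also have "\<dots> = of_int (x\<^sup>2 - int (2 * p * p) * y\<^sup>2)" unfolding s_def by simp
  finally have "e * (of_int x - of_int y * s) = 1" unfolding n by simp
  then have "of_int x - of_int y * s = 1 / e" using e1 by (simp add: field_simps)
  moreover have "1 / e > 0" "1 / e < 1" using e1 by simp_all
  \<comment> \<open>Here 2 x = e + 1/e with 1 < e < 3, which leaves only x = 1; then y = 0 and e =
    1.\<close>
  ultimately have "2 * real_of_int x > 1" "2 * real_of_int x < 4" using e1 e3 unfolding e_def by linarith+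
  then have "x = 1" by linarith
  then have "y = 0" using n assms(1) by simp
  then show False using e1 \<open>x = 1\<close> by (simp add: e_def)
qed

theorem theorem29:
  fixes p1 p2 :: nat and x y :: int and \<epsilon>2 :: complex
  assumes "prime p1" and "prime p2"
    and "p1 mod 4 = 1" and "p2 mod 4 = 1"
    and "fundamental_unit (2 * p2) \<epsilon>2"
    and "fundamental_unit (2 * p1 * p2)
           (of_int x + of_int y * complex_of_real (sqrt (real (2 * p1 * p2))))"
    and "\<exists>a b :: rat. \<epsilon>2 = of_rat a + of_rat b * complex_of_real (sqrt (real (2 * p2)))
                      \<and> a\<^sup>2 - of_nat (2 * p2) * b\<^sup>2 = 1"
    and "x\<^sup>2 - int (2 * p1 * p2) * y\<^sup>2 = 1"
  shows "card (capitulation_kernel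
            (field_gen {complex_of_real (sqrt (real (2 * p1 * p2))), \<i>})
            (field_gen {complex_of_real (sqrt (real (2 * p1 * p2))), \<i>,
                        complex_of_real (sqrt (real p1))}))
         = (if (\<exists>n::nat. x + 1 = int n ^ 2 \<or> x - 1 = int n ^ 2) then 4 else 2)"
proof -
  \<comment> \<open>The locale needs distinct primes; for equal primes the hypotheses on the
    fundamental unit are contradictory.\<close>
  have "p1 \<noteq> p2"
  proof
    assume "p1 = p2"
    then show False using no_square_case[of p1 x y] assms(1,6,8) prime_gt_0_nat by simp
  qed
  then interpret biquad_units p1 p2 x y \<epsilon>2 using assms by unfold_locales
  show ?thesis unfolding field_gen_k field_gen_L capitulation_kernel_def by (rule card_kernel)
qed

end
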